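(* Let $c_1>c_2>c_3>c_4>0$, put $$d_1=c_1+c_2+c_3+c_4,\quad d_2=c_1+c_2-c_3-c_4,\quad d_3=c_1-c_2+c_3-c_4,\quad d_4=c_1-c_2-c_3+c_4,$$ $$z=\begin{pmatrix}1-\dfrac{c_4}{c_2}\dfrac{\sqrt{d_1d_3}-\sqrt{d_2d_4}}{\sqrt{d_1d_3}+\sqrt{d_2d_4}}&1-\dfrac{c_1}{c_3}\dfrac{\sqrt{d_1d_3}-\sqrt{d_2d_4}}{\sqrt{d_1d_3}+\sqrt{d_2d_4}}\\[4mm]1-\dfrac{c_1}{c_2}\dfrac{\sqrt{d_1d_2}-\sqrt{d_3d_4}}{\sqrt{d_1d_2}+\sqrt{d_3d_4}}&1-\dfrac{c_4}{c_3}\dfrac{\sqrt{d_1d_2}-\sqrt{d_3d_4}}{\sqrt{d_1d_2}+\sqrt{d_3d_4}}\end{pmatrix},$$ $$w=\begin{pmatrix}1-\dfrac{c_4}{c_2}\dfrac{\sqrt{d_1d_3}+\sqrt{d_2d_4}}{\sqrt{d_1d_3}-\sqrt{d_2d_4}}&1-\dfrac{c_1}{c_3}\dfrac{\sqrt{d_1d_3}+\sqrt{d_2d_4}}{\sqrt{d_1d_3}-\sqrt{d_2d_4}}\\[4mm]1-\dfrac{c_1}{c_2}\dfrac{\sqrt{d_1d_2}+\sqrt{d_3d_4}}{\sqrt{d_1d_2}-\sqrt{d_3d_4}}&1-\dfrac{c_4}{c_3}\dfrac{\sqrt{d_1d_2}+\sqrt{d_3d_4}}{\sqrt{d_1d_2}-\sqrt{d_3d_4}}\end{pmatrix},$$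 and $$m(z)=\begin{pmatrix}1-\dfrac{2(\sqrt{c_1c_4}+\sqrt{c_2c_3})(\sqrt{c_1c_3}-\sqrt{c_2c_4})}{(\sqrt{c_1c_2}+\sqrt{c_3c_4})d_3}&1-\dfrac{(\sqrt{c_1c_3}-\sqrt{c_2c_4})d_1}{(\sqrt{c_1c_3}+\sqrt{c_2c_4})d_3}\\[4mm]1-\dfrac{(\sqrt{c_1c_2}-\sqrt{c_3c_4})d_1}{(\sqrt{c_1c_2}+\sqrt{c_3c_4})d_2}&1-\dfrac{2(\sqrt{c_1c_4}+\sqrt{c_2c_3})(\sqrt{c_1c_2}-\sqrt{c_3c_4})}{(\sqrt{c_1c_3}+\sqrt{c_2c_4})d_2}\end{pmatrix},$$ $$m(w)=\begin{pmatrix}1-\dfrac{(\sqrt{c_1c_4}+\sqrt{c_2c_3})d_3}{2(\sqrt{c_1c_2}+\sqrt{c_3c_4})(\sqrt{c_1c_3}-\sqrt{c_2c_4})}&1-\dfrac{d_1d_3}{4(c_1c_3-c_2c_4)}\\[4mm]1-\dfrac{d_1d_2}{4(c_1c_2-c_3c_4)}&1-\dfrac{(\sqrt{c_1c_4}+\sqrt{c_2c_3})d_2}{2(\sqrt{c_1c_3}+\sqrt{c_2c_4})(\sqrt{c_1c_2}-\sqrt{c_3c_4})}\end{pmatrix}.$$ Then $$F_S(m(z))=\frac1{16}\,\frac{\sqrt{d_2d_3}\,(\sqrt{d_1d_2}-\sqrt{d_3d_4})(\sqrt{d_1d_3}-\sqrt{d_2d_4})}{\sqrt{c_2c_3}\,(\sqrt{c_1c_2}-\sqrt{c_3c_4})(\sqrt{c_1c_3}-\sqrt{c_2c_4})}\,F_S(z),$$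 $$F_S(m(w))=\frac{(\sqrt{d_1d_2}+\sqrt{d_3d_4})(\sqrt{d_1d_3}+\sqrt{d_2d_4})}{4\sqrt{c_2c_3d_2d_3}}\,F_S(w).$$
   Context: One has $d_1,d_2,d_3>0$. Square roots of nonnegative reals are nonnegative; if $d_4<0$, then $\sqrt{d_2d_4}$ and $\sqrt{d_3d_4}$ mean $\sqrt{-1}\sqrt{|d_2d_4|}$ and $\sqrt{-1}\sqrt{|d_3d_4|}$. The hypergeometric function $F_S$ of a matrix variable $z=\begin{pmatrix}z_1&z_3\\ z_2&z_4\end{pmatrix}$ is $$F_S(z)=\sum_{n\in\mathbb N^4}\frac{(\frac12)_{n_1+n_3}(\frac12)_{n_2+n_4}(\frac12)_{n_1+n_2}(\frac12)_{n_3+n_4}}{(1)_{n_1+n_3}(1)_{n_2+n_4}\,n_1!\,n_2!\,n_3!\,n_4!}\,z_1^{n_1}z_2^{n_2}z_3^{n_3}z_4^{n_4},$$ $\mathbb N=\{0,1,2,\dots\}$, $(a)_k=a(a+1)\cdots(a+k-1)$, convergent for $|z_1|+|z_2|<1$, $|z_3|+|z_4|<1$. Outside this domain $F_S(z)$ is understood through the Euler integral $$F_S(z)=\frac1{\pi^2}\int_0^1\!\!\int_0^1\frac{ds_1\,ds_2}{\sqrt{s_1(1-s_1)s_2(1-s_2)}\,(1-z_1s_1-z_2s_2)^{1/2}(1-z_3s_1-z_4s_2)^{1/2}}$$ (which equals the series on its domain of convergence), where the two linear factors are nonvanishing on $[0,1]^2$ with arguments continuous and equal to $0$ at $(s_1,s_2)=(0,0)$.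 Here $m(z)$ and $m(w)$ are just names for the displayed matrices. *)

theory Defs
  imports "HOL-Analysis.Analysis"
begin

definition FS_series :: "complex^2^2 \<Rightarrow> complex" where
  "FS_series z =
    (\<Sum>\<^sub>\<infinity>(n1, n2, n3, n4)\<in>(UNIV :: (nat \<times> nat \<times> nat \<times> nat) set).
        (pochhammer (1/2) (n1 + n3) * pochhammer (1/2) (n2 + n4)
          * pochhammer (1/2) (n1 + n2) * pochhammer (1/2) (n3 + n4))
        / (pochhammer 1 (n1 + n3) * pochhammer 1 (n2 + n4)
          * fact n1 * fact n2 * fact n3 * fact n4)
        * (z$1$1) ^ n1 * (z$2$1) ^ n2 * (z$1$2) ^ n3 * (z$2$2) ^ n4)"

abbreviation unit_square :: "(real \<times> real) set" where
  "unit_square \<equiv> {0..1} \<times> {0..1}"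

definition lin_factor :: "complex \<Rightarrow> complex \<Rightarrow> real \<times> real \<Rightarrow> complex" where
  "lin_factor a b p = 1 - a * of_real (fst p) - b * of_real (snd p)"

definition is_lin_arg :: "complex \<Rightarrow> complex \<Rightarrow> (real \<times> real \<Rightarrow> real) \<Rightarrow> bool" where
  "is_lin_arg a b \<theta> \<longleftrightarrow>
     continuous_on unit_square \<theta> \<and> \<theta> (0, 0) = 0 \<and>
     (\<forall>p\<in>unit_square. lin_factor a b p = of_real (cmod (lin_factor a b p)) * cis (\<theta> p))"

text \<open>
  When the factor has no zero on the unit square, such an argument exists and is unique there,
  and the resulting square root is the principal one; see \<open>lin_sqrt_eq_csqrt\<close> below.
\<close>
definition lin_sqrt :: "complex \<Rightarrow> complex \<Rightarrow> real \<times> real \<Rightarrow> complex" where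
  "lin_sqrt a b p =
     of_real (sqrt (cmod (lin_factor a b p))) * cis ((SOME \<theta>. is_lin_arg a b \<theta>) p / 2)"

definition FS_euler :: "complex^2^2 \<Rightarrow> complex" where
  "FS_euler z = 1 / of_real (pi ^ 2) *
     set_lebesgue_integral lborel unit_square
       (\<lambda>(s1, s2). 1 / (of_real (sqrt (s1 * (1 - s1) * s2 * (1 - s2)))
                        * lin_sqrt (z$1$1) (z$2$1) (s1, s2)
                        * lin_sqrt (z$1$2) (z$2$2) (s1, s2)))"

text \<open>
  The matrix variable has rows \<open>(z\<^sub>1, z\<^sub>3)\<close> and \<open>(z\<^sub>2, z\<^sub>4)\<close>, so that \<open>z\<^sub>2\<close> is \<open>z$2$1\<close> and
  \<open>z\<^sub>3\<close> is \<open>z$1$2\<close>.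
\<close>
definition FS :: "complex^2^2 \<Rightarrow> complex" where
  "FS z = (if cmod (z$1$1) + cmod (z$2$1) < 1 \<and> cmod (z$1$2) + cmod (z$2$2) < 1
           then FS_series z else FS_euler z)"


lemma lin_factor_not_nonpos_Reals:
  assumes nz: "\<forall>p\<in>unit_square. lin_factor a b p \<noteq> 0" and p: "p \<in> unit_square"
  shows "lin_factor a b p \<notin> \<real>\<^sub>\<le>\<^sub>0"
proof
  assume "lin_factor a b p \<in> \<real>\<^sub>\<le>\<^sub>0"
  then obtain r where r: "lin_factor a b p = of_real r" "r \<le> 0"
    by (auto elim!: nonpos_Reals_cases)
  define t where "t = 1 / (1 - r)"
  have t: "0 \<le> t" "t \<le> 1" "1 - t + t * r = 0"
    using r(2) by (auto simp: t_def field_simps)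
  have "lin_factor a b (t *\<^sub>R p) = of_real (1 - t) + of_real t * lin_factor a b p"
    by (simp add: lin_factor_def algebra_simps)
  also have "\<dots> = of_real (1 - t + t * r)"
    by (simp add: r(1))
  finally have "lin_factor a b (t *\<^sub>R p) = 0"
    using t(3) by simp
  moreover have "t *\<^sub>R p \<in> unit_square"
    using p t(1,2) by (auto simp: mult_le_one)
  ultimately show False
    using nz by metis
qed

lemma is_lin_arg_Arg:
  assumes nz: "\<forall>p\<in>unit_square. lin_factor a b p \<noteq> 0"
  shows "is_lin_arg a b (\<lambda>p. Arg (lin_factor a b p))"
  unfolding is_lin_arg_def
proof (intro conjI ballI)
  have cont: "continuous_on unit_square (lin_factor a b)"
    unfolding lin_factor_def by (intro continuous_intros)
  show "continuous_on unit_square (\<lambda>p. Arg (lin_factor a b p))"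
  proof (rule continuous_on_compose2[OF _ cont])
    show "continuous_on (lin_factor a b ` unit_square) Arg"
      using lin_factor_not_nonpos_Reals[OF nz]
      by (intro continuous_at_imp_continuous_on) (auto intro!: continuous_at_Arg)
  qed auto
  show "Arg (lin_factor a b (0, 0)) = 0"
    by (simp add: lin_factor_def)
  fix p assume "p \<in> unit_square"
  then show "lin_factor a b p
      = of_real (cmod (lin_factor a b p)) * cis (Arg (lin_factor a b p))"
    by (metis rcis_cmod_Arg rcis_def)
qed

lemma is_lin_arg_unique:
  assumes nz: "\<forall>p\<in>unit_square. lin_factor a b p \<noteq> 0"
    and \<theta>: "is_lin_arg a b \<theta>" and \<phi>: "is_lin_arg a b \<phi>" and p: "p \<in> unit_square"
  shows "\<theta> p = \<phi> p"
proof -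
  define g where "g = (\<lambda>p. (\<theta> p - \<phi> p) / (2 * pi))"
  have cont: "continuous_on unit_square g"
    using \<theta> \<phi> unfolding g_def is_lin_arg_def by (intro continuous_intros) auto
  have gint: "g q \<in> \<int>" if q: "q \<in> unit_square" for q
  proof -
    have "of_real (cmod (lin_factor a b q)) * cis (\<theta> q)
        = of_real (cmod (lin_factor a b q)) * cis (\<phi> q)"
      using \<theta> \<phi> q unfolding is_lin_arg_def by metis
    then have "cis (\<theta> q) = cis (\<phi> q)"
      using nz q by simp
    then have "cis (\<theta> q - \<phi> q) = 1"
      by (simp flip: cis_divide)
    then have "cos (\<theta> q - \<phi> q) = 1"
      by (metis cis.sel(1) one_complex.sel(1))
    then obtain n :: int where "\<theta> q - \<phi> q = of_int n * 2 * pi"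
      unfolding cos_one_2pi_int by blast
    then show ?thesis
      by (simp add: g_def)
  qed
  have "g constant_on unit_square"
  proof (rule continuous_discrete_range_constant[OF _ cont])
    show "connected unit_square"
      by (intro connected_Times) auto
    fix q :: "real \<times> real" assume q: "q \<in> unit_square"
    show "\<exists>e>0. \<forall>q'. q' \<in> unit_square \<and> g q' \<noteq> g q \<longrightarrow> e \<le> norm (g q' - g q)"
    proof (intro exI[of _ 1] conjI allI impI)
      fix q' assume q': "q' \<in> unit_square \<and> g q' \<noteq> g q"
      then have "g q' - g q \<in> \<int>" "g q' - g q \<noteq> 0"
        using gint q by auto
      then show "1 \<le> norm (g q' - g q)"
        by (simp add: Ints_nonzero_abs_ge1)
    qed simp
  qed
  then have "g p = g (0, 0)"
    using p unfolding constant_on_def by fastforce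
  also have "\<dots> = 0"
    using \<theta> \<phi> by (simp add: g_def is_lin_arg_def)
  finally show ?thesis
    by (simp add: g_def)
qed

lemma lin_sqrt_eq_csqrt:
  assumes nz: "\<forall>p\<in>unit_square. lin_factor a b p \<noteq> 0" and p: "p \<in> unit_square"
  shows "lin_sqrt a b p = csqrt (lin_factor a b p)"
proof -
  have "is_lin_arg a b (SOME \<theta>. is_lin_arg a b \<theta>)"
    using is_lin_arg_Arg[OF nz] by (rule someI[where P = "is_lin_arg a b"])
  then have "(SOME \<theta>. is_lin_arg a b \<theta>) p = Arg (lin_factor a b p)"
    using is_lin_arg_unique[OF nz _ is_lin_arg_Arg[OF nz] p] by blast
  moreover have "csqrt (lin_factor a b p)
      = of_real (sqrt (cmod (lin_factor a b p))) * cis (Arg (lin_factor a b p) / 2)"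
  proof -
    have "cmod (csqrt (lin_factor a b p)) ^ 2 = cmod (lin_factor a b p)"
      by (simp flip: norm_power)
    then have "cmod (csqrt (lin_factor a b p)) = sqrt (cmod (lin_factor a b p))"
      by (metis norm_ge_zero real_sqrt_unique)
    then show ?thesis
      by (metis Arg_csqrt rcis_cmod_Arg rcis_def)
  qed
  ultimately show ?thesis
    by (simp add: lin_sqrt_def)
qed

end

theory Submission
  imports Defs "HOL-Complex_Analysis.Cauchy_Integral_Theorem"
begin

text \<open>
  Put \<open>s\<^sub>1 = x / (1 + x)\<close> and \<open>s\<^sub>2 = y / (1 + y)\<close> in the Euler integral of \<open>F\<^sub>S(z)\<close>.  It becomes the
  integral of \<open>dx dy / sqrt (x y L\<^sub>1 L\<^sub>2)\<close> over the positive quadrant, where \<open>L\<^sub>1\<close> and \<open>L\<^sub>2\<close> are bilinear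
  in \<open>x\<close> and \<open>y\<close>.  Let \<open>\<rho>\<close> and \<open>\<sigma>\<close> be the two quotients of square roots in the entries of \<open>z\<close>.  They satisfy
  \<open>c\<^sub>4 \<rho> + c\<^sub>1 \<sigma> - c\<^sub>2 = c\<^sub>3 \<rho> \<sigma>\<close> and \<open>c\<^sub>1 \<rho> + c\<^sub>4 \<sigma> - c\<^sub>3 = c\<^sub>2 \<rho> \<sigma>\<close>, which say exactly that after the
  substitution \<open>x \<mapsto> x / \<rho>\<close>, \<open>y \<mapsto> y / \<sigma>\<close> the two bilinear forms are, up to constant factors,
  \<open>c\<^sub>2 + c\<^sub>4 x + c\<^sub>1 y + c\<^sub>3 x y\<close> and \<open>c\<^sub>3 + c\<^sub>1 x + c\<^sub>4 y + c\<^sub>2 x y\<close>.  Hence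
  \<open>F\<^sub>S(z) = sqrt (c\<^sub>2 c\<^sub>3) / (\<pi>\<^sup>2 sqrt (\<rho> \<sigma>)) J(c)\<close>, where \<open>J(c)\<close> (\<open>borchardt_integral\<close>) depends on \<open>c\<close> only.
  The matrix \<open>w\<close> comes from \<open>1 / \<rho>\<close> and \<open>1 / \<sigma>\<close>, which satisfy the same two relations with their order
  exchanged, and so it has the same \<open>J(c)\<close>.  If \<open>d\<^sub>4 < 0\<close>, then \<open>\<rho>\<close> and \<open>\<sigma>\<close> have modulus 1 and the substitution
  rotates the contours; this is legitimate because \<open>\<bar>d\<^sub>4\<bar> < d\<^sub>1\<close> gives \<open>\<bar>Arg \<rho>\<bar> + \<bar>Arg \<sigma>\<bar> < \<pi>\<close>, which keeps all the
  terms of each form inside an open half-plane (\<open>kummer_kernel_shift\<close>, \<open>FS_euler_eq_borchardt_integral\<close>).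

  The matrices \<open>m(z)\<close> and \<open>m(w)\<close> are of the same shape for the four means \<open>c'\<close> of Borchardt:
  with \<open>c\<^sub>1 = a\<^sup>2\<close>, \<open>c\<^sub>2 = b\<^sup>2\<close>, \<open>c\<^sub>3 = c\<^sup>2\<close>, \<open>c\<^sub>4 = d\<^sup>2\<close> they belong to
  \<open>c'\<^sub>1 = (a\<^sup>2 + b\<^sup>2 + c\<^sup>2 + d\<^sup>2) / 4\<close>, \<open>c'\<^sub>2 = (a b + c d) / 2\<close>, \<open>c'\<^sub>3 = (a c + b d) / 2\<close>,
  \<open>c'\<^sub>4 = (a d + b c) / 2\<close>.  So both identities say that \<open>J(c') = J(c)\<close>
  (\<open>borchardt_integral_mean_invariant\<close>); the factors in front are algebra with square roots.

  To see \<open>J(c') = J(c)\<close>, write \<open>M\<close> for the arithmetic-geometric mean of two numbers.  Integrating out one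
  variable of \<open>J(c)\<close> leaves an integral over the line of \<open>\<pi> / M(sqrt p, sqrt q)\<close> with
  \<open>p = c\<^sub>1\<^sup>2 + c\<^sub>2\<^sup>2 + 2 c\<^sub>1 c\<^sub>2 cosh v\<close> and \<open>q = c\<^sub>3\<^sup>2 + c\<^sub>4\<^sup>2 + 2 c\<^sub>3 c\<^sub>4 cosh v\<close>.  Integrating in the other order, and
  passing to an angle \<open>\<phi>\<close>, gives an integral over the circle of \<open>\<pi> / M(\<bar>f\<bar>, \<bar>g\<bar>)\<close> with
  \<open>f = e\<^sub>1 + e\<^sub>3 exp (\<i> \<phi>)\<close> and \<open>g = e\<^sub>2 + e\<^sub>4 exp (\<i> \<phi>)\<close>, where \<open>e\<^sub>1 = 2 c'\<^sub>1\<close> and \<open>e\<^sub>2 = 2 c'\<^sub>2\<close>.  Now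
  \<open>\<pi> / M(\<bar>f\<bar>, \<bar>g\<bar>)\<close> is the integral over \<open>u\<close> of the inverse square root of
  \<open>(f + g exp u) (cnj f + cnj g exp (- u))\<close>: a shift of \<open>u\<close> by an imaginary constant removes the arguments of
  \<open>f\<close> and \<open>g\<close>.  The same product is bilinear in \<open>exp (\<i> \<phi>)\<close>, and an imaginary shift of \<open>\<phi>\<close> symmetrizes it
  there; exchanging the two integrations (\<open>line_circle_exchange\<close>) leaves an integral over a circle that one
  step of the Gauss-Landen transformation evaluates, and the result is the fibre integral of \<open>J(c')\<close>.
\<close>

section \<open>Change of variables and contour shifts\<close>

text \<open>
  Applied to indicator functions, the change of variables theorem for absolutely integrable functions says
  that two measures agree; this lets extended nonnegative functions be integrated
  against both.
\<close>
lemma nn_integral_change_of_variables: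
  fixes g g' :: "real \<Rightarrow> real" and f :: "real \<Rightarrow> ennreal"
  assumes S[measurable]: "S \<in> sets borel" and T[measurable]: "T \<in> sets borel"
    and g[measurable]: "g \<in> borel_measurable borel" and g'[measurable]: "g' \<in> borel_measurable borel"
    and der: "\<And>x. x \<in> S \<Longrightarrow> (g has_real_derivative g' x) (at x)"
    and pos: "\<And>x. x \<in> S \<Longrightarrow> 0 \<le> g' x"
    and inj: "inj_on g S" and im: "g ` S = T"
    and f[measurable]: "f \<in> borel_measurable borel"
  shows "(\<integral>\<^sup>+y\<in>T. f y \<partial>lborel) = (\<integral>\<^sup>+x\<in>S. f (g x) * ennreal (g' x) \<partial>lborel)"
proof -
  define M where "M = distr (density lborel (\<lambda>x. ennreal (g' x) * indicator S x)) borel g"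
  have "density lborel (indicator T) = M"
  proof (rule measure_eqI)
    show "sets (density lborel (indicator T)) = sets M"
      by (simp add: M_def)
    fix A assume "A \<in> sets (density lborel (indicator T))"
    then have A[measurable]: "A \<in> sets borel" by simp
    define h :: "real \<Rightarrow> real" where "h = indicator A"
    have h[measurable]: "h \<in> borel_measurable borel" by (simp add: h_def)
    have l: "emeasure (density lborel (indicator T)) A = (\<integral>\<^sup>+y. ennreal (indicator T y * h y) \<partial>lborel)"
      by (subst emeasure_density) (auto simp: h_def indicator_def intro!: nn_integral_cong)
    have r: "emeasure M A = (\<integral>\<^sup>+x. ennreal (indicator S x * (\<bar>g' x\<bar> * h (g x))) \<partial>lborel)"
      unfolding M_def
      using measurable_sets_borel[OF g A]
      by (subst emeasure_distr, simp, simp, subst emeasure_density)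
         (auto simp: h_def indicator_def pos intro!: nn_integral_cong)
    have SL: "S \<in> sets lebesgue" by simp
    have key: "h absolutely_integrable_on T \<and> integral T h = b \<longleftrightarrow>
       (\<lambda>x. \<bar>g' x\<bar> * h (g x)) absolutely_integrable_on S \<and> integral S (\<lambda>x. \<bar>g' x\<bar> * h (g x)) = b" for b
      using has_absolute_integral_change_of_variables_1'[OF SL DERIV_subset[OF der] inj, of h b] im by auto
    have eqL: "u absolutely_integrable_on U \<longleftrightarrow> (\<integral>\<^sup>+x. ennreal (indicator U x * u x) \<partial>lborel) < \<infinity>"
      and eqI: "u absolutely_integrable_on U \<Longrightarrow> (\<integral>\<^sup>+x. ennreal (indicator U x * u x) \<partial>lborel) = ennreal (integral U u)"
      if [measurable]: "u \<in> borel_measurable borel" "U \<in> sets borel" and nn: "\<And>x. x \<in> U \<Longrightarrow> 0 \<le> u x" for u :: "real \<Rightarrow> real" and U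
    proof -
      have nn': "0 \<le> indicator U x * u x" for x using nn by (auto simp: indicator_def)
      have "u absolutely_integrable_on U \<longleftrightarrow> integrable lborel (\<lambda>x. indicator U x * u x)"
        unfolding set_integrable_def real_scaleR_def
        by (rule integrable_completion) measurable
      also have "\<dots> \<longleftrightarrow> (\<integral>\<^sup>+x. ennreal (indicator U x * u x) \<partial>lborel) < \<infinity>"
        using nn' by (subst integrable_iff_bounded) (simp add: abs_of_nonneg)
      finally show 1: "u absolutely_integrable_on U \<longleftrightarrow> (\<integral>\<^sup>+x. ennreal (indicator U x * u x) \<partial>lborel) < \<infinity>" .
      assume ai: "u absolutely_integrable_on U"
      then have i: "integrable lborel (\<lambda>x. indicator U x * u x)"
        unfolding set_integrable_def real_scaleR_def by (subst (asm) integrable_completion) measurable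
      have "(\<integral>\<^sup>+x. ennreal (indicator U x * u x) \<partial>lborel) = ennreal (\<integral>x. indicator U x * u x \<partial>lborel)"
        by (rule nn_integral_eq_integral[OF i]) (use nn' in auto)
      also have "(\<integral>x. indicator U x * u x \<partial>lborel) = (LINT x:U|lebesgue. u x)"
        unfolding set_lebesgue_integral_def real_scaleR_def by (rule integral_completion[symmetric]) measurable
      also have "\<dots> = integral U u"
        by (rule set_lebesgue_integral_eq_integral[OF ai])
      finally show "(\<integral>\<^sup>+x. ennreal (indicator U x * u x) \<partial>lborel) = ennreal (integral U u)" .
    qed
    have n1: "0 \<le> h y" "0 \<le> \<bar>g' x\<bar> * h (g x)" for x y by (auto simp: h_def)
    show "emeasure (density lborel (indicator T)) A = emeasure M A"
    proof (cases "h absolutely_integrable_on T")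
      case True
      then have "(\<lambda>x. \<bar>g' x\<bar> * h (g x)) absolutely_integrable_on S"
        "integral S (\<lambda>x. \<bar>g' x\<bar> * h (g x)) = integral T h"
        using key by blast+
      then show ?thesis
        unfolding l r using eqI[of h T] eqI[of "\<lambda>x. \<bar>g' x\<bar> * h (g x)" S] True n1 by simp
    next
      case False
      then have "\<not> (\<lambda>x. \<bar>g' x\<bar> * h (g x)) absolutely_integrable_on S"
        using key by blast
      then show ?thesis
        unfolding l r using eqL[of h T] eqL[of "\<lambda>x. \<bar>g' x\<bar> * h (g x)" S] False n1
        by (auto simp: top.not_eq_extremum[symmetric])
    qed
  qed
  then have "(\<integral>\<^sup>+y. f y \<partial>density lborel (indicator T)) = (\<integral>\<^sup>+y. f y \<partial>M)" by simp
  then show ?thesis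
    unfolding M_def
    by (subst (asm) nn_integral_density, simp, simp, subst (asm) nn_integral_distr, simp, simp,
        subst (asm) nn_integral_density) (auto simp: mult_ac)
qed

lemma open_strip: "open {w. \<bar>Im w\<bar> < r}" and convex_strip: "convex {w. \<bar>Im w\<bar> < r}"
proof -
  have *: "{w. \<bar>Im w\<bar> < r} = {w. Im w < r} \<inter> {w. Im w > -r}" by auto
  show "open {w. \<bar>Im w\<bar> < r}" unfolding *
    by (intro open_Int open_halfspace_Im_lt open_halfspace_Im_gt)
  show "convex {w. \<bar>Im w\<bar> < r}" unfolding *
    by (intro convex_Int convex_halfspace_Im_lt convex_halfspace_Im_gt)
qed

lemma strip_primitive:
  assumes "h holomorphic_on {w. \<bar>Im w\<bar> < r}"
  obtains H where "\<And>w. \<bar>Im w\<bar> < r \<Longrightarrow> (H has_field_derivative h w) (at w)"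
proof -
  obtain H where H: "\<And>w. w \<in> {w. \<bar>Im w\<bar> < r} \<Longrightarrow> (H has_field_derivative h w) (at w within {w. \<bar>Im w\<bar> < r})"
    using holomorphic_convex_primitive'[OF convex_strip open_strip assms] by blast
  have "(H has_field_derivative h w) (at w)" if w: "\<bar>Im w\<bar> < r" for w
  proof -
    have w': "w \<in> {w. \<bar>Im w\<bar> < r}" using w by simp
    show ?thesis using H[OF w'] unfolding at_within_open[OF w' open_strip] .
  qed
  then show thesis by (rule that)
qed

text \<open>
  A primitive on the strip turns the difference of the two integrals over \<open>{-n..n}\<close> into its increments over
  the two short sides, and the decay of \<open>h\<close> makes these vanish as \<open>n\<close> grows.
\<close>
lemma integral_strip_shift:
  fixes h :: "complex \<Rightarrow> complex" and l :: complex
  assumes hol: "h holomorphic_on {w. \<bar>Im w\<bar> < r}" and r: "\<bar>Im l\<bar> < r"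
    and int0: "integrable lborel (\<lambda>u::real. h (of_real u))"
    and int1: "integrable lborel (\<lambda>u::real. h (of_real u + l))"
    and bound: "\<And>w. \<bar>Im w\<bar> \<le> \<bar>Im l\<bar> \<Longrightarrow> cmod (h w) \<le> C * exp (- \<bar>Re w\<bar> * \<delta>)" and \<delta>: "\<delta> > 0"
  shows "(\<integral>u. h (of_real u + l) \<partial>lborel) = (\<integral>u. h (of_real u) \<partial>lborel)"
proof -
  obtain H where H': "\<And>w. \<bar>Im w\<bar> < r \<Longrightarrow> (H has_field_derivative h w) (at w)"
    using strip_primitive[OF hol] by blast
  have ftc: "(LBINT u:{-real n..real n}. h (of_real u + \<mu>)) = H (of_real n + \<mu>) - H (- of_real n + \<mu>)"
    if \<mu>: "\<bar>Im \<mu>\<bar> < r" and int: "integrable lborel (\<lambda>u::real. h (of_real u + \<mu>))" for \<mu> n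
  proof -
    have "((\<lambda>u. h (of_real u + \<mu>)) has_integral (H (of_real (real n) + \<mu>) - H (of_real (- real n) + \<mu>))) {-real n..real n}"
    proof (rule fundamental_theorem_of_calculus)
      fix x :: real
      have d: "(H has_field_derivative h (of_real x + \<mu>)) (at (of_real x + \<mu>))"
        using \<mu> by (intro H') auto
      have "((\<lambda>w. H (w + \<mu>)) has_field_derivative h (of_real x + \<mu>)) (at (of_real x))"
        by (rule DERIV_shift[THEN iffD1, OF d])
      then show "((\<lambda>u. H (of_real u + \<mu>)) has_vector_derivative h (of_real x + \<mu>)) (at x within {- real n..real n})"
        using has_vector_derivative_real_field has_vector_derivative_at_within by blast
    qed simp
    moreover have "(LBINT u:{-real n..real n}. h (of_real u + \<mu>)) = integral {-real n..real n} (\<lambda>u. h (of_real u + \<mu>))"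
      by (rule set_borel_integral_eq_integral(2))
         (use int in \<open>auto simp: set_integrable_def intro!: integrable_mult_indicator\<close>)
    ultimately show ?thesis by (simp add: integral_unique)
  qed
  have lim: "(\<lambda>n. LBINT u:{-real n..real n}. f u) \<longlonglongrightarrow> (\<integral>u. f u \<partial>lborel)"
    if f: "integrable lborel f" for f :: "real \<Rightarrow> complex"
  proof -
    have "(\<lambda>n. LBINT u:{-real n..real n}. f u) \<longlonglongrightarrow> (LBINT u:(\<Union>n. {-real n..real n}). f u)"
    proof (rule set_integral_cont_up)
      show "incseq (\<lambda>n. {-real n..real n})" by (auto simp: incseq_def)
      show "set_integrable lborel (\<Union>n. {- real n..real n}) f"
        using f by (auto simp: set_integrable_def intro!: integrable_mult_indicator)
    qed auto
    moreover have "(\<Union>n. {-real n..real n}) = UNIV"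
    proof -
      have "\<exists>n. x \<in> {-real n..real n}" for x
        using real_arch_simple[of "\<bar>x\<bar>"] by (auto simp: abs_le_iff minus_le_iff)
      then show ?thesis by blast
    qed
    ultimately show ?thesis by (simp add: set_lebesgue_integral_def)
  qed
  have side: "(\<lambda>n. H (x n + l) - H (x n)) \<longlonglongrightarrow> 0"
    if x: "\<And>n. x n = of_real (y n)" "\<And>n. \<bar>y n\<bar> = real n" for x :: "nat \<Rightarrow> complex" and y :: "nat \<Rightarrow> real"
  proof (rule Lim_null_comparison)
    show "\<forall>\<^sub>F n in sequentially. norm (H (x n + l) - H (x n)) \<le> C * exp (\<bar>Re l\<bar> * \<delta>) * exp (- real n * \<delta>) * cmod l"
    proof (rule always_eventually, rule allI)
      fix n
      have "norm (H (x n + l) - H (x n)) \<le> C * exp (\<bar>Re l\<bar> * \<delta>) * exp (- real n * \<delta>) * norm ((x n + l) - x n)"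
      proof (rule field_differentiable_bound)
        show "convex (closed_segment (x n) (x n + l))" by simp
        fix z assume "z \<in> closed_segment (x n) (x n + l)"
        then obtain t where t: "0 \<le> t" "t \<le> 1" "z = x n + of_real t * l"
          by (auto simp: closed_segment_def scaleR_conv_of_real algebra_simps)
        have im: "\<bar>Im z\<bar> \<le> \<bar>Im l\<bar>"
          using t by (simp add: x abs_mult mult_left_le_one_le)
        have re: "real n - \<bar>Re l\<bar> \<le> \<bar>Re z\<bar>"
        proof -
          have "\<bar>t * Re l\<bar> \<le> \<bar>Re l\<bar>" using t by (simp add: abs_mult mult_left_le_one_le)
          then show ?thesis using t x(2)[of n] by (simp add: x(1))
        qed
        show "(H has_field_derivative h z) (at z within closed_segment (x n) (x n + l))"
          using im r by (intro has_field_derivative_at_within[OF H']) auto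
        have C: "C \<ge> 0"
        proof -
          have "0 \<le> C * exp (- \<bar>Re z\<bar> * \<delta>)" using bound[OF im] norm_ge_zero order_trans by blast
          then show ?thesis by (simp add: zero_le_mult_iff)
        qed
        have "cmod (h z) \<le> C * exp (- \<bar>Re z\<bar> * \<delta>)" by (rule bound[OF im])
        also have "\<dots> \<le> C * exp (\<bar>Re l\<bar> * \<delta> + - real n * \<delta>)"
        proof (intro mult_left_mono C)
          have "(real n - \<bar>Re l\<bar>) * \<delta> \<le> \<bar>Re z\<bar> * \<delta>" using re \<delta> by (intro mult_right_mono) auto
          then show "exp (- \<bar>Re z\<bar> * \<delta>) \<le> exp (\<bar>Re l\<bar> * \<delta> + - real n * \<delta>)" by (simp add: algebra_simps)
        qed
        finally show "norm (h z) \<le> C * exp (\<bar>Re l\<bar> * \<delta>) * exp (- real n * \<delta>)"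
          by (simp only: exp_add mult.assoc)
      qed auto
      then show "norm (H (x n + l) - H (x n)) \<le> C * exp (\<bar>Re l\<bar> * \<delta>) * exp (- real n * \<delta>) * cmod l" by simp
    qed
    have "(\<lambda>n. exp (- \<delta>) ^ n) \<longlonglongrightarrow> 0" using \<delta> by (intro LIMSEQ_power_zero) simp
    then have "(\<lambda>n. exp (- real n * \<delta>)) \<longlonglongrightarrow> 0" by (simp add: exp_of_nat_mult[symmetric] mult_ac)
    from tendsto_mult[OF tendsto_const[of "C * exp (\<bar>Re l\<bar> * \<delta>)"] tendsto_mult[OF this tendsto_const[of "cmod l"]]]
    show "(\<lambda>n. C * exp (\<bar>Re l\<bar> * \<delta>) * exp (- real n * \<delta>) * cmod l) \<longlonglongrightarrow> 0" by (simp add: mult_ac)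
  qed
  have s1: "(\<lambda>n. H (of_nat n + l) - H (of_nat n)) \<longlonglongrightarrow> 0"
    by (rule side[of _ "\<lambda>n. real n"]) auto
  have s2: "(\<lambda>n. H (- of_nat n + l) - H (- of_nat n)) \<longlonglongrightarrow> 0"
    by (rule side[of _ "\<lambda>n. - real n"]) auto
  have "(\<lambda>n. (H (of_nat n + l) - H (of_nat n)) - (H (- of_nat n + l) - H (- of_nat n))) \<longlonglongrightarrow> 0 - 0"
    by (rule tendsto_diff[OF s1 s2])
  moreover have "(\<lambda>n. (H (of_nat n + l) - H (of_nat n)) - (H (- of_nat n + l) - H (- of_nat n))) =
      (\<lambda>n. (LBINT u:{-real n..real n}. h (of_real u + l)) - (LBINT u:{-real n..real n}. h (of_real u)))"
    using ftc[OF r int1] ftc[of 0] int0 r by (auto simp: fun_eq_iff)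
  moreover have "(\<lambda>n. (LBINT u:{-real n..real n}. h (of_real u + l)) - (LBINT u:{-real n..real n}. h (of_real u)))
     \<longlonglongrightarrow> (\<integral>u. h (of_real u + l) \<partial>lborel) - (\<integral>u. h (of_real u) \<partial>lborel)"
    by (intro tendsto_diff lim int0 int1)
  ultimately have "(\<integral>u. h (of_real u + l) \<partial>lborel) - (\<integral>u. h (of_real u) \<partial>lborel) = 0"
    using LIMSEQ_unique by fastforce
  then show ?thesis by simp
qed

text \<open>
  The increment over one period of a primitive of a periodic function is constant on the strip.
\<close>
lemma integral_periodic_shift:
  fixes h :: "complex \<Rightarrow> complex" and a p :: real and l :: complex
  assumes hol: "h holomorphic_on {w. \<bar>Im w\<bar> < r}" and r: "\<bar>Im l\<bar> < r"
    and per: "\<And>w. h (w + of_real p) = h w" and p: "0 \<le> p"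
  shows "integral {a..a+p} (\<lambda>u. h (of_real u + l)) = integral {a..a+p} (\<lambda>u. h (of_real u))"
proof -
  obtain H where H': "\<And>w. \<bar>Im w\<bar> < r \<Longrightarrow> (H has_field_derivative h w) (at w)"
    using strip_primitive[OF hol] by blast
  have ftc: "integral {a..a+p} (\<lambda>u. h (of_real u + \<mu>)) = H (of_real (a + p) + \<mu>) - H (of_real a + \<mu>)"
    if \<mu>: "\<bar>Im \<mu>\<bar> < r" for \<mu>
  proof (intro integral_unique fundamental_theorem_of_calculus)
    fix x :: real
    have d: "(H has_field_derivative h (of_real x + \<mu>)) (at (of_real x + \<mu>))"
      using \<mu> by (intro H') auto
    have "((\<lambda>w. H (w + \<mu>)) has_field_derivative h (of_real x + \<mu>)) (at (of_real x))"
      by (rule DERIV_shift[THEN iffD1, OF d])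
    then show "((\<lambda>u. H (of_real u + \<mu>)) has_vector_derivative h (of_real x + \<mu>)) (at x within {a..a+p})"
      using has_vector_derivative_real_field has_vector_derivative_at_within by blast
  qed (use p in simp)
  have "(\<lambda>w. H (w + of_real p) - H w) constant_on {w. \<bar>Im w\<bar> < r}"
  proof (rule has_field_derivative_0_imp_constant_on)
    fix z assume "z \<in> {w. \<bar>Im w\<bar> < r}"
    then have z: "\<bar>Im z\<bar> < r" by simp
    have d: "(H has_field_derivative h (z + of_real p)) (at (z + of_real p))"
      using z by (intro H') auto
    have "((\<lambda>w. H (w + of_real p)) has_field_derivative h (z + of_real p)) (at z)"
      by (rule DERIV_shift[THEN iffD1, OF d])
    from DERIV_diff[OF this H'[OF z]] show "((\<lambda>w. H (w + of_real p) - H w) has_field_derivative 0) (at z)"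
      by (simp add: per)
  qed (use open_strip convex_strip convex_connected in blast)+
  then have "H (of_real a + l + of_real p) - H (of_real a + l) = H (of_real a + of_real p) - H (of_real a)"
    using r unfolding constant_on_def by fastforce
  then show ?thesis
    using ftc[OF r] ftc[of 0] r by (simp add: add_ac)
qed

section \<open>Elliptic integrals as arithmetic-geometric means\<close>

text \<open>
  This is \<open>\<pi> / M(sqrt p, sqrt q)\<close> for the arithmetic-geometric mean \<open>M\<close>: the integral of
  \<open>dx / sqrt (x (1 + x) (p + q x))\<close> over \<open>x > 0\<close> in the variable \<open>t = ln x\<close>.  It takes extended nonnegative
  values so that integrals of it can be exchanged freely.
\<close>
definition agm_period :: "real \<Rightarrow> real \<Rightarrow> ennreal" where
  "agm_period p q = (\<integral>\<^sup>+t. ennreal (1 / sqrt ((1 + exp (- t)) * (p + q * exp t))) \<partial>lborel)"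

text \<open>
  Only the products \<open>F F'\<close> and \<open>G G'\<close> survive because the translation by \<open>ln (F' / G')\<close> absorbs the rest.
\<close>
lemma agm_period_eq_bilinear:
  assumes pos: "F > 0" "G > 0" "F' > 0" "G' > 0"
  shows "(\<integral>\<^sup>+u. ennreal (1 / sqrt ((F + G * exp u) * (F' + G' * exp (- u)))) \<partial>lborel) = agm_period (F * F') (G * G')"
proof -
  have e: "exp (ln (F' / G')) = F' / G'" using pos by simp
  have "(1 + exp (- (ln (F' / G') + u))) * (F * F' + G * G' * exp (ln (F' / G') + u))
      = (F + G * exp u) * (F' + G' * exp (- u))" for u
    unfolding minus_add_distrib exp_add exp_minus e using pos by (simp add: field_simps)
  then show ?thesis
    unfolding agm_period_def by (subst nn_integral_real_affine[where c = 1 and t = "ln (F' / G')"]) simp_all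
qed

lemma agm_period_eq_cosh:
  assumes pos: "a > 0" "b > 0"
  shows "(\<integral>\<^sup>+u. ennreal (1 / sqrt (a\<^sup>2 + b\<^sup>2 + 2 * a * b * cosh u)) \<partial>lborel) = agm_period (a\<^sup>2) (b\<^sup>2)"
proof -
  have "(a + b * exp u) * (a + b * exp (- u)) = a\<^sup>2 + b\<^sup>2 + 2 * a * b * cosh u" for u
    by (simp add: cosh_def exp_minus field_simps power2_eq_square)
  then show ?thesis
    using agm_period_eq_bilinear[OF pos pos] by (simp add: power2_eq_square)
qed

lemma agm_period_scale:
  assumes "k > 0"
  shows "agm_period (k * p) (k * q) = ennreal (1 / sqrt k) * agm_period p q"
proof -
  have "1 / sqrt ((1 + exp (- t)) * (k * p + k * q * exp t))
     = 1 / sqrt k * (1 / sqrt ((1 + exp (- t)) * (p + q * exp t)))" for t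
  proof -
    have "(1 + exp (- t)) * (k * p + k * q * exp t) = k * ((1 + exp (- t)) * (p + q * exp t))"
      by (simp add: algebra_simps)
    then show ?thesis by (simp only: real_sqrt_mult[of k] times_divide_times_eq mult_1_left)
  qed
  then have "ennreal (1 / sqrt ((1 + exp (- t)) * (k * p + k * q * exp t)))
     = ennreal (1 / sqrt k) * ennreal (1 / sqrt ((1 + exp (- t)) * (p + q * exp t)))" for t
    using assms by (subst ennreal_mult'[symmetric]) auto
  then show ?thesis
    unfolding agm_period_def by (simp add: nn_integral_cmult)
qed

lemma borel_measurable_sinh[measurable]: "(sinh :: real \<Rightarrow> real) \<in> borel_measurable borel"
  and borel_measurable_cosh[measurable]: "(cosh :: real \<Rightarrow> real) \<in> borel_measurable borel"
  by (auto intro!: borel_measurable_continuous_onI continuous_intros)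

lemma borel_measurable_arsinh[measurable]: "(arsinh :: real \<Rightarrow> real) \<in> borel_measurable borel"
proof -
  have "(arsinh :: real \<Rightarrow> real) = (\<lambda>x. ln (x + sqrt (x\<^sup>2 + 1)))"
    by (rule ext) (rule arsinh_real_def)
  then show ?thesis by (rule ssubst) measurable
qed

lemma borel_measurable_agm_period[measurable]:
  assumes [measurable]: "p \<in> borel_measurable borel" "q \<in> borel_measurable borel"
  shows "(\<lambda>x::real. agm_period (p x) (q x)) \<in> borel_measurable borel"
  unfolding agm_period_def by measurable

lemma nn_integral_even:
  fixes f :: "real \<Rightarrow> ennreal"
  assumes [measurable]: "f \<in> borel_measurable borel" and ev: "\<And>x. f (- x) = f x"
  shows "(\<integral>\<^sup>+x\<in>{-a<..<a}. f x \<partial>lborel) = 2 * (\<integral>\<^sup>+x\<in>{0<..<a}. f x \<partial>lborel)"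
    "(\<integral>\<^sup>+x. f x \<partial>lborel) = 2 * (\<integral>\<^sup>+x\<in>{0<..}. f x \<partial>lborel)"
proof -
  have gen: "(\<integral>\<^sup>+x\<in>A. f x \<partial>lborel) = 2 * (\<integral>\<^sup>+x\<in>(A \<inter> {0<..}). f x \<partial>lborel)"
    if [measurable]: "A \<in> sets borel" and A: "\<And>x. - x \<in> A \<longleftrightarrow> x \<in> A" for A
  proof -
    have "(\<integral>\<^sup>+x\<in>A. f x \<partial>lborel)
        = (\<integral>\<^sup>+x. f x * indicator (A \<inter> {0<..}) x + f x * indicator (A \<inter> {..<0}) x \<partial>lborel)"
      by (intro nn_integral_cong_AE)
         (use AE_lborel_singleton[of "0::real"] in \<open>eventually_elim, auto simp: indicator_def\<close>)
    also have "\<dots> = (\<integral>\<^sup>+x. f x * indicator (A \<inter> {0<..}) x \<partial>lborel) + (\<integral>\<^sup>+x. f x * indicator (A \<inter> {..<0}) x \<partial>lborel)"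
      by (rule nn_integral_add) measurable
    also have "(\<integral>\<^sup>+x. f x * indicator (A \<inter> {..<0}) x \<partial>lborel) = (\<integral>\<^sup>+x. f x * indicator (A \<inter> {0<..}) x \<partial>lborel)"
      by (subst nn_integral_real_affine[where c = "-1" and t = 0])
         (auto simp: ev A indicator_def intro!: nn_integral_cong)
    finally show ?thesis by (simp add: mult_2)
  qed
  show "(\<integral>\<^sup>+x\<in>{-a<..<a}. f x \<partial>lborel) = 2 * (\<integral>\<^sup>+x\<in>{0<..<a}. f x \<partial>lborel)"
  proof -
    have "{-a<..<a} \<inter> {0<..} = {0<..<a}" by auto
    then show ?thesis using gen[of "{-a<..<a}"] by (simp add: less_minus_iff minus_less_iff conj_commute)
  qed
  show "(\<integral>\<^sup>+x. f x \<partial>lborel) = 2 * (\<integral>\<^sup>+x\<in>{0<..}. f x \<partial>lborel)"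
    using gen[of UNIV] by simp
qed

lemma arsinh_image: "(\<lambda>t::real. 2 * arsinh (exp (t / 2))) ` UNIV = {0<..}"
proof (intro equalityI subsetI)
  fix v :: real assume "v \<in> {0<..}"
  then have v: "v > 0" by simp
  then have s: "sinh (v / 2) > 0" by simp
  have "v = 2 * arsinh (exp (2 * ln (sinh (v / 2)) / 2))" using s by (simp add: arsinh_sinh_real)
  then show "v \<in> range (\<lambda>t::real. 2 * arsinh (exp (t / 2)))" by blast
qed (auto simp: arsinh_real_pos_iff)

lemma exp_half_squared: "(exp (t / 2))\<^sup>2 = exp (t::real)"
  using exp_double[of "t / 2"] by simp

text \<open>
  The substitution \<open>exp t = sinh\<^sup>2 (v / 2)\<close> on each half-line.
\<close>
lemma agm_period_eq_sinh:
  "(\<integral>\<^sup>+v. ennreal (1 / sqrt (p + q * (sinh (v / 2))\<^sup>2)) \<partial>lborel) = 2 * agm_period p q"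
proof -
  let ?f = "\<lambda>v. ennreal (1 / sqrt (p + q * (sinh (v / 2))\<^sup>2))"
  let ?g = "\<lambda>t::real. 2 * arsinh (exp (t / 2))"
  have "(\<integral>\<^sup>+v. ?f v \<partial>lborel) = 2 * (\<integral>\<^sup>+v\<in>{0<..}. ?f v \<partial>lborel)"
    by (rule nn_integral_even) simp_all
  also have "(\<integral>\<^sup>+v\<in>{0<..}. ?f v \<partial>lborel) =
      (\<integral>\<^sup>+t\<in>UNIV. ?f (?g t) * ennreal (1 / sqrt (1 + exp (- t))) \<partial>lborel)"
  proof (rule nn_integral_change_of_variables)
    fix t :: real
    have "exp (t / 2) / sqrt ((exp (t / 2))\<^sup>2 + 1) = 1 / sqrt (1 + exp (- t))"
    proof -
      have "(exp (t / 2))\<^sup>2 + 1 = (exp (t / 2))\<^sup>2 * (1 + exp (- t))"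
        unfolding exp_half_squared by (simp add: exp_minus field_simps)
      then show ?thesis by (simp add: real_sqrt_mult)
    qed
    moreover have "((\<lambda>t. exp (t / 2)) has_real_derivative exp (t / 2) * (1 / 2)) (at t)"
      by (auto intro!: derivative_eq_intros)
    from DERIV_cmult[OF DERIV_chain2[OF arsinh_real_has_field_derivative this], of 2]
    have "(?g has_real_derivative exp (t / 2) / sqrt ((exp (t / 2))\<^sup>2 + 1)) (at t)"
      by (simp add: field_simps)
    ultimately show "(?g has_real_derivative 1 / sqrt (1 + exp (- t))) (at t)" by simp
    show "inj ?g" 
      by (rule injI) (metis exp_inj_iff mult_cancel_left sinh_arsinh_real zero_neq_numeral divide_cancel_right)
    show "range ?g = {0<..}" by (rule arsinh_image)
  qed (simp_all)
  also have "\<dots> = agm_period p q"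
    unfolding agm_period_def
    by (auto intro!: nn_integral_cong simp: sinh_arsinh_real real_sqrt_mult power2_eq_square mult_ac simp flip: ennreal_mult' exp_add)
  finally show ?thesis .
qed

text \<open>
  The substitution \<open>exp t = tan\<^sup>2 (\<phi> / 2)\<close>.
\<close>
lemma nn_integral_tan_half:
  fixes h :: "real \<Rightarrow> ennreal"
  assumes [measurable]: "h \<in> borel_measurable borel"
  shows "(\<integral>\<^sup>+\<phi>\<in>{0<..<pi}. h \<phi> \<partial>lborel)
    = (\<integral>\<^sup>+t. h (2 * arctan (exp (t / 2))) * ennreal (exp (t / 2) / (1 + exp t)) \<partial>lborel)"
proof -
  let ?g = "\<lambda>t::real. 2 * arctan (exp (t / 2))"
  have "(\<integral>\<^sup>+\<phi>\<in>{0<..<pi}. h \<phi> \<partial>lborel) =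
      (\<integral>\<^sup>+t\<in>UNIV. h (?g t) * ennreal (exp (t / 2) / (1 + exp t)) \<partial>lborel)"
  proof (rule nn_integral_change_of_variables)
    fix t :: real
    have "(exp (t / 2))\<^sup>2 = exp t" by (rule exp_half_squared)
    moreover have "2 * (inverse y * (x * (1 / 2))) = x / y" for x y :: real
      by (cases "y = 0") (simp_all add: field_simps)
    ultimately have "2 * (inverse (1 + (exp (t / 2))\<^sup>2) * (exp (t / 2) * (1 / 2))) = exp (t / 2) / (1 + exp t)"
      by (simp only:)
    moreover have "(?g has_real_derivative 2 * (inverse (1 + (exp (t / 2))\<^sup>2) * (exp (t / 2) * (1 / 2)))) (at t)"
      by (auto intro!: derivative_eq_intros)
    ultimately show "(?g has_real_derivative exp (t / 2) / (1 + exp t)) (at t)" by (simp only:)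
    show "inj ?g" by (auto intro!: injI simp: arctan_eq_iff)
    show "range ?g = {0<..<pi}"
    proof (intro equalityI subsetI)
      fix x :: real assume x: "x \<in> {0<..<pi}"
      then have "tan (x / 2) > 0" by (intro tan_gt_zero) auto
      then have "x = ?g (2 * ln (tan (x / 2)))" using x by (simp add: arctan_tan)
      then show "x \<in> range ?g" by blast
    next
      fix x assume "x \<in> range ?g"
      then obtain t where "x = ?g t" by blast
      then show "x \<in> {0<..<pi}" using arctan_ubound[of "exp (t / 2)"] by simp
    qed
  qed simp_all
  then show ?thesis by simp
qed

lemma cos_sin_arctan_exp:
  "(cos (arctan (exp (t / 2))))\<^sup>2 = 1 / (1 + exp t)" (is ?c)
  "(sin (arctan (exp (t / 2))))\<^sup>2 = exp t / (1 + exp (t::real))" (is ?s)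
proof -
  have "1 + exp t > 0" by (simp add: add_pos_pos)
  then show ?c ?s
    unfolding cos_arctan sin_arctan power_divide exp_half_squared by simp_all
qed

lemma tan_half_jacobian: "exp (t / 2) / (1 + exp t) = 1 / (sqrt (1 + exp (- t)) * sqrt (1 + exp (t::real)))"
proof -
  have "1 + exp t = (exp (t / 2))\<^sup>2 * (1 + exp (- t))" 
    unfolding exp_half_squared by (simp add: exp_minus field_simps)
  then have "sqrt (1 + exp t) = exp (t / 2) * sqrt (1 + exp (- t))" by (simp add: real_sqrt_mult)
  moreover have "1 + exp t = sqrt (1 + exp t) * sqrt (1 + exp t)" by (simp add: add_nonneg_nonneg)
  moreover have "e / (A * A) = 1 / (B * A)" if "A = e * B" "e \<noteq> 0" for A B e :: real
    using that by simp
  ultimately show ?thesis by (metis exp_not_eq_zero)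
qed

lemma agm_period_eq_trig:
  assumes "p > 0" "q > 0"
  shows "(\<integral>\<^sup>+\<phi>\<in>{0<..<pi}. ennreal (1 / sqrt (p * (cos (\<phi> / 2))\<^sup>2 + q * (sin (\<phi> / 2))\<^sup>2)) \<partial>lborel) = agm_period p q"
proof -
  have "1 / sqrt (p * (1 / (1 + exp t)) + q * (exp t / (1 + exp t))) * (exp (t / 2) / (1 + exp t))
      = 1 / sqrt ((1 + exp (- t)) * (p + q * exp t))" for t
  proof -
    have pos: "1 + exp t > 0" "p + q * exp t > 0" using assms by (auto intro: add_pos_pos)
    have "p * (1 / (1 + exp t)) + q * (exp t / (1 + exp t)) = (p + q * exp t) / (1 + exp t)"
      by (simp add: add_divide_distrib)
    then show ?thesis using pos by (simp add: tan_half_jacobian real_sqrt_mult real_sqrt_divide)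
  qed
  then have "ennreal (1 / sqrt (p * (1 / (1 + exp t)) + q * (exp t / (1 + exp t)))) * ennreal (exp (t / 2) / (1 + exp t))
      = ennreal (1 / sqrt ((1 + exp (- t)) * (p + q * exp t)))" for t
    by (subst ennreal_mult''[symmetric]) (auto simp: add_nonneg_nonneg)
  note * = this
  have half: "2 * x / 2 = x" for x :: real by simp
  have "(\<integral>\<^sup>+\<phi>\<in>{0<..<pi}. ennreal (1 / sqrt (p * (cos (\<phi> / 2))\<^sup>2 + q * (sin (\<phi> / 2))\<^sup>2)) \<partial>lborel)
      = (\<integral>\<^sup>+t. ennreal (1 / sqrt (p * (cos (2 * arctan (exp (t / 2)) / 2))\<^sup>2 + q * (sin (2 * arctan (exp (t / 2)) / 2))\<^sup>2))
          * ennreal (exp (t / 2) / (1 + exp t)) \<partial>lborel)"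
    by (rule nn_integral_tan_half) measurable
  also have "\<dots> = agm_period p q"
    unfolding agm_period_def by (intro nn_integral_cong) (simp only: half cos_sin_arctan_exp *)
  finally show ?thesis .
qed

lemma nn_integral_shift:
  fixes f :: "real \<Rightarrow> ennreal"
  assumes "f \<in> borel_measurable borel"
  shows "(\<integral>\<^sup>+x. f x \<partial>lborel) = (\<integral>\<^sup>+x. f (a + x) \<partial>lborel)"
    and "(\<integral>\<^sup>+x. f x \<partial>lborel) = (\<integral>\<^sup>+x. f (a - x) \<partial>lborel)"
    and "(\<integral>\<^sup>+x. f x \<partial>lborel) = 2 * (\<integral>\<^sup>+x. f (2 * x) \<partial>lborel)"
  using nn_integral_real_affine[OF assms, of 1 a] nn_integral_real_affine[OF assms, of "-1" a]
    nn_integral_real_affine[OF assms, of 2 0] by simp_all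

lemma nn_integral_sin_half:
  fixes f :: "real \<Rightarrow> ennreal"
  assumes [measurable]: "f \<in> borel_measurable borel"
  shows "(\<integral>\<^sup>+x\<in>{0<..<pi}. f ((sin x)\<^sup>2) \<partial>lborel) = (\<integral>\<^sup>+x\<in>{0<..<pi}. f ((sin (x / 2))\<^sup>2) \<partial>lborel)"
proof -
  have "(\<integral>\<^sup>+x\<in>{0<..<pi}. f ((sin x)\<^sup>2) \<partial>lborel)
      = (\<integral>\<^sup>+x. f ((sin (pi / 2 + x))\<^sup>2) * indicator {0<..<pi} (pi / 2 + x) \<partial>lborel)"
    by (rule nn_integral_shift) measurable
  also have "\<dots> = (\<integral>\<^sup>+x\<in>{-(pi/2)<..<pi/2}. f ((cos x)\<^sup>2) \<partial>lborel)"
  proof -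
    have "sin (pi / 2 + x) = cos x" for x by (simp add: sin_add)
    moreover have "(indicator {0<..<pi} (pi / 2 + x) :: ennreal) = indicator {-(pi/2)<..<pi/2} x" for x
      by (auto simp: indicator_def field_simps)
    ultimately show ?thesis by (simp only:)
  qed
  also have "\<dots> = 2 * (\<integral>\<^sup>+x\<in>{0<..<pi/2}. f ((cos x)\<^sup>2) \<partial>lborel)"
    by (rule nn_integral_even) simp_all
  also have "(\<integral>\<^sup>+x\<in>{0<..<pi/2}. f ((cos x)\<^sup>2) \<partial>lborel)
      = (\<integral>\<^sup>+x. f ((cos (pi / 2 - x))\<^sup>2) * indicator {0<..<pi/2} (pi / 2 - x) \<partial>lborel)"
    by (rule nn_integral_shift) measurable
  also have "\<dots> = (\<integral>\<^sup>+x\<in>{0<..<pi/2}. f ((sin x)\<^sup>2) \<partial>lborel)"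
  proof -
    have "cos (pi / 2 - x) = sin x" for x by (simp add: cos_diff)
    moreover have "(indicator {0<..<pi/2} (pi / 2 - x) :: ennreal) = indicator {0<..<pi/2} x" for x
      by (auto simp: indicator_def field_simps)
    ultimately show ?thesis by (simp only:)
  qed
  also have "2 * \<dots> = (\<integral>\<^sup>+x\<in>{0<..<pi}. f ((sin (x / 2))\<^sup>2) \<partial>lborel)"
  proof -
    have "(\<integral>\<^sup>+x\<in>{0<..<pi}. f ((sin (x / 2))\<^sup>2) \<partial>lborel)
      = 2 * (\<integral>\<^sup>+x. f ((sin ((2 * x) / 2))\<^sup>2) * indicator {0<..<pi} (2 * x) \<partial>lborel)"
      by (rule nn_integral_shift) measurable
    also have "(\<integral>\<^sup>+x. f ((sin ((2 * x) / 2))\<^sup>2) * indicator {0<..<pi} (2 * x) \<partial>lborel)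
       = (\<integral>\<^sup>+x\<in>{0<..<pi/2}. f ((sin x)\<^sup>2) \<partial>lborel)"
      by (intro nn_integral_cong) (auto simp: indicator_def field_simps)
    finally show ?thesis by simp
  qed
  finally show ?thesis .
qed

text \<open>
  The circle integral of the inverse distance from \<open>0\<close> to \<open>a + b exp (\<i> \<phi>)\<close>.  Let \<open>\<omega>\<close> be the argument of that
  point and \<open>\<psi> = \<phi> - \<omega>\<close>.  The law of sines gives \<open>a sin \<omega> = b sin \<psi>\<close>, so that
  \<open>d\<phi> / \<bar>a + b exp (\<i> \<phi>)\<bar> = d\<psi> / sqrt (a\<^sup>2 - b\<^sup>2 sin\<^sup>2 \<psi>)\<close>, and \<open>\<psi>\<close> runs once over \<open>{0..\<pi>}\<close> with \<open>\<phi>\<close>.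
\<close>
lemma landen_transformation:
  assumes "a > b" "b > 0"
  shows "(\<integral>\<^sup>+\<phi>\<in>{0<..<pi}. ennreal (1 / sqrt (a\<^sup>2 + b\<^sup>2 + 2 * a * b * cos \<phi>)) \<partial>lborel) = agm_period (a\<^sup>2) (a\<^sup>2 - b\<^sup>2)"
proof -
  define N where "N \<phi> = a\<^sup>2 + b\<^sup>2 + 2 * a * b * cos \<phi>" for \<phi>
  define \<omega> where "\<omega> \<phi> = arctan (b * sin \<phi> / (a + b * cos \<phi>))" for \<phi>
  define \<psi> where "\<psi> \<phi> = \<phi> - \<omega> \<phi>" for \<phi>
  have A: "a + b * cos \<phi> > 0" for \<phi>
  proof -
    have "b * (- 1) \<le> b * cos \<phi>" using assms by (intro mult_left_mono) auto
    then show ?thesis using assms by linarith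
  qed
  have N_eq: "N \<phi> = (a + b * cos \<phi>)\<^sup>2 + (b * sin \<phi>)\<^sup>2" for \<phi>
  proof -
    show ?thesis using sin_cos_squared_add[of \<phi>] unfolding N_def by algebra
  qed
  have Npos: "N \<phi> > 0" for \<phi>
    unfolding N_eq using A[of \<phi>] by (simp add: add_pos_nonneg)
  have sq: "sqrt (1 + (b * sin \<phi> / (a + b * cos \<phi>))\<^sup>2) = sqrt (N \<phi>) / (a + b * cos \<phi>)" for \<phi>
  proof -
    have "1 + (b * sin \<phi> / (a + b * cos \<phi>))\<^sup>2 = N \<phi> / (a + b * cos \<phi>)\<^sup>2"
      unfolding N_eq using A[of \<phi>] by (simp add: field_simps)
    then show ?thesis using A[of \<phi>] by (simp add: real_sqrt_divide)
  qed
  have co: "cos (\<omega> \<phi>) = (a + b * cos \<phi>) / sqrt (N \<phi>)" for \<phi>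
    unfolding \<omega>_def cos_arctan sq by simp
  have si: "sin (\<omega> \<phi>) = b * sin \<phi> / sqrt (N \<phi>)" for \<phi>
    unfolding \<omega>_def sin_arctan sq using A[of \<phi>] by simp
  have sch: "sin (\<psi> \<phi>) = a * sin \<phi> / sqrt (N \<phi>)" for \<phi>
    unfolding \<psi>_def sin_diff co si by (simp add: algebra_simps diff_divide_distrib add_divide_distrib)
  define D where "D \<phi> = (a\<^sup>2 + a * b * cos \<phi>) / N \<phi>" for \<phi>
  have Dpos: "D \<phi> > 0" for \<phi>
  proof -
    have "a\<^sup>2 + a * b * cos \<phi> = a * (a + b * cos \<phi>)" by (simp add: power2_eq_square algebra_simps)
    then show ?thesis unfolding D_def using A[of \<phi>] Npos[of \<phi>] assms by simp
  qed
  have der: "(\<psi> has_real_derivative D \<phi>) (at \<phi>)" for \<phi>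
  proof -
    have A0: "a + b * cos \<phi> \<noteq> 0" using A[of \<phi>] by simp
    have 1: "((\<lambda>\<phi>. b * sin \<phi> / (a + b * cos \<phi>)) has_real_derivative (b\<^sup>2 + a * b * cos \<phi>) / (a + b * cos \<phi>)\<^sup>2) (at \<phi>)"
    proof -
      have "(b * cos \<phi>) * (a + b * cos \<phi>) - (b * sin \<phi>) * (- (b * sin \<phi>)) = b\<^sup>2 * ((cos \<phi>)\<^sup>2 + (sin \<phi>)\<^sup>2) + a * b * cos \<phi>"
        by algebra
      also have "\<dots> = b\<^sup>2 + a * b * cos \<phi>" by simp
      finally have e: "(b * cos \<phi>) * (a + b * cos \<phi>) - (b * sin \<phi>) * (- (b * sin \<phi>)) = b\<^sup>2 + a * b * cos \<phi>" .
      have "((\<lambda>\<phi>. b * sin \<phi>) has_real_derivative b * cos \<phi>) (at \<phi>)"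
        "((\<lambda>\<phi>. a + b * cos \<phi>) has_real_derivative - (b * sin \<phi>)) (at \<phi>)"
        by (auto intro!: derivative_eq_intros)
      from DERIV_divide[OF this A0] show ?thesis
        unfolding e power2_eq_square[of "a + b * cos \<phi>"] .
    qed
    have "1 + (b * sin \<phi> / (a + b * cos \<phi>))\<^sup>2 = N \<phi> / (a + b * cos \<phi>)\<^sup>2"
      unfolding N_eq using A[of \<phi>] by (simp add: field_simps)
    then have "((\<lambda>\<phi>. arctan (b * sin \<phi> / (a + b * cos \<phi>))) has_real_derivative (b\<^sup>2 + a * b * cos \<phi>) / N \<phi>) (at \<phi>)"
      using DERIV_chain2[OF DERIV_arctan 1] A0 by simp
    then have "((\<lambda>\<phi>. \<phi> - arctan (b * sin \<phi> / (a + b * cos \<phi>))) has_real_derivative 1 - (b\<^sup>2 + a * b * cos \<phi>) / N \<phi>) (at \<phi>)"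
      by (intro DERIV_diff DERIV_ident)
    moreover have "1 - (b\<^sup>2 + a * b * cos \<phi>) / N \<phi> = D \<phi>"
      using Npos[of \<phi>] unfolding D_def by (simp add: field_simps) (simp add: N_def)
    moreover have "\<psi> = (\<lambda>\<phi>. \<phi> - arctan (b * sin \<phi> / (a + b * cos \<phi>)))"
      by (simp add: fun_eq_iff \<psi>_def \<omega>_def)
    ultimately show ?thesis by simp
  qed
  have mono: "strict_mono \<psi>"
    using der Dpos by (meson DERIV_pos_imp_increasing strict_monoI)
  have cont: "continuous_on X \<psi>" for X
    using der by (meson DERIV_isCont continuous_at_imp_continuous_on)
  have c0: "\<psi> 0 = 0" and cpi: "\<psi> pi = pi" by (simp_all add: \<psi>_def \<omega>_def)
  have im: "\<psi> ` {0<..<pi} = {0<..<pi}"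
  proof (intro equalityI subsetI)
    fix y assume "y \<in> \<psi> ` {0<..<pi}"
    then show "y \<in> {0<..<pi}" using strict_monoD[OF mono] c0 cpi by (force)
  next
    fix y assume y: "y \<in> {0<..<pi}"
    then obtain x where x: "0 \<le> x" "x \<le> pi" "\<psi> x = y"
      using IVT'[of \<psi> 0 y pi] cont c0 cpi by auto
    then have "x \<noteq> 0" "x \<noteq> pi" using y c0 cpi by auto
    then show "y \<in> \<psi> ` {0<..<pi}" using x by force
  qed
  have [measurable]: "\<psi> \<in> borel_measurable borel"
    by (rule borel_measurable_continuous_onI[OF cont])
  have [measurable]: "D \<in> borel_measurable borel" unfolding D_def N_def by measurable
  have key: "1 / sqrt (a\<^sup>2 - b\<^sup>2 * (sin (\<psi> \<phi>))\<^sup>2) * D \<phi> = 1 / sqrt (N \<phi>)" for \<phi>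
  proof -
    have "a\<^sup>2 - b\<^sup>2 * (sin (\<psi> \<phi>))\<^sup>2 = a\<^sup>2 * (N \<phi> - (b * sin \<phi>)\<^sup>2) / N \<phi>"
      unfolding sch using Npos[of \<phi>] by (simp add: field_simps power_mult_distrib)
    also have "\<dots> = (a * (a + b * cos \<phi>))\<^sup>2 / N \<phi>"
      unfolding N_eq by (simp add: power_mult_distrib)
    finally have "sqrt (a\<^sup>2 - b\<^sup>2 * (sin (\<psi> \<phi>))\<^sup>2) = a * (a + b * cos \<phi>) / sqrt (N \<phi>)"
      using assms A[of \<phi>] by (simp add: real_sqrt_divide)
    moreover have "D \<phi> = a * (a + b * cos \<phi>) / (sqrt (N \<phi>) * sqrt (N \<phi>))"
      using Npos[of \<phi>] by (simp add: D_def power2_eq_square algebra_simps)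
    moreover have "a * (a + b * cos \<phi>) \<noteq> 0" using assms A[of \<phi>] by simp
    moreover have "1 / S * d = 1 / n" if "S = k / n" "d = k / (n * n)" "k \<noteq> 0" "n \<noteq> 0" for S d k n :: real
      using that by simp
    ultimately show ?thesis using Npos[of \<phi>] by (metis real_sqrt_gt_zero less_numeral_extra(3))
  qed
  have nn: "a\<^sup>2 - b\<^sup>2 * (sin x)\<^sup>2 = a\<^sup>2 * (cos x)\<^sup>2 + (a\<^sup>2 - b\<^sup>2) * (sin x)\<^sup>2" for x
    by (simp add: cos_squared_eq algebra_simps)
  have "agm_period (a\<^sup>2) (a\<^sup>2 - b\<^sup>2) = (\<integral>\<^sup>+x\<in>{0<..<pi}. ennreal (1 / sqrt (a\<^sup>2 - b\<^sup>2 * (sin (x / 2))\<^sup>2)) \<partial>lborel)"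
    unfolding nn using assms by (subst agm_period_eq_trig) (auto simp: power2_eq_square intro!: mult_strict_mono)
  also have "\<dots> = (\<integral>\<^sup>+x\<in>{0<..<pi}. ennreal (1 / sqrt (a\<^sup>2 - b\<^sup>2 * (sin x)\<^sup>2)) \<partial>lborel)"
    by (rule nn_integral_sin_half[symmetric, of "\<lambda>s. ennreal (1 / sqrt (a\<^sup>2 - b\<^sup>2 * s))"]) measurable
  also have "\<dots> = (\<integral>\<^sup>+\<phi>\<in>{0<..<pi}. ennreal (1 / sqrt (a\<^sup>2 - b\<^sup>2 * (sin (\<psi> \<phi>))\<^sup>2)) * ennreal (D \<phi>) \<partial>lborel)"
    by (rule nn_integral_change_of_variables)
       (use der Dpos im strict_mono_imp_inj_on[OF mono] in \<open>auto simp: less_imp_le intro: inj_on_subset\<close>)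
  also have "\<dots> = (\<integral>\<^sup>+\<phi>\<in>{0<..<pi}. ennreal (1 / sqrt (N \<phi>)) \<partial>lborel)"
    using key Dpos by (simp add: less_imp_le flip: ennreal_mult'')
  finally show ?thesis by (simp add: N_def)
qed

section \<open>The double integral attached to four numbers\<close>

text \<open>
  The second factor is the first one at \<open>(- u, - v)\<close>.  The value is \<open>\<pi>\<^sup>2\<close> divided by Borchardt's
  arithmetic-geometric mean of the four numbers.
\<close>
definition borchardt_integral :: "real \<Rightarrow> real \<Rightarrow> real \<Rightarrow> real \<Rightarrow> ennreal" where
  "borchardt_integral c1 c2 c3 c4 = (\<integral>\<^sup>+v. \<integral>\<^sup>+u. ennreal (1 / sqrt ((c2 + c4 * exp u + c1 * exp v + c3 * exp (u + v))
      * (c2 + c4 * exp (- u) + c1 * exp (- v) + c3 * exp (- u - v)))) \<partial>lborel \<partial>lborel)"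

lemma mult_exp_pair: "(x + y * exp v) * (x + y * exp (- v)) = y\<^sup>2 + x\<^sup>2 + 2 * y * x * cosh (v::real)"
  by (simp add: cosh_def exp_minus field_simps power2_eq_square)

text \<open>
  For fixed \<open>v\<close> both factors are linear in \<open>exp u\<close> and \<open>exp (- u)\<close>.
\<close>
lemma borchardt_integral_eq_agm_period:
  assumes c: "c1 > 0" "c2 > 0" "c3 > 0" "c4 > 0"
  shows "borchardt_integral c1 c2 c3 c4
    = (\<integral>\<^sup>+v. agm_period (c1\<^sup>2 + c2\<^sup>2 + 2 * c1 * c2 * cosh v) (c3\<^sup>2 + c4\<^sup>2 + 2 * c3 * c4 * cosh v) \<partial>lborel)"
proof -
  have "(\<integral>\<^sup>+u. ennreal (1 / sqrt ((c2 + c4 * exp u + c1 * exp v + c3 * exp (u + v))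
      * (c2 + c4 * exp (- u) + c1 * exp (- v) + c3 * exp (- u - v)))) \<partial>lborel)
     = agm_period (c1\<^sup>2 + c2\<^sup>2 + 2 * c1 * c2 * cosh v) (c3\<^sup>2 + c4\<^sup>2 + 2 * c3 * c4 * cosh v)" for v
  proof -
    have e: "(c2 + c4 * exp u + c1 * exp v + c3 * exp (u + v)) * (c2 + c4 * exp (- u) + c1 * exp (- v) + c3 * exp (- u - v))
       = ((c2 + c1 * exp v) + (c4 + c3 * exp v) * exp u) * ((c2 + c1 * exp (- v)) + (c4 + c3 * exp (- v)) * exp (- u))" for u
    proof -
      have "exp (u + v) = exp v * exp u" "exp (- u - v) = exp (- v) * exp (- u)"
        by (simp_all add: exp_add[symmetric] add.commute)
      then show ?thesis by (simp add: algebra_simps)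
    qed
    show ?thesis unfolding e
      by (subst agm_period_eq_bilinear) (use c in \<open>simp_all add: add_pos_pos mult_exp_pair\<close>)
  qed
  then show ?thesis by (simp add: borchardt_integral_def)
qed

text \<open>
  Here the elliptic integral over the variable \<open>t\<close> inside \<open>agm_period\<close> is kept, and \<open>v\<close> is integrated first:
  the integrand depends on \<open>v\<close> through \<open>sinh\<^sup>2 (v / 2)\<close>, so this is again an \<open>agm_period\<close>.  The angle is
  given by \<open>exp t = tan\<^sup>2 (\<phi> / 2)\<close>.
\<close>
lemma borchardt_integral_eq_angle:
  assumes c: "c1 > 0" "c2 > 0" "c3 > 0" "c4 > 0"
  shows "borchardt_integral c1 c2 c3 c4 = 2 * (\<integral>\<^sup>+\<phi>\<in>{0<..<pi}.
     agm_period ((c1 + c2)\<^sup>2 * (cos (\<phi> / 2))\<^sup>2 + (c3 + c4)\<^sup>2 * (sin (\<phi> / 2))\<^sup>2)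
         (4 * (c1 * c2) * (cos (\<phi> / 2))\<^sup>2 + 4 * (c3 * c4) * (sin (\<phi> / 2))\<^sup>2) \<partial>lborel)"
proof -
  let ?p = "\<lambda>v. c1\<^sup>2 + c2\<^sup>2 + 2 * c1 * c2 * cosh v" and ?q = "\<lambda>v. c3\<^sup>2 + c4\<^sup>2 + 2 * c3 * c4 * cosh v"
  define P where "P t = (c1 + c2)\<^sup>2 + (c3 + c4)\<^sup>2 * exp t" for t
  define R where "R t = 4 * (c1 * c2) + 4 * (c3 * c4) * exp t" for t
  have cosh_eq: "cosh v = 1 + 2 * (sinh (v / 2))\<^sup>2" for v :: real
    using cosh_double[of "v / 2"] cosh_square_eq[of "v / 2"] by simp
  have inner: "(\<integral>\<^sup>+v. ennreal (1 / sqrt ((1 + exp (- t)) * (?p v + ?q v * exp t))) \<partial>lborel) = 2 * (ennreal (1 / sqrt (1 + exp (- t))) * agm_period (P t) (R t))" for t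
  proof -
    have "?p v + ?q v * exp t = P t + R t * (sinh (v / 2))\<^sup>2" for v
      unfolding P_def R_def cosh_eq by (simp add: power2_eq_square algebra_simps)
    then have "ennreal (1 / sqrt ((1 + exp (- t)) * (?p v + ?q v * exp t))) = ennreal (1 / sqrt (1 + exp (- t))) * ennreal (1 / sqrt (P t + R t * (sinh (v / 2))\<^sup>2))" for v
      by (subst ennreal_mult'[symmetric]) (simp_all add: real_sqrt_mult add_nonneg_nonneg)
    then show ?thesis by (simp add: nn_integral_cmult agm_period_eq_sinh mult_ac)
  qed
  have "borchardt_integral c1 c2 c3 c4 = (\<integral>\<^sup>+v. \<integral>\<^sup>+t. ennreal (1 / sqrt ((1 + exp (- t)) * (?p v + ?q v * exp t))) \<partial>lborel \<partial>lborel)"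
    unfolding borchardt_integral_eq_agm_period[OF c] agm_period_def ..
  also have "\<dots> = (\<integral>\<^sup>+t. \<integral>\<^sup>+v. ennreal (1 / sqrt ((1 + exp (- t)) * (?p v + ?q v * exp t))) \<partial>lborel \<partial>lborel)"
    by (rule lborel_pair.Fubini') measurable
  also have "\<dots> = 2 * (\<integral>\<^sup>+t. ennreal (1 / sqrt (1 + exp (- t))) * agm_period (P t) (R t) \<partial>lborel)"
    unfolding inner P_def R_def by (rule nn_integral_cmult) measurable
  also have "(\<integral>\<^sup>+t. ennreal (1 / sqrt (1 + exp (- t))) * agm_period (P t) (R t) \<partial>lborel)
     = (\<integral>\<^sup>+t. agm_period ((c1 + c2)\<^sup>2 * (cos (2 * arctan (exp (t / 2)) / 2))\<^sup>2 + (c3 + c4)\<^sup>2 * (sin (2 * arctan (exp (t / 2)) / 2))\<^sup>2)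
         (4 * (c1 * c2) * (cos (2 * arctan (exp (t / 2)) / 2))\<^sup>2 + 4 * (c3 * c4) * (sin (2 * arctan (exp (t / 2)) / 2))\<^sup>2)
          * ennreal (exp (t / 2) / (1 + exp t)) \<partial>lborel)"
  proof (intro nn_integral_cong)
    fix t :: real
    have half: "2 * x / 2 = x" for x :: real by simp
    have pos: "1 + exp t > 0" by (rule add_pos_pos) simp_all
    have 1: "(c1 + c2)\<^sup>2 * (1 / (1 + exp t)) + (c3 + c4)\<^sup>2 * (exp t / (1 + exp t)) = 1 / (1 + exp t) * P t"
      "4 * (c1 * c2) * (1 / (1 + exp t)) + 4 * (c3 * c4) * (exp t / (1 + exp t)) = 1 / (1 + exp t) * R t"
      by (simp_all add: P_def R_def add_divide_distrib)
    have "ennreal (1 / sqrt (1 / (1 + exp t))) * ennreal (exp (t / 2) / (1 + exp t)) = ennreal (1 / sqrt (1 + exp (- t)))"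
      unfolding tan_half_jacobian using pos
      by (subst ennreal_mult'[symmetric]) (simp_all add: real_sqrt_divide)
    then show "ennreal (1 / sqrt (1 + exp (- t))) * agm_period (P t) (R t) =
       agm_period ((c1 + c2)\<^sup>2 * (cos (2 * arctan (exp (t / 2)) / 2))\<^sup>2 + (c3 + c4)\<^sup>2 * (sin (2 * arctan (exp (t / 2)) / 2))\<^sup>2)
         (4 * (c1 * c2) * (cos (2 * arctan (exp (t / 2)) / 2))\<^sup>2 + 4 * (c3 * c4) * (sin (2 * arctan (exp (t / 2)) / 2))\<^sup>2)
          * ennreal (exp (t / 2) / (1 + exp t))"
      unfolding half cos_sin_arctan_exp 1 using pos
      by (subst agm_period_scale) (simp_all add: mult_ac)
  qed
  also have "\<dots> = (\<integral>\<^sup>+\<phi>\<in>{0<..<pi}.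
     agm_period ((c1 + c2)\<^sup>2 * (cos (\<phi> / 2))\<^sup>2 + (c3 + c4)\<^sup>2 * (sin (\<phi> / 2))\<^sup>2)
         (4 * (c1 * c2) * (cos (\<phi> / 2))\<^sup>2 + 4 * (c3 * c4) * (sin (\<phi> / 2))\<^sup>2) \<partial>lborel)"
    by (rule nn_integral_tan_half[symmetric]) measurable
  finally show ?thesis .
qed

section \<open>Contour shifts for inverse square roots\<close>

lemma borel_measurable_csqrt[measurable]: "csqrt \<in> borel_measurable borel"
proof -
  have "(\<lambda>z. Re (csqrt z)) \<in> borel_measurable borel" "(\<lambda>z. Im (csqrt z)) \<in> borel_measurable borel"
    unfolding csqrt.simps sgn_real_def by measurable
  then show ?thesis unfolding borel_measurable_complex_iff by simp
qed

lemma borel_measurable_complex_cosh[measurable]: "(cosh :: complex \<Rightarrow> complex) \<in> borel_measurable borel"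
  and borel_measurable_complex_exp[measurable]: "(exp :: complex \<Rightarrow> complex) \<in> borel_measurable borel"
  by (auto intro!: borel_measurable_continuous_onI continuous_intros)

lemma integrable_exp_minus_abs:
  assumes "\<delta> > 0" shows "integrable lborel (\<lambda>x::real. exp (- \<bar>x\<bar> * \<delta>))"
proof (rule integrableI_bounded)
  have even: "(\<integral>\<^sup>+x. ennreal (norm (exp (- \<bar>x\<bar> * \<delta>))) \<partial>lborel) = 2 * (\<integral>\<^sup>+x\<in>{0<..}. ennreal (norm (exp (- \<bar>x\<bar> * \<delta>))) \<partial>lborel)"
    by (rule nn_integral_even) simp_all
  have "(\<integral>\<^sup>+x\<in>{0<..}. ennreal (norm (exp (- \<bar>x\<bar> * \<delta>))) \<partial>lborel) \<le> (\<integral>\<^sup>+x\<in>{0..}. ennreal (exp (- \<delta> * x)) \<partial>lborel)"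
    by (intro nn_integral_mono) (auto simp: indicator_def mult.commute)
  also have "\<dots> = ennreal (exp (- \<delta> * 0) / \<delta>)"
    by (rule nn_integral_has_integral_lebesgue') (use assms has_integral_exp_minus_to_infinity[of \<delta> 0] in auto)
  finally have "(\<integral>\<^sup>+x\<in>{0<..}. ennreal (norm (exp (- \<bar>x\<bar> * \<delta>))) \<partial>lborel) < \<infinity>"
    by (rule order_le_less_trans) simp
  then show "(\<integral>\<^sup>+x. ennreal (norm (exp (- \<bar>x\<bar> * \<delta>))) \<partial>lborel) < \<infinity>"
    unfolding even by (simp add: ennreal_mult_less_top)
qed simp

abbreviation lborel2 :: "(real \<times> real) measure" where
  "lborel2 \<equiv> lborel \<Otimes>\<^sub>M lborel"

lemma integrable_product_bound:
  fixes f :: "real \<times> real \<Rightarrow> complex" and p q :: "real \<Rightarrow> real"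
  assumes f[measurable]: "f \<in> borel_measurable lborel2"
    and p: "integrable lborel p" and q: "integrable lborel q"
    and bound: "\<And>x y. cmod (f (x, y)) \<le> p x * q y"
    and nonneg: "\<And>x. 0 \<le> p x" "\<And>y. 0 \<le> q y"
  shows "integrable lborel2 f"
proof (rule integrableI_bounded)
  have [measurable]: "p \<in> borel_measurable borel" "q \<in> borel_measurable borel"
    using p q by auto
  have "(\<integral>\<^sup>+z. ennreal (norm (f z)) \<partial>lborel2) = (\<integral>\<^sup>+x. \<integral>\<^sup>+y. ennreal (norm (f (x, y))) \<partial>lborel \<partial>lborel)"
    by (rule lborel.nn_integral_fst[symmetric]) measurable
  also have "\<dots> \<le> (\<integral>\<^sup>+x. \<integral>\<^sup>+y. ennreal (p x) * ennreal (q y) \<partial>lborel \<partial>lborel)"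
    using bound by (intro nn_integral_mono) (simp add: nonneg flip: ennreal_mult)
  also have "\<dots> = (\<integral>\<^sup>+x. ennreal (p x) \<partial>lborel) * (\<integral>\<^sup>+y. ennreal (q y) \<partial>lborel)"
    by (simp add: nn_integral_cmult nn_integral_multc)
  also have "\<dots> < \<infinity>"
    using p q nonneg by (simp add: nn_integral_eq_integral ennreal_mult_less_top)
  finally show "(\<integral>\<^sup>+z. ennreal (norm (f z)) \<partial>lborel2) < \<infinity>" .
qed measurable

lemma cmod_csqrt: "cmod (csqrt z) = sqrt (cmod z)"
  by (metis norm_power power2_csqrt norm_ge_zero real_sqrt_unique)

lemma right_half_plane_mult:
  assumes "Re z > 0" "Re w > 0" shows "z * w \<notin> \<real>\<^sub>\<le>\<^sub>0"
proof
  assume "z * w \<in> \<real>\<^sub>\<le>\<^sub>0"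
  then have 1: "Re z * Re w - Im z * Im w \<le> 0" and 2: "Re z * Im w + Im z * Re w = 0"
    by (auto simp: complex_nonpos_Reals_iff)
  have "Re z * (Re z * Re w - Im z * Im w) = Re w * ((Re z)\<^sup>2 + (Im z)\<^sup>2) - Im z * (Re z * Im w + Im z * Re w)"
    by algebra
  also have "\<dots> > 0" unfolding 2 using assms by (simp add: add_pos_nonneg)
  finally show False using 1 assms by (simp add: zero_less_mult_iff)
qed

abbreviation cosh_kernel :: "real \<Rightarrow> real \<Rightarrow> complex \<Rightarrow> complex" where
  "cosh_kernel a b w \<equiv> of_real (a\<^sup>2 + b\<^sup>2) + of_real (2 * a * b) * cosh w"

lemma cosh_kernel_eq:
  "cosh_kernel a b w
    = (of_real a * exp (- w / 2) + of_real b * exp (w / 2)) * (of_real a * exp (w / 2) + of_real b * exp (- w / 2 :: complex))"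
proof -
  have "exp w = exp (w / 2) * exp (w / 2)" "exp (- w) = exp (- w / 2) * exp (- w / 2)" "exp (w / 2) * exp (- w / 2) = 1"
    by (simp_all flip: exp_add)
  then show ?thesis
    unfolding cosh_def by (simp add: power2_eq_square scaleR_conv_of_real algebra_simps)
qed

lemma Re_exp_half_sum:
  "Re (of_real a * exp (- w / 2) + of_real b * exp (w / 2)) = cos (Im w / 2) * (a * exp (- Re w / 2) + b * exp (Re w / 2))"
  by (simp add: Re_exp algebra_simps)

text \<open>
  Both factors in \<open>cosh_kernel_eq\<close> lie in the right half-plane.
\<close>
lemma cosh_kernel_not_nonpos:
  assumes "a > 0" "b > 0" "\<bar>Im w\<bar> < pi"
  shows "cosh_kernel a b w \<notin> \<real>\<^sub>\<le>\<^sub>0"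
proof -
  have c: "cos (Im w / 2) > 0" using assms(3) by (intro cos_gt_zero_pi) auto
  have "Re (of_real a * exp (- w / 2) + of_real b * exp (w / 2)) > 0"
    "Re (of_real b * exp (- w / 2) + of_real a * exp (w / 2)) > 0"
    unfolding Re_exp_half_sum using c assms by (auto intro!: mult_pos_pos add_pos_pos)
  then show ?thesis unfolding cosh_kernel_eq
    using right_half_plane_mult by (simp add: add.commute)
qed

lemma cosh_kernel_bound:
  assumes ab: "a > 0" "b > 0" and "\<bar>Im w\<bar> \<le> \<psi>" "\<psi> < pi"
  shows "(cos (\<psi> / 2))\<^sup>2 * (a * b * exp \<bar>Re w\<bar>) \<le> cmod (cosh_kernel a b w)"
proof -
  have c: "0 < cos (\<psi> / 2)" using assms by (intro cos_gt_zero_pi) auto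
  have c2: "cos (\<psi> / 2) \<le> cos (Im w / 2)"
  proof -
    have "cos (\<psi> / 2) \<le> cos (\<bar>Im w\<bar> / 2)" using assms by (intro cos_monotone_0_pi_le) auto
    also have "cos (\<bar>Im w\<bar> / 2) = cos (Im w / 2)" by (simp add: abs_if)
    finally show ?thesis .
  qed
  define S T where "S = a * exp (- Re w / 2) + b * exp (Re w / 2)" and "T = b * exp (- Re w / 2) + a * exp (Re w / 2)"
  have S: "S > 0" and T: "T > 0" using ab by (auto simp: S_def T_def intro!: add_pos_pos)
  have low: "cos (\<psi> / 2) * S \<le> cmod (of_real a * exp (- w / 2) + of_real b * exp (w / 2))"
    "cos (\<psi> / 2) * T \<le> cmod (of_real b * exp (- w / 2) + of_real a * exp (w / 2))"
  proof -
    have "cos (\<psi> / 2) * S \<le> cos (Im w / 2) * S" using c2 S by simp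
    also have "\<dots> = Re (of_real a * exp (- w / 2) + of_real b * exp (w / 2))"
      unfolding Re_exp_half_sum S_def ..
    also have "\<dots> \<le> cmod (of_real a * exp (- w / 2) + of_real b * exp (w / 2))" by (rule complex_Re_le_cmod)
    finally show "cos (\<psi> / 2) * S \<le> cmod (of_real a * exp (- w / 2) + of_real b * exp (w / 2))" .
    have "cos (\<psi> / 2) * T \<le> cos (Im w / 2) * T" using c2 T by simp
    also have "\<dots> = Re (of_real b * exp (- w / 2) + of_real a * exp (w / 2))"
      unfolding Re_exp_half_sum T_def ..
    also have "\<dots> \<le> cmod (of_real b * exp (- w / 2) + of_real a * exp (w / 2))" by (rule complex_Re_le_cmod)
    finally show "cos (\<psi> / 2) * T \<le> cmod (of_real b * exp (- w / 2) + of_real a * exp (w / 2))" .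
  qed
  have "a * b * exp \<bar>Re w\<bar> \<le> S * T"
  proof -
    have e: "exp (Re w) = exp (Re w / 2) * exp (Re w / 2)" "exp (- Re w) = exp (- Re w / 2) * exp (- Re w / 2)" "exp (Re w / 2) * exp (- Re w / 2) = 1"
      by (simp_all flip: exp_add)
    have "S * T = a\<^sup>2 + b\<^sup>2 + a * b * (exp (Re w) + exp (- Re w))"
      unfolding S_def T_def e(1,2) using e(3) by algebra
    moreover have "exp \<bar>Re w\<bar> \<le> exp (Re w) + exp (- Re w)" by (simp add: abs_if)
    then have "a * b * exp \<bar>Re w\<bar> \<le> a * b * (exp (Re w) + exp (- Re w))" using ab by (intro mult_left_mono) auto
    ultimately show ?thesis by (smt (verit) zero_le_power2)
  qed
  then have "(cos (\<psi> / 2))\<^sup>2 * (a * b * exp \<bar>Re w\<bar>) \<le> (cos (\<psi> / 2))\<^sup>2 * (S * T)" by (intro mult_left_mono) auto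
  also have "\<dots> = (cos (\<psi> / 2) * S) * (cos (\<psi> / 2) * T)" by (simp add: power2_eq_square mult_ac)
  also have "\<dots> \<le> cmod (of_real a * exp (- w / 2) + of_real b * exp (w / 2)) * cmod (of_real b * exp (- w / 2) + of_real a * exp (w / 2))"
    using low c S T by (intro mult_mono) auto
  also have "\<dots> = cmod (cosh_kernel a b w)"
    unfolding cosh_kernel_eq norm_mult by (simp add: add.commute)
  finally show ?thesis .
qed

text \<open>
  The kernel avoids the cut of the square root on the whole strip \<open>\<bar>Im w\<bar> < \<pi>\<close>, so the line of
  integration may be moved back to the real axis.
\<close>
lemma inv_sqrt_cosh_shift:
  assumes ab: "a > 0" "b > 0" and psi: "\<bar>\<psi>\<bar> < pi"
  shows "integrable lborel (\<lambda>u::real. 1 / csqrt (cosh_kernel a b (of_real u + \<i> * of_real \<psi>)))"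
    and "(\<integral>u. 1 / csqrt (cosh_kernel a b (of_real u + \<i> * of_real \<psi>)) \<partial>lborel)
      = of_real (\<integral>u. 1 / sqrt (a\<^sup>2 + b\<^sup>2 + 2 * a * b * cosh u) \<partial>lborel)"
    and "integrable lborel (\<lambda>u::real. 1 / sqrt (a\<^sup>2 + b\<^sup>2 + 2 * a * b * cosh u))"
proof -
  define h where "h w = 1 / csqrt (cosh_kernel a b w)" for w :: complex
  have bound: "cmod (h w) \<le> (1 / (cos (\<theta> / 2) * sqrt (a * b))) * exp (- \<bar>Re w\<bar> * (1/2))" if w: "\<bar>Im w\<bar> \<le> \<theta>" "\<theta> < pi" for w \<theta>
  proof -
    have c: "0 < cos (\<theta> / 2)" using w by (intro cos_gt_zero_pi) auto
    have pos: "0 < (cos (\<theta> / 2))\<^sup>2 * (a * b * exp \<bar>Re w\<bar>)" using c ab by simp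
    have "cmod (h w) = 1 / sqrt (cmod (cosh_kernel a b w))"
      unfolding h_def norm_divide cmod_csqrt by simp
    also have "\<dots> \<le> 1 / sqrt ((cos (\<theta> / 2))\<^sup>2 * (a * b * exp \<bar>Re w\<bar>))"
      using cosh_kernel_bound[OF ab w] pos by (intro divide_left_mono) (auto intro!: mult_pos_pos)
    also have "sqrt ((cos (\<theta> / 2))\<^sup>2 * (a * b * exp \<bar>Re w\<bar>)) = cos (\<theta> / 2) * sqrt (a * b) * exp (\<bar>Re w\<bar> / 2)"
    proof -
      have "sqrt (exp \<bar>Re w\<bar>) = exp (\<bar>Re w\<bar> / 2)" by (rule real_sqrt_unique) (simp_all add: exp_half_squared)
      then show ?thesis using c by (simp add: real_sqrt_mult)
    qed
    finally show ?thesis by (simp add: exp_minus field_simps)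
  qed
  have [measurable]: "h \<in> borel_measurable borel" unfolding h_def by measurable
  have int: "integrable lborel (\<lambda>u::real. h (of_real u + \<i> * of_real \<theta>))" if "\<bar>\<theta>\<bar> < pi" for \<theta>
  proof (rule Bochner_Integration.integrable_bound)
    show "integrable lborel (\<lambda>u. (1 / (cos (\<bar>\<theta>\<bar> / 2) * sqrt (a * b))) * exp (- \<bar>u\<bar> * (1/2)))"
      by (intro integrable_mult_right integrable_exp_minus_abs) simp
    show "AE u in lborel. norm (h (of_real u + \<i> * of_real \<theta>)) \<le> norm ((1 / (cos (\<bar>\<theta>\<bar> / 2) * sqrt (a * b))) * exp (- \<bar>u\<bar> * (1/2)))"
    proof (rule AE_I2)
      fix u :: real
      show "norm (h (of_real u + \<i> * of_real \<theta>)) \<le> norm ((1 / (cos (\<bar>\<theta>\<bar> / 2) * sqrt (a * b))) * exp (- \<bar>u\<bar> * (1/2)))"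
        unfolding real_norm_def
      proof (rule order_trans[OF _ abs_ge_self])
        show "norm (h (of_real u + \<i> * of_real \<theta>)) \<le> (1 / (cos (\<bar>\<theta>\<bar> / 2) * sqrt (a * b))) * exp (- \<bar>u\<bar> * (1/2))"
          using bound[of "of_real u + \<i> * of_real \<theta>" "\<bar>\<theta>\<bar>"] that by simp
      qed
    qed
  qed measurable
  show int1: "integrable lborel (\<lambda>u::real. 1 / csqrt (cosh_kernel a b (of_real u + \<i> * of_real \<psi>)))"
    using int[OF psi] by (simp add: h_def)
  have hreal: "h (of_real u) = of_real (1 / sqrt (a\<^sup>2 + b\<^sup>2 + 2 * a * b * cosh u))" for u
  proof -
    have "cosh_kernel a b (of_real u) = of_real (a\<^sup>2 + b\<^sup>2 + 2 * a * b * cosh u)"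
      by (simp add: cosh_def scaleR_conv_of_real exp_of_real[symmetric])
    moreover have "0 \<le> a\<^sup>2 + b\<^sup>2 + 2 * a * b * cosh u"
      using ab by (intro add_nonneg_nonneg mult_nonneg_nonneg) auto
    ultimately show ?thesis by (simp add: h_def del: of_real_add of_real_mult of_real_power)
  qed
  have int0: "integrable lborel (\<lambda>u::real. h (of_real u))" using int[of 0] by simp
  then show "integrable lborel (\<lambda>u::real. 1 / sqrt (a\<^sup>2 + b\<^sup>2 + 2 * a * b * cosh u))"
    unfolding hreal complex_of_real_integrable_eq .
  have "(\<integral>u. h (of_real u + \<i> * of_real \<psi>) \<partial>lborel) = (\<integral>u. h (of_real u) \<partial>lborel)"
  proof (rule integral_strip_shift[where r = pi and \<delta> = "1/2" and C = "1 / (cos (\<bar>\<psi>\<bar> / 2) * sqrt (a * b))"])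
    show "h holomorphic_on {w. \<bar>Im w\<bar> < pi}"
    proof -
      have "cosh_kernel a b w \<noteq> 0" if "\<bar>Im w\<bar> < pi" for w
        using cosh_kernel_not_nonpos[OF ab that] by (metis nonpos_Reals_zero_I)
      then show ?thesis
        unfolding h_def using cosh_kernel_not_nonpos[OF ab]
        by (intro holomorphic_intros) (auto simp: cosh_field_def intro!: holomorphic_intros)
    qed
  qed (use psi int[OF psi] int0 bound[of _ "\<bar>\<psi>\<bar>"] in auto)
  also have "\<dots> = of_real (\<integral>u. 1 / sqrt (a\<^sup>2 + b\<^sup>2 + 2 * a * b * cosh u) \<partial>lborel)"
    unfolding hreal by (rule integral_complex_of_real)
  finally show "(\<integral>u. 1 / csqrt (cosh_kernel a b (of_real u + \<i> * of_real \<psi>)) \<partial>lborel)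
      = of_real (\<integral>u. 1 / sqrt (a\<^sup>2 + b\<^sup>2 + 2 * a * b * cosh u) \<partial>lborel)"
    by (simp add: h_def)
qed

abbreviation cos_kernel :: "real \<Rightarrow> real \<Rightarrow> complex \<Rightarrow> complex" where
  "cos_kernel a b w \<equiv> of_real (a\<^sup>2 + b\<^sup>2) + of_real (2 * a * b) * cos w"

lemma cos_kernel_eq:
  "cos_kernel a b w
    = (of_real a + of_real b * exp (\<i> * w)) * (of_real a + of_real b * exp (- \<i> * w :: complex))"
proof -
  have "exp (\<i> * w) * exp (- \<i> * w) = 1" by (simp flip: exp_add)
  then show ?thesis
    unfolding cos_exp_eq by (simp add: power2_eq_square algebra_simps)
qed

text \<open>
  The bound on \<open>Im w\<close> is what keeps \<open>\<bar>b exp (\<i> w)\<bar>\<close> and \<open>\<bar>b exp (- \<i> w)\<bar>\<close> below \<open>a\<close>, so that both factors in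
  \<open>cos_kernel_eq\<close> lie in the right half-plane.
\<close>
lemma cos_kernel_not_nonpos:
  assumes "b > 0" "b < a" "\<bar>Im w\<bar> < ln (a / b)"
  shows "cos_kernel a b w \<notin> \<real>\<^sub>\<le>\<^sub>0"
proof -
  have pos: "Re (of_real a + of_real b * exp z) > 0" if "Re z < ln (a / b)" for z
  proof -
    have "exp (Re z) < exp (ln (a / b))" using that by simp
    then have 1: "b * exp (Re z) < a" using assms by (simp add: field_simps)
    have "- cmod (of_real b * exp z) \<le> Re (of_real b * exp z)" using abs_Re_le_cmod[of "of_real b * exp z"] by linarith
    also have "cmod (of_real b * exp z) = b * exp (Re z)" using assms by (simp add: norm_mult)
    finally show ?thesis using 1 by simp
  qed
  show ?thesis unfolding cos_kernel_eq
    using assms by (intro right_half_plane_mult pos) auto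
qed

lemma inv_sqrt_cos_shift:
  assumes ab: "b > 0" "b < a" and eta: "\<bar>\<eta>\<bar> < ln (a / b)"
  shows "set_integrable lborel {-pi<..<pi} (\<lambda>\<phi>::real. 1 / csqrt (cos_kernel a b (of_real \<phi> + \<i> * of_real \<eta>)))"
    and "(LINT \<phi>:{-pi<..<pi}|lborel. 1 / csqrt (cos_kernel a b (of_real \<phi> + \<i> * of_real \<eta>)))
      = of_real (LINT \<phi>:{-pi<..<pi}|lborel. 1 / sqrt (a\<^sup>2 + b\<^sup>2 + 2 * a * b * cos \<phi>))"
    and "set_integrable lborel {-pi<..<pi} (\<lambda>\<phi>::real. 1 / sqrt (a\<^sup>2 + b\<^sup>2 + 2 * a * b * cos \<phi>))"
proof -
  define h where "h w = 1 / csqrt (cos_kernel a b w)" for w :: complex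
  have r: "ln (a / b) > 0" using ab by simp
  have hol: "h holomorphic_on {w. \<bar>Im w\<bar> < ln (a / b)}"
  proof -
    have "cos_kernel a b w \<noteq> 0" if "\<bar>Im w\<bar> < ln (a / b)" for w
      using cos_kernel_not_nonpos[OF ab that] by (metis nonpos_Reals_zero_I)
    then show ?thesis
      unfolding h_def using cos_kernel_not_nonpos[OF ab]
      by (intro holomorphic_intros) auto
  qed
  have int: "set_integrable lborel {-pi<..<pi} (\<lambda>\<phi>::real. h (of_real \<phi> + \<i> * of_real \<theta>))" if "\<bar>\<theta>\<bar> < ln (a / b)" for \<theta>
  proof (rule set_integrable_subset[OF borel_integrable_atLeastAtMost'])
    show "continuous_on {-pi..pi} (\<lambda>\<phi>::real. h (of_real \<phi> + \<i> * of_real \<theta>))"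
      by (rule continuous_on_compose2[OF holomorphic_on_imp_continuous_on[OF hol]])
         (use that in \<open>auto intro!: continuous_intros\<close>)
  qed auto
  have eqI: "(LINT \<phi>:{-pi<..<pi}|lborel. h (of_real \<phi> + \<i> * of_real \<theta>)) = integral {-pi..-pi+2*pi} (\<lambda>\<phi>. h (of_real \<phi> + \<i> * of_real \<theta>))"
    if "\<bar>\<theta>\<bar> < ln (a / b)" for \<theta>
    using set_borel_integral_eq_integral(2)[OF int[OF that]] by (simp add: integral_open_interval_real)
  show "set_integrable lborel {-pi<..<pi} (\<lambda>\<phi>::real. 1 / csqrt (cos_kernel a b (of_real \<phi> + \<i> * of_real \<eta>)))"
    using int[OF eta] by (simp add: h_def)
  have hreal: "h (of_real u) = of_real (1 / sqrt (a\<^sup>2 + b\<^sup>2 + 2 * a * b * cos u))" for u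
  proof -
    have "cos_kernel a b (of_real u) = of_real (a\<^sup>2 + b\<^sup>2 + 2 * a * b * cos u)"
      by (simp add: cos_of_real)
    moreover have "0 \<le> a\<^sup>2 + b\<^sup>2 + 2 * a * b * cos u"
    proof -
      have "2 * a * b * (- 1) \<le> 2 * a * b * cos u" using ab by (intro mult_left_mono) auto
      moreover have "0 \<le> (a - b)\<^sup>2" by simp
      ultimately show ?thesis by (simp add: power2_diff)
    qed
    ultimately show ?thesis by (simp add: h_def del: of_real_add of_real_mult of_real_power)
  qed
  have int0: "set_integrable lborel {-pi<..<pi} (\<lambda>u::real. h (of_real u))" using int[of 0] r by simp
  then have "integrable lborel (\<lambda>x. of_real (indicator {-pi<..<pi} x * (1 / sqrt (a\<^sup>2 + b\<^sup>2 + 2 * a * b * cos x))) :: complex)"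
    unfolding set_integrable_def hreal scaleR_conv_of_real of_real_mult .
  then show "set_integrable lborel {-pi<..<pi} (\<lambda>\<phi>::real. 1 / sqrt (a\<^sup>2 + b\<^sup>2 + 2 * a * b * cos \<phi>))"
    unfolding set_integrable_def real_scaleR_def complex_of_real_integrable_eq .
  have "(LINT \<phi>:{-pi<..<pi}|lborel. h (of_real \<phi> + \<i> * of_real \<eta>)) = (LINT \<phi>:{-pi<..<pi}|lborel. h (of_real \<phi>))"
  proof -
    have "cos (w + of_real (2 * pi)) = cos w" for w :: complex
      by (simp only: cos_add cos_of_real sin_of_real cos_two_pi sin_two_pi) simp
    then have "h (w + of_real (2 * pi)) = h w" for w
      unfolding h_def by simp
    then show ?thesis
      using eqI[OF eta] eqI[of 0] r integral_periodic_shift[OF hol, of "\<i> * of_real \<eta>" "2 * pi" "- pi"] eta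
      by simp
  qed
  also have "\<dots> = of_real (LINT \<phi>:{-pi<..<pi}|lborel. 1 / sqrt (a\<^sup>2 + b\<^sup>2 + 2 * a * b * cos \<phi>))"
    unfolding hreal set_lebesgue_integral_def real_scaleR_def
    by (subst integral_complex_of_real[symmetric]) (simp add: scaleR_conv_of_real)
  finally show "(LINT \<phi>:{-pi<..<pi}|lborel. 1 / csqrt (cos_kernel a b (of_real \<phi> + \<i> * of_real \<eta>)))
      = of_real (LINT \<phi>:{-pi<..<pi}|lborel. 1 / sqrt (a\<^sup>2 + b\<^sup>2 + 2 * a * b * cos \<phi>))"
    by (simp add: h_def)
qed

section \<open>Invariance under the Borchardt mean\<close>

lemma agm_period_eq_integral:
  assumes "a > 0" "b > 0"
  shows "agm_period (a\<^sup>2) (b\<^sup>2) = ennreal (\<integral>u. 1 / sqrt (a\<^sup>2 + b\<^sup>2 + 2 * a * b * cosh u) \<partial>lborel)"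
proof -
  have "0 \<le> a\<^sup>2 + b\<^sup>2 + 2 * a * b * cosh u" for u
    using assms by (intro add_nonneg_nonneg mult_nonneg_nonneg) auto
  then show ?thesis
    unfolding agm_period_eq_cosh[OF assms, symmetric]
    by (intro nn_integral_eq_integral inv_sqrt_cosh_shift(3)[OF assms, of 0]) auto
qed

lemma agm_period_eq_angle_integral:
  assumes ab: "b > 0" "b < a"
  shows "2 * agm_period (a\<^sup>2) (a\<^sup>2 - b\<^sup>2) = ennreal (LINT \<phi>:{-pi<..<pi}|lborel. 1 / sqrt (a\<^sup>2 + b\<^sup>2 + 2 * a * b * cos \<phi>))"
proof -
  have nn: "0 \<le> a\<^sup>2 + b\<^sup>2 + 2 * a * b * cos u" for u
  proof -
    have "2 * a * b * (- 1) \<le> 2 * a * b * cos u" using ab by (intro mult_left_mono) auto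
    moreover have "0 \<le> (a - b)\<^sup>2" by simp
    ultimately show ?thesis by (simp add: power2_diff)
  qed
  have r: "\<bar>0\<bar> < ln (a / b)" using ab by simp
  have "2 * agm_period (a\<^sup>2) (a\<^sup>2 - b\<^sup>2) = 2 * (\<integral>\<^sup>+\<phi>\<in>{0<..<pi}. ennreal (1 / sqrt (a\<^sup>2 + b\<^sup>2 + 2 * a * b * cos \<phi>)) \<partial>lborel)"
    using landen_transformation[OF ab(2,1)] by simp
  also have "\<dots> = (\<integral>\<^sup>+\<phi>\<in>{-pi<..<pi}. ennreal (1 / sqrt (a\<^sup>2 + b\<^sup>2 + 2 * a * b * cos \<phi>)) \<partial>lborel)"
    by (rule nn_integral_even(1)[symmetric]) simp_all
  also have "\<dots> = (\<integral>\<^sup>+\<phi>. ennreal (indicator {-pi<..<pi} \<phi> *\<^sub>R (1 / sqrt (a\<^sup>2 + b\<^sup>2 + 2 * a * b * cos \<phi>))) \<partial>lborel)"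
    by (intro nn_integral_cong) (simp add: indicator_def)
  also have "\<dots> = ennreal (LINT \<phi>:{-pi<..<pi}|lborel. 1 / sqrt (a\<^sup>2 + b\<^sup>2 + 2 * a * b * cos \<phi>))"
    unfolding set_lebesgue_integral_def
    by (intro nn_integral_eq_integral inv_sqrt_cos_shift(3)[OF ab r, unfolded set_integrable_def])
       (use nn in \<open>auto simp: indicator_def\<close>)
  finally show ?thesis .
qed

text \<open>
  As a function on the line, the product of a bilinear factor and its reflection is a \<open>cosh_kernel\<close> on a
  line shifted by \<open>\<psi> = Arg (g * cnj f)\<close>.
\<close>
lemma kernel_on_line:
  fixes f g :: complex
  assumes "Re f > 0" "Re g > 0"
  obtains \<psi> where "\<bar>\<psi>\<bar> < pi"
    "\<And>u. (f + g * of_real (exp u)) * (cnj f + cnj g * of_real (exp (- u)))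
      = cosh_kernel (cmod f) (cmod g) (of_real u + \<i> * of_real \<psi>)"
proof
  define z where "z = g * cnj f"
  have nn: "z \<notin> \<real>\<^sub>\<le>\<^sub>0" unfolding z_def using assms by (intro right_half_plane_mult) simp_all
  show "\<bar>Arg z\<bar> < pi"
  proof -
    have "z \<noteq> 0" using nn by (metis nonpos_Reals_zero_I)
    then have "Arg z \<noteq> pi" using nn by (auto simp: Arg_eq_pi complex_nonpos_Reals_iff)
    then show ?thesis using mpi_less_Arg[of z] Arg_le_pi[of z] by linarith
  qed
  fix u :: real
  have z: "z = of_real (cmod f * cmod g) * exp (\<i> * of_real (Arg z))"
  proof -
    have "z = of_real (cmod z) * exp (\<i> * of_real (Arg z))"
      by (metis cis_conv_exp rcis_cmod_Arg rcis_def)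
    then show ?thesis by (simp add: z_def norm_mult mult.commute)
  qed
  have zc: "cnj z = of_real (cmod f * cmod g) * exp (- \<i> * of_real (Arg z))"
    by (subst z) (simp add: exp_cnj)
  have e: "of_real (exp u) = exp (of_real u :: complex)" "of_real (exp (- u)) = exp (- of_real u :: complex)"
    by (simp_all add: exp_of_real[symmetric])
  have e1: "exp (of_real u) * exp (- of_real u :: complex) = 1" by (simp flip: exp_add)
  have f2: "f * cnj f = of_real ((cmod f)\<^sup>2)" "g * cnj g = of_real ((cmod g)\<^sup>2)"
    by (simp_all only: complex_norm_square)
  have "(f + g * exp (of_real u)) * (cnj f + cnj g * exp (- of_real u)) = f * cnj f + g * cnj g * (exp (of_real u) * exp (- of_real u))
     + z * exp (of_real u) + cnj z * exp (- of_real u)"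
    by (simp add: z_def algebra_simps)
  also have "\<dots> = of_real ((cmod f)\<^sup>2 + (cmod g)\<^sup>2) + of_real (cmod f * cmod g) *
      (exp (of_real u) * exp (\<i> * of_real (Arg z)) + exp (- of_real u) * exp (- \<i> * of_real (Arg z)))"
    unfolding e1 f2 by (subst zc, subst z) (simp add: algebra_simps)
  also have "exp (of_real u) * exp (\<i> * of_real (Arg z)) + exp (- of_real u) * exp (- \<i> * of_real (Arg z))
      = 2 * cosh (of_real u + \<i> * of_real (Arg z))"
    by (simp add: cosh_def scaleR_conv_of_real flip: exp_add)
  finally show "(f + g * of_real (exp u)) * (cnj f + cnj g * of_real (exp (- u)))
      = cosh_kernel (cmod f) (cmod g) (of_real u + \<i> * of_real (Arg z))"
    unfolding e by (simp add: mult_ac)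
qed

text \<open>
  On the circle such a product is a \<open>cos_kernel\<close> shifted by \<open>\<eta>\<close>, where \<open>exp (2 \<eta>) = F G' / (F' G)\<close>.  The bound on
  \<open>\<eta>\<close> amounts to \<open>G < F\<close> and \<open>G' < F'\<close>.
\<close>
lemma kernel_on_circle:
  fixes F G F' G' :: real
  assumes pos: "0 < G" "G < F" "0 < G'" "G' < F'"
  obtains \<eta> where "\<bar>\<eta>\<bar> < ln (sqrt (F * F') / sqrt (G * G'))"
    "\<And>\<phi>. (of_real F + of_real G * exp (\<i> * of_real \<phi>)) * (of_real F' + of_real G' * exp (- \<i> * of_real \<phi>))
      = cos_kernel (sqrt (F * F')) (sqrt (G * G')) (of_real \<phi> + \<i> * of_real \<eta>)"
proof
  define \<eta> where "\<eta> = (ln (F * G') - ln (F' * G)) / 2"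
  have p: "F > 0" "F' > 0" using pos by auto
  define k where "k = sqrt (F * F') * sqrt (G * G')"
  have k: "k > 0" using p pos by (simp add: k_def)
  have l: "ln (sqrt (F * F') / sqrt (G * G')) = (ln F + ln F' - ln G - ln G') / 2"
    using p pos by (simp add: ln_div ln_sqrt ln_mult field_simps)
  have "ln G < ln F" "ln G' < ln F'" using pos p by auto
  then show "\<bar>\<eta>\<bar> < ln (sqrt (F * F') / sqrt (G * G'))"
    unfolding l \<eta>_def using p pos by (simp add: ln_mult abs_if field_simps)
  have lk: "ln k = (ln F + ln F' + ln G + ln G') / 2"
    using p pos by (simp add: k_def ln_sqrt ln_mult add_divide_distrib)
  have "ln k - \<eta> = ln (F' * G)" "ln k + \<eta> = ln (F * G')"
    unfolding lk \<eta>_def using p pos by (simp_all add: ln_mult field_simps)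
  then have "exp (ln k - \<eta>) = F' * G" "exp (ln k + \<eta>) = F * G'" using p pos by simp_all
  then have e: "k * exp (- \<eta>) = F' * G" "k * exp \<eta> = F * G'"
    using k by (simp_all add: exp_add exp_diff exp_minus field_simps)
  fix \<phi> :: real
  have c: "of_real (2 * k) * cos (of_real \<phi> + \<i> * of_real \<eta>) = of_real (k * exp (- \<eta>)) * exp (\<i> * of_real \<phi>) + of_real (k * exp \<eta>) * exp (- \<i> * of_real \<phi>)"
  proof -
    have "exp (\<i> * (of_real \<phi> + \<i> * of_real \<eta>)) = of_real (exp (- \<eta>)) * exp (\<i> * of_real \<phi>)"
      "exp (- (\<i> * (of_real \<phi> + \<i> * of_real \<eta>))) = of_real (exp \<eta>) * exp (- \<i> * of_real \<phi>)"
      by (simp_all add: exp_of_real[symmetric] algebra_simps flip: exp_add mult.assoc)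
    then show ?thesis by (simp add: cos_exp_eq algebra_simps)
  qed
  have e1: "exp (\<i> * of_real \<phi>) * exp (- \<i> * of_real \<phi>) = 1" by (simp flip: exp_add)
  have "(of_real F + of_real G * exp (\<i> * of_real \<phi>)) * (of_real F' + of_real G' * exp (- \<i> * of_real \<phi>))
     = of_real (F * F') + of_real (G * G') * (exp (\<i> * of_real \<phi>) * exp (- \<i> * of_real \<phi>)) + of_real (2 * k) * cos (of_real \<phi> + \<i> * of_real \<eta>)"
    unfolding c e by (simp add: algebra_simps)
  also have "\<dots> = cos_kernel (sqrt (F * F')) (sqrt (G * G')) (of_real \<phi> + \<i> * of_real \<eta>)"
    unfolding e1 k_def using p pos by (simp add: mult.assoc)
  finally show "(of_real F + of_real G * exp (\<i> * of_real \<phi>)) * (of_real F' + of_real G' * exp (- \<i> * of_real \<phi>))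
      = cos_kernel (sqrt (F * F')) (sqrt (G * G')) (of_real \<phi> + \<i> * of_real \<eta>)" .
qed

text \<open>
  Both sides are iterated integrals of the inverse square root of
  \<open>Dc = (F(u) + G(u) exp (\<i> \<phi>)) (F(-u) + G(-u) exp (- \<i> \<phi>))\<close> over \<open>u\<close> in the line and \<open>\<phi>\<close> in the circle.
  Sorting the first factor as \<open>f(\<phi>) + g(\<phi>) exp u\<close> evaluates the integral over \<open>u\<close>; sorting it as
  \<open>F(u) + G(u) exp (\<i> \<phi>)\<close> evaluates the one over \<open>\<phi>\<close>, by the Landen transformation.
\<close>
lemma line_circle_exchange:
  assumes e: "0 < e3" "e3 < e1" "0 < e4" "e4 < e2"
  shows "(\<integral>\<^sup>+\<phi>\<in>{0<..<pi}. agm_period (e1\<^sup>2 + e3\<^sup>2 + 2 * e1 * e3 * cos \<phi>) (e2\<^sup>2 + e4\<^sup>2 + 2 * e2 * e4 * cos \<phi>) \<partial>lborel)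
    = (\<integral>\<^sup>+u. agm_period (e1\<^sup>2 + e2\<^sup>2 + 2 * e1 * e2 * cosh u)
        (e1\<^sup>2 + e2\<^sup>2 + 2 * e1 * e2 * cosh u - (e3\<^sup>2 + e4\<^sup>2 + 2 * e3 * e4 * cosh u)) \<partial>lborel)"
proof -
  define F G where "F u = e1 + e2 * exp u" and "G u = e3 + e4 * exp u" for u :: real
  let ?A = "\<lambda>u. sqrt (F u * F (- u))" and ?B = "\<lambda>u. sqrt (G u * G (- u))"
  define f g where "f \<phi> = of_real e1 + of_real e3 * exp (\<i> * of_real \<phi>)"
    and "g \<phi> = of_real e2 + of_real e4 * exp (\<i> * of_real \<phi>)" for \<phi> :: real
  define Dc where "Dc \<phi> u = (of_real (F u) + of_real (G u) * exp (\<i> * of_real \<phi>))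
     * (of_real (F (- u)) + of_real (G (- u)) * exp (- \<i> * of_real \<phi>))" for \<phi> u :: real
  define K where "K \<phi> u = 1 / csqrt (Dc \<phi> u)" for \<phi> u
  have FG: "0 < G u" "G u < F u" for u
  proof -
    show "0 < G u" using e by (simp add: G_def add_pos_pos)
    have "e4 * exp u < e2 * exp u" using e by simp
    then show "G u < F u" unfolding F_def G_def by (intro add_strict_mono e(2))
  qed
  have Dfg: "Dc \<phi> u = (f \<phi> + g \<phi> * of_real (exp u)) * (cnj (f \<phi>) + cnj (g \<phi>) * of_real (exp (- u)))" for \<phi> u
    by (simp add: Dc_def F_def G_def f_def g_def exp_cnj algebra_simps)
  have Re_aux: "Re (of_real x + of_real y * exp (\<i> * of_real \<phi>)) > 0" if "0 < y" "y < x" for x y \<phi> :: real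
  proof -
    have "y * (- 1) \<le> y * cos \<phi>" using that by (intro mult_left_mono) auto
    then show ?thesis using that by (simp add: Re_exp)
  qed
  have fg: "Re (f \<phi>) > 0" "Re (g \<phi>) > 0" for \<phi>
    unfolding f_def g_def using e by (intro Re_aux; simp)+
  have cmod_aux: "(cmod (of_real x + of_real y * exp (\<i> * of_real \<phi>)))\<^sup>2 = x\<^sup>2 + y\<^sup>2 + 2 * x * y * cos \<phi>" for x y \<phi> :: real
  proof -
    have "(x + y * cos \<phi>)\<^sup>2 + (y * sin \<phi>)\<^sup>2 = x\<^sup>2 + y\<^sup>2 + 2 * x * y * cos \<phi>"
      using sin_cos_squared_add[of \<phi>] by algebra
    then show ?thesis unfolding cmod_power2 by (simp add: Re_exp Im_exp)
  qed
  define L where "L \<phi> = (\<integral>u. 1 / sqrt ((cmod (f \<phi>))\<^sup>2 + (cmod (g \<phi>))\<^sup>2 + 2 * cmod (f \<phi>) * cmod (g \<phi>) * cosh u) \<partial>lborel)" for \<phi>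
  define R where "R u = (LINT \<phi>:{-pi<..<pi}|lborel. 1 / sqrt ((?A u)\<^sup>2 + (?B u)\<^sup>2
      + 2 * ?A u * ?B u * cos \<phi>))" for u
  have ellL: "agm_period (e1\<^sup>2 + e3\<^sup>2 + 2 * e1 * e3 * cos \<phi>) (e2\<^sup>2 + e4\<^sup>2 + 2 * e2 * e4 * cos \<phi>) = ennreal (L \<phi>)" for \<phi>
  proof -
    have "cmod (f \<phi>) > 0" "cmod (g \<phi>) > 0" using fg[of \<phi>] by auto
    from agm_period_eq_integral[OF this] show ?thesis
      unfolding L_def by (simp add: cmod_aux f_def g_def)
  qed
  have KL: "(\<integral>u. K \<phi> u \<partial>lborel) = of_real (L \<phi>)" for \<phi>
  proof -
    obtain \<psi> where psi: "\<bar>\<psi>\<bar> < pi" and eq: "\<And>u. Dc \<phi> u = cosh_kernel (cmod (f \<phi>)) (cmod (g \<phi>)) (of_real u + \<i> * of_real \<psi>)"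
      using kernel_on_line[OF fg[of \<phi>]] unfolding Dfg[symmetric] by blast
    have "cmod (f \<phi>) > 0" "cmod (g \<phi>) > 0" using fg[of \<phi>] by auto
    from inv_sqrt_cosh_shift(2)[OF this psi] show ?thesis unfolding K_def eq L_def .
  qed
  have sq: "0 < ?B u" "?B u < ?A u" for u
    using FG[of u] FG[of "- u"] by (auto intro!: mult_strict_mono)
  have KR: "(LINT \<phi>:{-pi<..<pi}|lborel. K \<phi> u) = of_real (R u)" for u
  proof -
    obtain \<eta> where eta: "\<bar>\<eta>\<bar> < ln (?A u / ?B u)"
      and eq: "\<And>\<phi>. Dc \<phi> u = cos_kernel (?A u) (?B u) (of_real \<phi> + \<i> * of_real \<eta>)"
      using kernel_on_circle[OF FG[of u] FG[of "- u"]] unfolding Dc_def by blast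
    from inv_sqrt_cos_shift(2)[OF sq eta] show ?thesis unfolding K_def eq R_def .
  qed
  have FF: "(?A u)\<^sup>2 = e1\<^sup>2 + e2\<^sup>2 + 2 * e1 * e2 * cosh u" 
    "(?B u)\<^sup>2 = e3\<^sup>2 + e4\<^sup>2 + 2 * e3 * e4 * cosh u" for u
  proof -
    have "(?A u)\<^sup>2 = F u * F (- u)" "(?B u)\<^sup>2 = G u * G (- u)"
      using FG[of u] FG[of "- u"] by simp_all
    then show "(?A u)\<^sup>2 = e1\<^sup>2 + e2\<^sup>2 + 2 * e1 * e2 * cosh u" 
      "(?B u)\<^sup>2 = e3\<^sup>2 + e4\<^sup>2 + 2 * e3 * e4 * cosh u"
      unfolding F_def G_def mult_exp_pair by simp_all
  qed
  have ellR: "2 * agm_period (e1\<^sup>2 + e2\<^sup>2 + 2 * e1 * e2 * cosh u)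
        (e1\<^sup>2 + e2\<^sup>2 + 2 * e1 * e2 * cosh u - (e3\<^sup>2 + e4\<^sup>2 + 2 * e3 * e4 * cosh u)) = ennreal (R u)" for u
    using agm_period_eq_angle_integral[OF sq[of u]] unfolding R_def FF .
  have [measurable]: "(\<lambda>p. K (fst p) (snd p)) \<in> borel_measurable lborel2"
    unfolding K_def Dc_def F_def G_def by measurable
  \<comment> \<open>For Fubini: \<open>\<bar>F + G exp (\<i> \<phi>)\<bar> \<ge> F - G\<close>, which bounds \<open>\<bar>Dc\<bar>\<close> below by a multiple of \<open>exp \<bar>u\<bar>\<close>.\<close>
  define C where "C = 1 / sqrt ((e1 - e3) * (e2 - e4))"
  have Kbound: "cmod (K \<phi> u) \<le> C * exp (- \<bar>u\<bar> * (1/2))" for \<phi> u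
  proof -
    have low: "F u - G u \<le> cmod (of_real (F u) + of_real (G u) * exp (\<i> * of_real x))" for u x
    proof -
      have "cmod (of_real (F u)) - cmod (of_real (G u) * exp (\<i> * of_real x)) \<le> cmod (of_real (F u) + of_real (G u) * exp (\<i> * of_real x))"
        by (rule norm_diff_ineq)
      then show ?thesis using FG[of u] by (simp add: norm_mult)
    qed
    have "(e1 - e3) * (e2 - e4) * exp \<bar>u\<bar> \<le> (F u - G u) * (F (- u) - G (- u))"
    proof -
      have "(F u - G u) * (F (- u) - G (- u)) = (e1 - e3)\<^sup>2 + (e2 - e4)\<^sup>2 + (e1 - e3) * (e2 - e4) * (exp u + exp (- u))"
        by (simp add: F_def G_def exp_minus field_simps power2_eq_square)
      moreover have "(e1 - e3) * (e2 - e4) * exp \<bar>u\<bar> \<le> (e1 - e3) * (e2 - e4) * (exp u + exp (- u))"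
        using e by (intro mult_left_mono) (auto simp: abs_if)
      ultimately show ?thesis by (smt (verit) zero_le_power2)
    qed
    also have "\<dots> \<le> cmod (Dc \<phi> u)"
      unfolding Dc_def norm_mult using FG[of u] FG[of "- u"] low[of u \<phi>] low[of "- u" "- \<phi>"]
      by (intro mult_mono) auto
    finally have "sqrt ((e1 - e3) * (e2 - e4) * exp \<bar>u\<bar>) \<le> sqrt (cmod (Dc \<phi> u))" by simp
    moreover have "sqrt ((e1 - e3) * (e2 - e4) * exp \<bar>u\<bar>) = sqrt ((e1 - e3) * (e2 - e4)) * exp (\<bar>u\<bar> / 2)"
    proof -
      have "sqrt (exp \<bar>u\<bar>) = exp (\<bar>u\<bar> / 2)" by (rule real_sqrt_unique) (simp_all add: exp_half_squared)
      then show ?thesis by (simp add: real_sqrt_mult)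
    qed
    moreover have p: "0 < sqrt ((e1 - e3) * (e2 - e4)) * exp (\<bar>u\<bar> / 2)" using e by simp
    ultimately have "1 / sqrt (cmod (Dc \<phi> u)) \<le> 1 / (sqrt ((e1 - e3) * (e2 - e4)) * exp (\<bar>u\<bar> / 2))"
      by (intro divide_left_mono) (auto intro!: mult_pos_pos)
    then show ?thesis
      unfolding K_def norm_divide cmod_csqrt C_def by (simp add: exp_minus field_simps)
  qed
  have C: "C \<ge> 0" using e by (simp add: C_def)
  have int: "integrable lborel2 (\<lambda>(\<phi>, u). indicator {-pi<..<pi} \<phi> *\<^sub>R K \<phi> u)"
  proof (rule integrable_product_bound[where p = "indicator {-pi<..<pi}" and q = "\<lambda>u. C * exp (- \<bar>u\<bar> * (1/2))"])
    show "integrable lborel (indicator {-pi<..<pi} :: real \<Rightarrow> real)" by (simp add: integrable_indicator_iff)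
    show "integrable lborel (\<lambda>u. C * exp (- \<bar>u\<bar> * (1/2)))" by (intro integrable_mult_right integrable_exp_minus_abs) simp
  qed (use Kbound C in \<open>auto simp: case_prod_beta indicator_def\<close>)
  have i1: "(\<lambda>\<phi>. \<integral>u. indicator {-pi<..<pi} \<phi> *\<^sub>R K \<phi> u \<partial>lborel) = (\<lambda>\<phi>. of_real (indicator {-pi<..<pi} \<phi> * L \<phi>))"
    by (simp add: KL scaleR_conv_of_real)
  have i2: "(\<lambda>u. \<integral>\<phi>. indicator {-pi<..<pi} \<phi> *\<^sub>R K \<phi> u \<partial>lborel) = (\<lambda>u. of_real (R u))"
    using KR by (simp add: set_lebesgue_integral_def)
  have L: "integrable lborel (\<lambda>\<phi>. indicator {-pi<..<pi} \<phi> * L \<phi>)"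
    using lborel_pair.integrable_fst[OF int] unfolding i1 complex_of_real_integrable_eq .
  have R: "integrable lborel R"
    using lborel_pair.integrable_snd[OF int] unfolding i2 complex_of_real_integrable_eq .
  have "complex_of_real (\<integral>\<phi>. indicator {-pi<..<pi} \<phi> * L \<phi> \<partial>lborel) = of_real (\<integral>u. R u \<partial>lborel)"
    using lborel_pair.Fubini_integral[OF int] unfolding i1 i2 integral_complex_of_real by simp
  then have LR: "(\<integral>\<phi>. indicator {-pi<..<pi} \<phi> * L \<phi> \<partial>lborel) = (\<integral>u. R u \<partial>lborel)"
    by (simp only: of_real_eq_iff)
  have L0: "L \<phi> \<ge> 0" for \<phi>
    unfolding L_def by (intro integral_nonneg_AE AE_I2) (auto intro!: add_nonneg_nonneg)
  have R0: "R u \<ge> 0" for u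
    unfolding R_def set_lebesgue_integral_def
  proof (intro integral_nonneg_AE AE_I2)
    fix \<phi> :: real
    have "2 * ?A u * ?B u * (- 1) \<le> 2 * ?A u * ?B u * cos \<phi>" using sq[of u] by (intro mult_left_mono) auto
    moreover have "0 \<le> (?A u - ?B u)\<^sup>2" by simp
    ultimately have "0 \<le> (?A u)\<^sup>2 + (?B u)\<^sup>2 + 2 * ?A u * ?B u * cos \<phi>" by (simp only: power2_diff)
    then show "0 \<le> indicator {-pi<..<pi} \<phi> *\<^sub>R (1 / sqrt ((?A u)\<^sup>2 + (?B u)\<^sup>2 + 2 * ?A u * ?B u * cos \<phi>))" by simp
  qed
  have "2 * (\<integral>\<^sup>+\<phi>\<in>{0<..<pi}. agm_period (e1\<^sup>2 + e3\<^sup>2 + 2 * e1 * e3 * cos \<phi>) (e2\<^sup>2 + e4\<^sup>2 + 2 * e2 * e4 * cos \<phi>) \<partial>lborel)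
      = (\<integral>\<^sup>+\<phi>\<in>{-pi<..<pi}. agm_period (e1\<^sup>2 + e3\<^sup>2 + 2 * e1 * e3 * cos \<phi>) (e2\<^sup>2 + e4\<^sup>2 + 2 * e2 * e4 * cos \<phi>) \<partial>lborel)"
    by (rule nn_integral_even(1)[symmetric]) simp_all
  also have "\<dots> = (\<integral>\<^sup>+\<phi>. ennreal (indicator {-pi<..<pi} \<phi> * L \<phi>) \<partial>lborel)"
    unfolding ellL by (intro nn_integral_cong) (simp add: indicator_def)
  also have "\<dots> = ennreal (\<integral>\<phi>. indicator {-pi<..<pi} \<phi> * L \<phi> \<partial>lborel)"
    by (intro nn_integral_eq_integral L) (simp add: L0)
  also have "\<dots> = (\<integral>\<^sup>+u. ennreal (R u) \<partial>lborel)"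
    unfolding LR by (rule nn_integral_eq_integral[symmetric, OF R]) (simp add: R0)
  also have "\<dots> = 2 * (\<integral>\<^sup>+u. agm_period (e1\<^sup>2 + e2\<^sup>2 + 2 * e1 * e2 * cosh u)
        (e1\<^sup>2 + e2\<^sup>2 + 2 * e1 * e2 * cosh u - (e3\<^sup>2 + e4\<^sup>2 + 2 * e3 * e4 * cosh u)) \<partial>lborel)"
    unfolding ellR[symmetric] by (rule nn_integral_cmult) measurable
  finally show ?thesis by (simp add: ennreal_mult_cancel_left)
qed

text \<open>
  The numbers \<open>e\<^sub>1, \<dots>, e\<^sub>4\<close> below are chosen so that the circle form of \<open>J(a\<^sup>2, b\<^sup>2, c\<^sup>2, d\<^sup>2)\<close> is the left side
  of \<open>line_circle_exchange\<close>: \<open>e\<^sub>1 \<plusminus> e\<^sub>3\<close> are \<open>a\<^sup>2 + b\<^sup>2\<close> and \<open>c\<^sup>2 + d\<^sup>2\<close>, and \<open>e\<^sub>2 \<plusminus> e\<^sub>4\<close> are \<open>2 a b\<close> and \<open>2 c d\<close>.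
  The right side then turns out to be the line form of \<open>J\<close> at the four means.
\<close>
theorem borchardt_integral_mean_invariant:
  fixes a b c d :: real
  assumes "a > b" "b > c" "c > d" "d > 0"
  shows "borchardt_integral ((a\<^sup>2 + b\<^sup>2 + c\<^sup>2 + d\<^sup>2) / 4) ((a * b + c * d) / 2) ((a * c + b * d) / 2) ((a * d + b * c) / 2)
    = borchardt_integral (a\<^sup>2) (b\<^sup>2) (c\<^sup>2) (d\<^sup>2)"
proof -
  have p: "a > 0" "b > 0" "c > 0" "d > 0" using assms by auto
  define e1 e2 e3 e4 where e: "e1 = (a\<^sup>2 + b\<^sup>2 + c\<^sup>2 + d\<^sup>2) / 2" "e2 = a * b + c * d"
    "e3 = (a\<^sup>2 + b\<^sup>2 - c\<^sup>2 - d\<^sup>2) / 2" "e4 = a * b - c * d"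
  have "c\<^sup>2 < a\<^sup>2" "d\<^sup>2 < b\<^sup>2" using assms by (auto intro!: power_strict_mono)
  moreover have "c * d < a * b" using assms p by (intro mult_strict_mono) auto
  ultimately have ei: "0 < e3" "e3 < e1" "0 < e4" "e4 < e2"
    using p by (auto simp: e add_pos_pos)
  have cos_half: "cos \<phi> = 2 * (cos (\<phi> / 2))\<^sup>2 - 1" "(sin (\<phi> / 2))\<^sup>2 = 1 - (cos (\<phi> / 2))\<^sup>2" for \<phi> :: real
    using cos_double_cos[of "\<phi> / 2"] by (simp_all add: sin_squared_eq)
  have 1: "(a\<^sup>2 + b\<^sup>2)\<^sup>2 * (cos (\<phi> / 2))\<^sup>2 + (c\<^sup>2 + d\<^sup>2)\<^sup>2 * (sin (\<phi> / 2))\<^sup>2 = e1\<^sup>2 + e3\<^sup>2 + 2 * e1 * e3 * cos \<phi>"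
    "4 * (a\<^sup>2 * b\<^sup>2) * (cos (\<phi> / 2))\<^sup>2 + 4 * (c\<^sup>2 * d\<^sup>2) * (sin (\<phi> / 2))\<^sup>2 = e2\<^sup>2 + e4\<^sup>2 + 2 * e2 * e4 * cos \<phi>" for \<phi>
    unfolding cos_half[of \<phi>] e by (simp_all add: field_simps power2_eq_square)
  let ?p = "\<lambda>v. ((a\<^sup>2 + b\<^sup>2 + c\<^sup>2 + d\<^sup>2) / 4)\<^sup>2 + ((a * b + c * d) / 2)\<^sup>2 + 2 * ((a\<^sup>2 + b\<^sup>2 + c\<^sup>2 + d\<^sup>2) / 4) * ((a * b + c * d) / 2) * cosh v"
  let ?q = "\<lambda>v. ((a * c + b * d) / 2)\<^sup>2 + ((a * d + b * c) / 2)\<^sup>2 + 2 * ((a * c + b * d) / 2) * ((a * d + b * c) / 2) * cosh v"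
  have 2: "e1\<^sup>2 + e2\<^sup>2 + 2 * e1 * e2 * cosh v = 4 * ?p v"
    "e1\<^sup>2 + e2\<^sup>2 + 2 * e1 * e2 * cosh v - (e3\<^sup>2 + e4\<^sup>2 + 2 * e3 * e4 * cosh v) = 4 * ?q v" for v
    unfolding e by (simp_all add: field_simps power2_eq_square)
  have four: "agm_period (4 * p) (4 * q) = ennreal (1 / 2) * agm_period p q" for p q
    using agm_period_scale[of 4 p q] by simp
  have two: "2 * ennreal (1 / 2) = 1"
    using ennreal_mult[of 2 "1 / 2"] by simp
  have a2: "a\<^sup>2 > 0" "b\<^sup>2 > 0" "c\<^sup>2 > 0" "d\<^sup>2 > 0" using p by simp_all
  have "borchardt_integral (a\<^sup>2) (b\<^sup>2) (c\<^sup>2) (d\<^sup>2) = 2 * (\<integral>\<^sup>+v. agm_period (4 * ?p v) (4 * ?q v) \<partial>lborel)"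
    unfolding borchardt_integral_eq_angle[OF a2] 1 line_circle_exchange[OF ei] 2(2) unfolding 2(1) ..
  also have "\<dots> = 2 * (\<integral>\<^sup>+v. ennreal (1 / 2) * agm_period (?p v) (?q v) \<partial>lborel)"
    unfolding four ..
  also have "\<dots> = 2 * (ennreal (1 / 2) * (\<integral>\<^sup>+v. agm_period (?p v) (?q v) \<partial>lborel))"
    by (subst nn_integral_cmult) measurable
  also have "\<dots> = (\<integral>\<^sup>+v. agm_period (?p v) (?q v) \<partial>lborel)"
    unfolding mult.assoc[symmetric] two by simp
  also have "\<dots> = borchardt_integral ((a\<^sup>2 + b\<^sup>2 + c\<^sup>2 + d\<^sup>2) / 4) ((a * b + c * d) / 2) ((a * c + b * d) / 2) ((a * d + b * c) / 2)"
    using p by (intro borchardt_integral_eq_agm_period[symmetric]) (simp_all add: add_pos_pos)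
  finally show ?thesis by simp
qed

section \<open>Rotating the contours of the double integral\<close>

text \<open>
  The form \<open>c\<^sub>2 + c\<^sub>4 exp x + c\<^sub>1 exp y + c\<^sub>3 exp (x + y)\<close> divided by \<open>exp ((x + y) / 2)\<close>.  In this normalization
  the four exponents are \<open>(\<plusminus> x \<plusminus> y) / 2\<close>, so the values stay in the right half-plane as long as
  \<open>\<bar>Im x\<bar> + \<bar>Im y\<bar> < \<pi>\<close>.
\<close>
definition half_form :: "real \<Rightarrow> real \<Rightarrow> real \<Rightarrow> real \<Rightarrow> complex \<Rightarrow> complex \<Rightarrow> complex" where
  "half_form c1 c2 c3 c4 x y = of_real c2 * exp (- (x + y) / 2) + of_real c4 * exp ((x - y) / 2)
     + of_real c1 * exp ((y - x) / 2) + of_real c3 * exp ((x + y) / 2)"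

definition kummer_kernel :: "real \<Rightarrow> real \<Rightarrow> real \<Rightarrow> real \<Rightarrow> complex \<Rightarrow> complex \<Rightarrow> complex" where
  "kummer_kernel c1 c2 c3 c4 x y = 1 / (csqrt (half_form c1 c2 c3 c4 x y) * csqrt (half_form c1 c2 c3 c4 (- x) (- y)))"

lemma kummer_kernel_measurable[measurable]:
  assumes [measurable]: "f \<in> borel_measurable M" "g \<in> borel_measurable M"
  shows "(\<lambda>p. kummer_kernel c1 c2 c3 c4 (f p) (g p)) \<in> borel_measurable M"
  unfolding kummer_kernel_def half_form_def by measurable

text \<open>
  With a common lower bound \<open>m\<close> of the coefficients, the four terms together dominate
  \<open>m (exp (x / 2) + exp (- x / 2)) (exp (y / 2) + exp (- y / 2))\<close> at the real parts of \<open>x\<close> and \<open>y\<close>.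
\<close>
lemma Re_half_form:
  assumes c: "c1 > 0" "c2 > 0" "c3 > 0" "c4 > 0" and m: "m > 0" "m \<le> c1" "m \<le> c2" "m \<le> c3" "m \<le> c4"
    and im: "\<bar>Im x\<bar> + \<bar>Im y\<bar> \<le> \<theta>" "\<theta> < pi"
  shows "cos (\<theta> / 2) * m * exp (\<bar>Re x\<bar> / 2) * exp (\<bar>Re y\<bar> / 2) \<le> Re (half_form c1 c2 c3 c4 x y)"
proof -
  let ?h = "half_form c1 c2 c3 c4"
  have ge: "cos (\<theta> / 2) * (m * exp (Re z / 2)) \<le> Re (of_real k * exp (z / 2))"
    if z: "\<bar>Im z\<bar> \<le> \<theta>" and k: "m \<le> k" for z k
  proof -
    have c0: "0 < cos (\<theta> / 2)" using im by (intro cos_gt_zero_pi) auto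
    have "cos (\<theta> / 2) \<le> cos (\<bar>Im z\<bar> / 2)" using z im by (intro cos_monotone_0_pi_le) auto
    also have "cos (\<bar>Im z\<bar> / 2) = cos (Im z / 2)" by (simp add: abs_if)
    finally have "cos (\<theta> / 2) * (m * exp (Re z / 2)) \<le> cos (Im z / 2) * (k * exp (Re z / 2))"
      using k m c0 by (intro mult_mono) auto
    then show ?thesis by (simp add: Re_exp mult_ac)
  qed
  have "\<bar>Im (- (x + y))\<bar> \<le> \<theta>" "\<bar>Im (x - y)\<bar> \<le> \<theta>" "\<bar>Im (y - x)\<bar> \<le> \<theta>" "\<bar>Im (x + y)\<bar> \<le> \<theta>"
    using im by auto
  from ge[OF this(1) m(3)] ge[OF this(2) m(5)] ge[OF this(3) m(2)] ge[OF this(4) m(4)]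
  have "cos (\<theta> / 2) * (m * (exp (Re (- (x + y)) / 2) + exp (Re (x - y) / 2) + exp (Re (y - x) / 2) + exp (Re (x + y) / 2)))
     \<le> Re (?h x y)"
    unfolding half_form_def by (simp add: distrib_left)
  moreover have "exp (Re (- (x + y)) / 2) + exp (Re (x - y) / 2) + exp (Re (y - x) / 2) + exp (Re (x + y) / 2)
     = (exp (Re x / 2) + exp (- Re x / 2)) * (exp (Re y / 2) + exp (- Re y / 2))"
    by (simp add: distrib_left distrib_right diff_divide_distrib add_divide_distrib flip: exp_add)
  moreover have "exp (\<bar>Re x\<bar> / 2) * exp (\<bar>Re y\<bar> / 2) \<le> (exp (Re x / 2) + exp (- Re x / 2)) * (exp (Re y / 2) + exp (- Re y / 2))"
    by (intro mult_mono) (auto simp: abs_if)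
  then have "cos (\<theta> / 2) * (m * (exp (\<bar>Re x\<bar> / 2) * exp (\<bar>Re y\<bar> / 2))) \<le>
      cos (\<theta> / 2) * (m * ((exp (Re x / 2) + exp (- Re x / 2)) * (exp (Re y / 2) + exp (- Re y / 2))))"
    using m im by (intro mult_left_mono) (auto intro!: cos_ge_zero)
  ultimately show ?thesis by (simp add: mult.assoc)
qed

lemma Re_half_form_pos:
  assumes c: "c1 > 0" "c2 > 0" "c3 > 0" "c4 > 0" and im: "\<bar>Im x\<bar> + \<bar>Im y\<bar> < pi"
  shows "Re (half_form c1 c2 c3 c4 x y) > 0"
proof -
  let ?m = "min (min c1 c2) (min c3 c4)"
  have "0 < cos ((\<bar>Im x\<bar> + \<bar>Im y\<bar>) / 2)" using im by (intro cos_gt_zero_pi) auto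
  then have "0 < cos ((\<bar>Im x\<bar> + \<bar>Im y\<bar>) / 2) * ?m * exp (\<bar>Re x\<bar> / 2) * exp (\<bar>Re y\<bar> / 2)"
    using c by simp
  also have "\<dots> \<le> Re (half_form c1 c2 c3 c4 x y)"
    by (rule Re_half_form[OF c]) (use c im in auto)
  finally show ?thesis .
qed

lemma kummer_kernel_bound:
  assumes c: "c1 > 0" "c2 > 0" "c3 > 0" "c4 > 0" and theta: "0 \<le> \<theta>" "\<theta> < pi"
  obtains C where "C \<ge> 0" "\<And>x y. \<bar>Im x\<bar> + \<bar>Im y\<bar> \<le> \<theta> \<Longrightarrow>
     cmod (kummer_kernel c1 c2 c3 c4 x y) \<le> C * exp (- \<bar>Re x\<bar> * (1/2)) * exp (- \<bar>Re y\<bar> * (1/2))"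
proof
  let ?h = "half_form c1 c2 c3 c4"
  let ?m = "min (min c1 c2) (min c3 c4)"
  define k where "k = cos (\<theta> / 2) * ?m"
  have "0 < cos (\<theta> / 2)" using theta by (intro cos_gt_zero_pi) auto
  then have k: "k > 0" using c by (simp add: k_def)
  show "1 / k \<ge> 0" using k by simp
  fix x y :: complex assume im: "\<bar>Im x\<bar> + \<bar>Im y\<bar> \<le> \<theta>"
  define E where "E = k * exp (\<bar>Re x\<bar> / 2) * exp (\<bar>Re y\<bar> / 2)"
  have E: "E > 0" using k by (simp add: E_def)
  have 1: "E \<le> cmod (?h x y)"
    unfolding E_def k_def by (rule order_trans[OF Re_half_form[OF c] complex_Re_le_cmod]) (use c im theta in auto)
  have 2: "E \<le> cmod (?h (- x) (- y))"
  proof -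
    have "E = cos (\<theta> / 2) * ?m * exp (\<bar>Re (- x)\<bar> / 2) * exp (\<bar>Re (- y)\<bar> / 2)"
      by (simp only: E_def k_def uminus_complex.sel abs_minus_cancel)
    also have "\<dots> \<le> cmod (?h (- x) (- y))"
      by (rule order_trans[OF Re_half_form[OF c] complex_Re_le_cmod]) (use c im theta in auto)
    finally show ?thesis .
  qed
  have "sqrt E * sqrt E \<le> sqrt (cmod (?h x y)) * sqrt (cmod (?h (- x) (- y)))"
    using 1 2 E by (intro mult_mono) auto
  then have "E \<le> cmod (csqrt (?h x y) * csqrt (?h (- x) (- y)))"
    using E by (simp add: norm_mult cmod_csqrt)
  then have "cmod (kummer_kernel c1 c2 c3 c4 x y) \<le> 1 / E"
    unfolding kummer_kernel_def norm_divide using E by (simp add: frac_le)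
  also have "1 / E = 1 / k * exp (- \<bar>Re x\<bar> * (1/2)) * exp (- \<bar>Re y\<bar> * (1/2))"
    by (simp add: E_def exp_minus field_simps)
  finally show "cmod (kummer_kernel c1 c2 c3 c4 x y) \<le> 1 / k * exp (- \<bar>Re x\<bar> * (1/2)) * exp (- \<bar>Re y\<bar> * (1/2))" .
qed

lemma kummer_kernel_holomorphic:
  assumes c: "c1 > 0" "c2 > 0" "c3 > 0" "c4 > 0"
  shows "(\<lambda>y. kummer_kernel c1 c2 c3 c4 x y) holomorphic_on {y. \<bar>Im y\<bar> < pi - \<bar>Im x\<bar>}"
    and "(\<lambda>x. kummer_kernel c1 c2 c3 c4 x y) holomorphic_on {x. \<bar>Im x\<bar> < pi - \<bar>Im y\<bar>}"
proof -
  let ?h = "half_form c1 c2 c3 c4"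
  have nn: "?h x y \<notin> \<real>\<^sub>\<le>\<^sub>0 \<and> ?h (- x) (- y) \<notin> \<real>\<^sub>\<le>\<^sub>0
     \<and> ?h x y \<noteq> 0 \<and> ?h (- x) (- y) \<noteq> 0"
    if "\<bar>Im x\<bar> + \<bar>Im y\<bar> < pi" for x y
  proof -
    have "Re (?h x y) > 0" "Re (?h (- x) (- y)) > 0"
      using that by (auto intro!: Re_half_form_pos c)
    then show ?thesis by (auto simp: complex_nonpos_Reals_iff)
  qed
  have hol: "(\<lambda>y. ?h x y) holomorphic_on A" "(\<lambda>y. ?h (- x) (- y)) holomorphic_on A"
    "(\<lambda>x. ?h x y) holomorphic_on A" "(\<lambda>x. ?h (- x) (- y)) holomorphic_on A" for A x y
    unfolding half_form_def by (auto intro!: holomorphic_intros)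
  show "(\<lambda>y. kummer_kernel c1 c2 c3 c4 x y) holomorphic_on {y. \<bar>Im y\<bar> < pi - \<bar>Im x\<bar>}"
    unfolding kummer_kernel_def using nn by (intro holomorphic_intros hol) auto
  show "(\<lambda>x. kummer_kernel c1 c2 c3 c4 x y) holomorphic_on {x. \<bar>Im x\<bar> < pi - \<bar>Im y\<bar>}"
    unfolding kummer_kernel_def using nn by (intro holomorphic_intros hol) auto
qed

lemma integrable_exp_minus_abs_shift:
  "integrable lborel (\<lambda>u::real. exp (- \<bar>u + a\<bar> * (1/2)))"
  using lborel_integrable_real_affine[OF integrable_exp_minus_abs[of "1/2"], of 1 a] by (simp add: add.commute)

lemma kummer_kernel_integrable:
  assumes c: "c1 > 0" "c2 > 0" "c3 > 0" "c4 > 0" and im: "\<bar>Im l\<bar> + \<bar>Im m\<bar> < pi"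
  shows "integrable lborel2 (\<lambda>(u, v). kummer_kernel c1 c2 c3 c4 (of_real u + l) (of_real v + m))"
    and "integrable lborel (\<lambda>v. kummer_kernel c1 c2 c3 c4 (of_real u + l) (of_real v + m))"
    and "integrable lborel (\<lambda>u. kummer_kernel c1 c2 c3 c4 (of_real u + l) (of_real v + m))"
proof -
  let ?k = "kummer_kernel c1 c2 c3 c4"
  obtain C where C: "C \<ge> 0" and bd: "\<And>x y. \<bar>Im x\<bar> + \<bar>Im y\<bar> \<le> \<bar>Im l\<bar> + \<bar>Im m\<bar> \<Longrightarrow>
     cmod (?k x y) \<le> C * exp (- \<bar>Re x\<bar> * (1/2)) * exp (- \<bar>Re y\<bar> * (1/2))"
    using kummer_kernel_bound[OF c _ im] by auto
  have b: "cmod (?k (of_real u + l) (of_real v + m))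
     \<le> C * exp (- \<bar>u + Re l\<bar> * (1/2)) * exp (- \<bar>v + Re m\<bar> * (1/2))" for u v
    using bd[of "of_real u + l" "of_real v + m"] by simp
  have b': "cmod (?k (of_real u + l) (of_real v + m))
     \<le> C * exp (- \<bar>v + Re m\<bar> * (1/2)) * exp (- \<bar>u + Re l\<bar> * (1/2))" for u v
    using b[of u v] by (simp only: mult.commute mult.left_commute mult.assoc)
  note I = integrable_mult_right[OF integrable_exp_minus_abs_shift]
  show "integrable lborel2 (\<lambda>(u, v). ?k (of_real u + l) (of_real v + m))"
  proof (rule integrable_product_bound[OF _ I integrable_exp_minus_abs_shift])
    show "cmod (case (u, v) of (u, v) \<Rightarrow> ?k (of_real u + l) (of_real v + m))
       \<le> C * exp (- \<bar>u + Re l\<bar> * (1/2)) * exp (- \<bar>v + Re m\<bar> * (1/2))" for u v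
      using b[of u v] by simp
  qed (use C in auto)
  show "integrable lborel (\<lambda>v. ?k (of_real u + l) (of_real v + m))"
  proof (rule Bochner_Integration.integrable_bound[OF I])
    show "AE v in lborel. norm (?k (of_real u + l) (of_real v + m))
       \<le> norm (C * exp (- \<bar>u + Re l\<bar> * (1/2)) * exp (- \<bar>v + Re m\<bar> * (1/2)))"
      unfolding real_norm_def by (intro AE_I2 order_trans[OF b abs_ge_self])
  qed measurable
  show "integrable lborel (\<lambda>u. ?k (of_real u + l) (of_real v + m))"
  proof (rule Bochner_Integration.integrable_bound[OF I])
    show "AE u in lborel. norm (?k (of_real u + l) (of_real v + m))
       \<le> norm (C * exp (- \<bar>v + Re m\<bar> * (1/2)) * exp (- \<bar>u + Re l\<bar> * (1/2)))"
      unfolding real_norm_def by (intro AE_I2 order_trans[OF b' abs_ge_self])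
  qed measurable
qed

text \<open>
  One variable is shifted at a time; in between, the order of integration is exchanged.  The domination
  holds because \<open>\<bar>Im x\<bar> + \<bar>Im y\<bar>\<close> never exceeds its final value.
\<close>
lemma kummer_kernel_shift:
  assumes c: "c1 > 0" "c2 > 0" "c3 > 0" "c4 > 0" and im: "\<bar>Im l\<bar> + \<bar>Im m\<bar> < pi"
  shows "(\<integral>(u, v). kummer_kernel c1 c2 c3 c4 (of_real u + l) (of_real v + m) \<partial>lborel2)
    = (\<integral>(u, v). kummer_kernel c1 c2 c3 c4 (of_real u) (of_real v) \<partial>lborel2)"
proof -
  let ?k = "kummer_kernel c1 c2 c3 c4"
  obtain C where C: "C \<ge> 0" and bd: "\<And>x y. \<bar>Im x\<bar> + \<bar>Im y\<bar> \<le> \<bar>Im l\<bar> + \<bar>Im m\<bar> \<Longrightarrow>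
     cmod (?k x y) \<le> C * exp (- \<bar>Re x\<bar> * (1/2)) * exp (- \<bar>Re y\<bar> * (1/2))"
    using kummer_kernel_bound[OF c _ im] by auto
  have i0: "\<bar>Im l\<bar> + \<bar>Im 0\<bar> < pi" "\<bar>Im 0\<bar> + \<bar>Im 0\<bar> < pi" using im by auto
  note int = kummer_kernel_integrable[OF c im]
    and int' = kummer_kernel_integrable[OF c i0(1), simplified]
    and int0 = kummer_kernel_integrable[OF c i0(2), simplified]
  have 1: "(\<integral>v. ?k (of_real u + l) (of_real v + m) \<partial>lborel) = (\<integral>v. ?k (of_real u + l) (of_real v) \<partial>lborel)" for u
  proof (rule integral_strip_shift[where r = "pi - \<bar>Im l\<bar>" and \<delta> = "1/2" and C = "C * exp (- \<bar>u + Re l\<bar> * (1/2))"])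
    show "(\<lambda>y. ?k (of_real u + l) y) holomorphic_on {y. \<bar>Im y\<bar> < pi - \<bar>Im l\<bar>}"
      using kummer_kernel_holomorphic(1)[OF c, of "of_real u + l"] by simp
    show "cmod (?k (of_real u + l) w) \<le> C * exp (- \<bar>u + Re l\<bar> * (1/2)) * exp (- \<bar>Re w\<bar> * (1/2))" if "\<bar>Im w\<bar> \<le> \<bar>Im m\<bar>" for w
      using bd[of "of_real u + l" w] that by simp
  qed (use im int(2) int'(2) in auto)
  have 2: "(\<integral>u. ?k (of_real u + l) (of_real v) \<partial>lborel) = (\<integral>u. ?k (of_real u) (of_real v) \<partial>lborel)" for v
  proof (rule integral_strip_shift[where r = pi and \<delta> = "1/2" and C = "C * exp (- \<bar>v\<bar> * (1/2))"])
    show "(\<lambda>x. ?k x (of_real v)) holomorphic_on {x. \<bar>Im x\<bar> < pi}"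
      using kummer_kernel_holomorphic(2)[OF c, of "of_real v"] by simp
    show "cmod (?k w (of_real v)) \<le> C * exp (- \<bar>v\<bar> * (1/2)) * exp (- \<bar>Re w\<bar> * (1/2))" if "\<bar>Im w\<bar> \<le> \<bar>Im l\<bar>" for w
      using bd[of w "of_real v"] that by (simp add: mult_ac)
  qed (use im int0(3) int'(3) in auto)
  have "(\<integral>(u, v). ?k (of_real u + l) (of_real v + m) \<partial>lborel2) = (\<integral>u. \<integral>v. ?k (of_real u + l) (of_real v + m) \<partial>lborel \<partial>lborel)"
    by (rule lborel_pair.integral_fst[OF int(1), symmetric])
  also have "\<dots> = (\<integral>u. \<integral>v. ?k (of_real u + l) (of_real v) \<partial>lborel \<partial>lborel)" unfolding 1 ..
  also have "\<dots> = (\<integral>v. \<integral>u. ?k (of_real u + l) (of_real v) \<partial>lborel \<partial>lborel)"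
    by (rule lborel_pair.Fubini_integral[OF int'(1), symmetric])
  also have "\<dots> = (\<integral>v. \<integral>u. ?k (of_real u) (of_real v) \<partial>lborel \<partial>lborel)" unfolding 2 ..
  also have "\<dots> = (\<integral>(u, v). ?k (of_real u) (of_real v) \<partial>lborel2)"
    by (rule lborel_pair.integral_snd[OF int0(1)])
  finally show ?thesis .
qed

lemma kummer_kernel_integral_eq_borchardt_integral:
  assumes c: "c1 > 0" "c2 > 0" "c3 > 0" "c4 > 0"
  shows "(\<integral>(u, v). kummer_kernel c1 c2 c3 c4 (of_real u) (of_real v) \<partial>lborel2)
    = of_real (enn2real (borchardt_integral c1 c2 c3 c4))"
proof -
  define D where "D u v = (c2 + c4 * exp u + c1 * exp v + c3 * exp (u + v)) * (c2 + c4 * exp (- u) + c1 * exp (- v) + c3 * exp (- u - v))" for u v :: real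
  define B where "B u v = c2 * exp (- (u + v) / 2) + c4 * exp ((u - v) / 2) + c1 * exp ((v - u) / 2) + c3 * exp ((u + v) / 2)" for u v :: real
  have hf: "half_form c1 c2 c3 c4 (of_real u) (of_real v) = of_real (B u v)" for u v
    by (simp add: half_form_def B_def exp_of_real[symmetric])
  have Bpos: "B u v > 0" for u v using c by (simp add: B_def add_pos_pos)
  have BD: "B u v * B (- u) (- v) = D u v" for u v
  proof -
    have "B u v * exp ((u + v) / 2) = c2 + c4 * exp u + c1 * exp v + c3 * exp (u + v)"
      unfolding B_def by (simp add: distrib_right mult.assoc flip: exp_add) (simp add: field_simps)
    moreover have "B (- u) (- v) * exp (- (u + v) / 2) = c2 + c4 * exp (- u) + c1 * exp (- v) + c3 * exp (- u - v)"
      unfolding B_def by (simp add: distrib_right mult.assoc flip: exp_add) (simp add: field_simps)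
    moreover have "exp ((u + v) / 2) * exp (- (u + v) / 2) = 1"
      using exp_minus_inverse[of "(u + v) / 2"] by (simp only: minus_divide_left)
    ultimately show ?thesis unfolding D_def by algebra
  qed
  have ker: "kummer_kernel c1 c2 c3 c4 (of_real u) (of_real v) = of_real (1 / sqrt (D u v))" for u v
    unfolding kummer_kernel_def BD[symmetric] using Bpos[of u v] Bpos[of "- u" "- v"] hf[of u v] hf[of "- u" "- v"]
    by (simp add: real_sqrt_mult)
  have im0: "\<bar>Im 0\<bar> + \<bar>Im 0\<bar> < pi" by simp
  have "integrable lborel2 (\<lambda>p. complex_of_real (1 / sqrt (D (fst p) (snd p))))"
    using kummer_kernel_integrable(1)[OF c im0] by (simp only: add_0_right ker case_prod_beta')
  then have int: "integrable lborel2 (\<lambda>p. 1 / sqrt (D (fst p) (snd p)))"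
    by (simp only: complex_of_real_integrable_eq)
  have D0: "D u v \<ge> 0" for u v using BD[of u v] Bpos[of u v] Bpos[of "- u" "- v"] by (metis less_imp_le mult_nonneg_nonneg)
  have "borchardt_integral c1 c2 c3 c4 = (\<integral>\<^sup>+v. \<integral>\<^sup>+u. ennreal (1 / sqrt (D u v)) \<partial>lborel \<partial>lborel)"
    by (simp add: borchardt_integral_def D_def)
  also have "\<dots> = (\<integral>\<^sup>+p. ennreal (1 / sqrt (D (fst p) (snd p))) \<partial>lborel2)"
    unfolding D_def by (subst lborel_pair.nn_integral_snd[symmetric]) simp_all
  also have "\<dots> = ennreal (\<integral>p. 1 / sqrt (D (fst p) (snd p)) \<partial>lborel2)"
    by (rule nn_integral_eq_integral[OF int]) (simp add: D0)
  finally have "enn2real (borchardt_integral c1 c2 c3 c4) = (\<integral>p. 1 / sqrt (D (fst p) (snd p)) \<partial>lborel2)"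
    by (simp add: D0 integral_nonneg_AE)
  then show ?thesis
    unfolding ker case_prod_beta' by (simp only: integral_complex_of_real)
qed

section \<open>The Euler integral as a double integral over the plane\<close>

definition logistic :: "real \<Rightarrow> real" where "logistic u = 1 / (1 + exp (- u))"

text \<open>
  The square root of \<open>s (1 - s)\<close> at \<open>s = logistic u\<close>; its square is the derivative of \<open>logistic\<close>.
\<close>
definition sech_half :: "real \<Rightarrow> real" where "sech_half u = 1 / (exp (u / 2) + exp (- u / 2))"

lemma sech_half_pos: "sech_half u > 0"
  by (simp add: sech_half_def add_pos_pos)

lemma logistic_sech_half:
  "logistic u = sech_half u * exp (u / 2)" "1 - logistic u = sech_half u * exp (- u / 2)"
  "logistic u * (1 - logistic u) = (sech_half u)\<^sup>2"
proof -
  have 1: "exp (u / 2) + exp (- u / 2) = exp (u / 2) * (1 + exp (- u))"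
    by (simp add: distrib_left flip: exp_add)
  have p: "1 + exp (- u) > 0" "exp (u / 2) + exp (- u / 2) > 0" by (simp_all add: add_pos_pos)
  show 2: "logistic u = sech_half u * exp (u / 2)"
    using p unfolding logistic_def sech_half_def 1 by simp
  have "sech_half u * (exp (u / 2) + exp (- u / 2)) = 1"
    using p unfolding sech_half_def by (metis less_irrefl nonzero_eq_divide_eq)
  then show 3: "1 - logistic u = sech_half u * exp (- u / 2)"
    unfolding 2 by (simp add: distrib_left)
  have "exp (u / 2) * exp (- u / 2) = 1" by (simp flip: exp_add)
  then show "logistic u * (1 - logistic u) = (sech_half u)\<^sup>2"
    unfolding 3 unfolding 2 power2_eq_square by algebra
qed

lemma logistic_measurable[measurable]: "logistic \<in> borel_measurable borel"
  and sech_half_measurable[measurable]: "sech_half \<in> borel_measurable borel"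
  unfolding logistic_def[abs_def] sech_half_def[abs_def] by measurable

lemma distr_logistic:
  "distr (density lborel (\<lambda>u. ennreal ((sech_half u)\<^sup>2))) borel logistic = density lborel (\<lambda>x. ennreal (indicator {0<..<1} x))"
    (is "?L = ?R")
proof (rule measure_eqI)
  fix A assume "A \<in> sets ?L"
  then have A[measurable]: "A \<in> sets borel" by simp
  have "emeasure ?L A = (\<integral>\<^sup>+u\<in>UNIV. indicator A (logistic u) * ennreal ((sech_half u)\<^sup>2) \<partial>lborel)"
    using measurable_sets_borel[OF logistic_measurable A]
    by (subst emeasure_distr, simp, simp, subst emeasure_density)
       (auto simp: indicator_def intro!: nn_integral_cong)
  also have "\<dots> = (\<integral>\<^sup>+x\<in>{0<..<1}. indicator A x \<partial>lborel)"
  proof (rule nn_integral_change_of_variables[symmetric])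
    fix u :: real
    have p: "1 + exp (- u) > 0" by (simp add: add_pos_pos)
    have "(logistic has_real_derivative exp (- u) / (1 + exp (- u))\<^sup>2) (at u)"
      unfolding logistic_def[abs_def] using p
      by (auto intro!: derivative_eq_intros simp: power2_eq_square)
    moreover have "exp (- u) / (1 + exp (- u))\<^sup>2 = logistic u * (1 - logistic u)"
      using p unfolding logistic_def by (simp add: field_simps power2_eq_square)
    ultimately show "(logistic has_real_derivative (sech_half u)\<^sup>2) (at u)"
      unfolding logistic_sech_half(3)[symmetric] by simp
    show "inj logistic"
    proof (rule injI)
      fix x y assume "logistic x = logistic y"
      moreover have "1 + exp (- x) > 0" "1 + exp (- y) > 0" by (simp_all add: add_pos_pos)
      ultimately show "x = y" by (simp add: logistic_def)
    qed
    show "range logistic = {0<..<1}"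
    proof (intro equalityI subsetI)
      fix x :: real assume x: "x \<in> {0<..<1}"
      have "x = logistic (- ln (1 / x - 1))"
        using x by (simp add: logistic_def)
      then show "x \<in> range logistic" by blast
    qed (auto simp: logistic_def add_pos_pos)
  qed simp_all
  also have "\<dots> = emeasure ?R A"
    by (subst emeasure_density) (auto simp: indicator_def intro!: nn_integral_cong)
  finally show "emeasure ?L A = emeasure ?R A" .
qed simp

text \<open>
  The equality is one of product measures, obtained from the change of variables in each coordinate, and
  therefore one of Bochner integrals.
\<close>
lemma integral_unit_square_logistic:
  fixes f :: "real \<times> real \<Rightarrow> complex"
  assumes [measurable]: "f \<in> borel_measurable borel"
  shows "(\<integral>p. indicator ({0<..<1} \<times> {0<..<1}) p *\<^sub>R f p \<partial>lborel2)
    = (\<integral>(u, v). ((sech_half u)\<^sup>2 * (sech_half v)\<^sup>2) *\<^sub>R f (logistic u, logistic v) \<partial>lborel2)"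
proof -
  define N where "N = density lborel (\<lambda>x::real. ennreal (indicator {0<..<1} x))"
  define M where "M = density lborel (\<lambda>u. ennreal ((sech_half u)\<^sup>2))"
  have MN: "distr M borel logistic = N" unfolding M_def N_def by (rule distr_logistic)
  have finN: "finite_measure N"
    by (rule finite_measureI) (simp add: N_def emeasure_density ennreal_indicator)
  have finM: "finite_measure M"
  proof (rule finite_measureI)
    have "emeasure M (space M) = emeasure (distr M borel logistic) UNIV"
      by (subst emeasure_distr) (simp_all add: M_def)
    also have "\<dots> \<noteq> \<infinity>" unfolding MN using finite_measure.emeasure_finite[OF finN] by simp
    finally show "emeasure M (space M) \<noteq> \<infinity>" .
  qed
  interpret N: finite_measure N by (rule finN)
  interpret M: finite_measure M by (rule finM)
  have b2: "f \<in> borel_measurable (borel \<Otimes>\<^sub>M borel)" by (simp add: borel_prod)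
  have 1: "N \<Otimes>\<^sub>M N = density lborel2 (\<lambda>p. ennreal (indicator ({0<..<1} \<times> {0<..<1}) p))"
    using N.sigma_finite_measure_axioms unfolding N_def
    by (subst pair_measure_density)
       (auto simp: lborel.sigma_finite_measure_axioms case_prod_beta indicator_times ennreal_mult' intro!: density_cong)
  have "N \<Otimes>\<^sub>M N = distr M borel logistic \<Otimes>\<^sub>M distr M borel logistic" by (simp add: MN)
  also have "\<dots> = distr (M \<Otimes>\<^sub>M M) (borel \<Otimes>\<^sub>M borel) (\<lambda>(u, v). (logistic u, logistic v))"
    by (rule pair_measure_distr) (simp_all add: M_def[symmetric] MN N.sigma_finite_measure_axioms, simp_all add: M_def)
  finally have 2: "N \<Otimes>\<^sub>M N = distr (M \<Otimes>\<^sub>M M) (borel \<Otimes>\<^sub>M borel) (\<lambda>(u, v). (logistic u, logistic v))" .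
  have 3: "M \<Otimes>\<^sub>M M = density lborel2 (\<lambda>p. ennreal ((sech_half (fst p))\<^sup>2 * (sech_half (snd p))\<^sup>2))"
    using M.sigma_finite_measure_axioms unfolding M_def
    by (subst pair_measure_density)
       (auto simp: lborel.sigma_finite_measure_axioms case_prod_beta ennreal_mult' intro!: density_cong)
  have "(\<integral>p. indicator ({0<..<1} \<times> {0<..<1}) p *\<^sub>R f p \<partial>lborel2) = (\<integral>p. f p \<partial>(N \<Otimes>\<^sub>M N))"
    unfolding 1 using b2 by (subst integral_density) (simp_all add: borel_Times)
  also have "\<dots> = (\<integral>p. f (logistic (fst p), logistic (snd p)) \<partial>(M \<Otimes>\<^sub>M M))"
    unfolding 2 by (subst integral_distr) (use b2 in \<open>simp_all add: M_def case_prod_beta\<close>)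
  also have "\<dots> = (\<integral>(u, v). ((sech_half u)\<^sup>2 * (sech_half v)\<^sup>2) *\<^sub>R f (logistic u, logistic v) \<partial>lborel2)"
    unfolding 3 by (subst integral_density) (simp_all add: case_prod_beta' borel_prod)
  finally show ?thesis .
qed

lemma Re_of_real_mult: "Re (of_real x * y) = x * Re y"
  by simp

lemma csqrt_exp_mult:
  assumes "Re z > 0" "\<bar>Im t\<bar> < pi / 2"
  shows "csqrt (exp t * z) = exp (t / 2) * csqrt z"
proof -
  have t: "- pi < Im t" "Im t \<le> pi" using assms(2) by auto
  have "\<bar>Arg z\<bar> < pi / 2" using assms Arg_Re_pos[of z] by blast
  moreover have "Arg (exp t) = Im t" using t by (simp add: Arg_exp)
  ultimately have "csqrt (exp t * z) = csqrt (exp t) * csqrt z"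
    using assms by (intro csqrt_mult) auto
  also have "csqrt (exp t) = exp (t / 2)"
    using t by (simp add: csqrt_exp_Ln)
  finally show ?thesis .
qed

lemma csqrt_of_real_mult:
  assumes "Re z > 0" "r > 0"
  shows "csqrt (of_real r * z) = of_real (sqrt r) * csqrt z"
proof -
  have "csqrt (exp (of_real (ln r)) * z) = exp (of_real (ln r) / 2) * csqrt z"
    by (rule csqrt_exp_mult) (use assms in auto)
  moreover have "exp (of_real (ln r)) = complex_of_real r" using assms by (simp add: exp_of_real)
  moreover have "exp (of_real (ln r) / 2) = complex_of_real (sqrt r)"
  proof -
    have "sqrt r = exp (ln r / 2)" by (rule real_sqrt_unique) (use assms in \<open>simp_all add: exp_half_squared\<close>)
    moreover have "exp (complex_of_real (ln r) / 2) = of_real (exp (ln r / 2))" by (simp add: exp_of_real[symmetric])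
    ultimately show ?thesis by simp
  qed
  ultimately show ?thesis by simp
qed

text \<open>
  The two linear factors of the Euler integral are instances of one statement: the second arises from the
  first by exchanging \<open>c\<^sub>1\<close> with \<open>c\<^sub>4\<close> and \<open>c\<^sub>2\<close> with \<open>c\<^sub>3\<close>.
\<close>
context
  fixes k1 k2 k3 k4 :: real and l m a b :: complex
  assumes k: "k1 > 0" "k2 > 0" "k3 > 0" "k4 > 0" and im: "\<bar>Im l\<bar> + \<bar>Im m\<bar> < pi"
    and rel: "of_real k4 * exp l + of_real k1 * exp m - of_real k2 = of_real k3 * exp l * exp m"
    and a: "a = 1 - of_real (k4 / k2) * exp l" and b: "b = 1 - of_real (k1 / k2) * exp m"
begin

text \<open>
  A linear factor is the combination of its values at the corners of the square with the weights
  \<open>(1 - s) (1 - t)\<close>, \<open>s (1 - t)\<close>, \<open>(1 - s) t\<close>, \<open>s t\<close>.  The relation assumed here puts the value at the corner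
  \<open>(1, 1)\<close> into the form \<open>(k\<^sub>3 / k\<^sub>2) exp (l + m)\<close>.
\<close>
lemma lin_factor_weights:
  "lin_factor a b (s, t) = exp ((l + m) / 2) * (of_real (1 / k2) *
     (of_real (k2 * ((1 - s) * (1 - t))) * exp (- (l + m) / 2) + of_real (k4 * (s * (1 - t))) * exp ((l - m) / 2)
      + of_real (k1 * ((1 - s) * t)) * exp ((m - l) / 2) + of_real (k3 * (s * t)) * exp ((l + m) / 2)))"
proof -
  have e: "exp ((l + m) / 2) * exp (- (l + m) / 2) = 1" "exp ((l + m) / 2) * exp ((l - m) / 2) = exp l"
    "exp ((l + m) / 2) * exp ((m - l) / 2) = exp m" "exp ((l + m) / 2) * exp ((l + m) / 2) = exp l * exp m"
    by (simp_all add: add_divide_distrib diff_divide_distrib flip: exp_add)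
  have k2: "of_real k2 \<noteq> (0::complex)" using k by simp
  have "of_real k2 * lin_factor a b (s, t) = of_real (k2 * ((1 - s) * (1 - t))) + of_real (k4 * (s * (1 - t))) * exp l
      + of_real (k1 * ((1 - s) * t)) * exp m + of_real (k3 * (s * t)) * (exp l * exp m)"
  proof -
    have "of_real k2 * a = of_real k2 - of_real k4 * exp l" "of_real k2 * b = of_real k2 - of_real k1 * exp m"
      using k2 by (simp_all add: a b field_simps)
    then have "of_real k2 * lin_factor a b (s, t) = of_real k2 - (of_real k2 - of_real k4 * exp l) * of_real s - (of_real k2 - of_real k1 * exp m) * of_real t"
      by (simp add: lin_factor_def right_diff_distrib flip: mult.assoc)
    also have "\<dots> = of_real (k2 * ((1 - s) * (1 - t))) + of_real (k4 * (s * (1 - t))) * exp l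
      + of_real (k1 * ((1 - s) * t)) * exp m + (of_real k4 * exp l + of_real k1 * exp m - of_real k2) * of_real s * of_real t"
      by (simp add: algebra_simps)
    finally show ?thesis unfolding rel by (simp add: algebra_simps)
  qed
  then have "lin_factor a b (s, t) = of_real (1 / k2) * (of_real (k2 * ((1 - s) * (1 - t))) + of_real (k4 * (s * (1 - t))) * exp l
      + of_real (k1 * ((1 - s) * t)) * exp m + of_real (k3 * (s * t)) * (exp l * exp m))"
    using k2 by (simp add: field_simps)
  moreover have "E * (K * (x1 * A + x2 * B + x3 * C + x4 * E)) = K * (x1 * (E * A) + x2 * (E * B) + x3 * (E * C) + x4 * (E * E))"
    for E K A B C x1 x2 x3 x4 :: complex by (simp add: algebra_simps)
  ultimately show ?thesis by (simp only: e mult_1_right)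
qed

lemma lin_factor_nonzero:
  assumes p: "p \<in> unit_square"
  shows "lin_factor a b p \<noteq> 0"
proof -
  obtain s t where st: "p = (s, t)" "0 \<le> s" "s \<le> 1" "0 \<le> t" "t \<le> 1" using p by auto
  have pos: "Re (exp (z / 2)) > 0" if "\<bar>Im z\<bar> < pi" for z
    unfolding Re_exp using that by (intro mult_pos_pos cos_gt_zero_pi) auto
  have e: "Re (exp (- (l + m) / 2)) > 0" "Re (exp ((l - m) / 2)) > 0" "Re (exp ((m - l) / 2)) > 0" "Re (exp ((l + m) / 2)) > 0"
    using im by (auto intro!: pos)
  define w1 w2 w3 w4 where w: "w1 = k2 * ((1 - s) * (1 - t))" "w2 = k4 * (s * (1 - t))" "w3 = k1 * ((1 - s) * t)" "w4 = k3 * (s * t)"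
  have w0: "w1 \<ge> 0" "w2 \<ge> 0" "w3 \<ge> 0" "w4 \<ge> 0" using k st by (auto simp: w)
  have "w1 > 0 \<or> w2 > 0 \<or> w3 > 0 \<or> w4 > 0"
    using k st by (auto simp: w zero_less_mult_iff)
  then have "Re (of_real w1 * exp (- (l + m) / 2) + of_real w2 * exp ((l - m) / 2)
      + of_real w3 * exp ((m - l) / 2) + of_real w4 * exp ((l + m) / 2)) > 0"
  proof -
    have "0 \<le> w1 * Re (exp (- (l + m) / 2))" "0 \<le> w2 * Re (exp ((l - m) / 2))"
      "0 \<le> w3 * Re (exp ((m - l) / 2))" "0 \<le> w4 * Re (exp ((l + m) / 2))"
      using w0 e by (intro mult_nonneg_nonneg less_imp_le[OF e(1)] less_imp_le[OF e(2)] less_imp_le[OF e(3)] less_imp_le[OF e(4)]; simp)+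
    moreover have "0 < w1 * Re (exp (- (l + m) / 2)) \<or> 0 < w2 * Re (exp ((l - m) / 2))
      \<or> 0 < w3 * Re (exp ((m - l) / 2)) \<or> 0 < w4 * Re (exp ((l + m) / 2))"
      using \<open>w1 > 0 \<or> w2 > 0 \<or> w3 > 0 \<or> w4 > 0\<close> e by (metis mult_pos_pos)
    ultimately show ?thesis
      unfolding plus_complex.sel Re_of_real_mult by linarith
  qed
  then have "of_real w1 * exp (- (l + m) / 2) + of_real w2 * exp ((l - m) / 2)
      + of_real w3 * exp ((m - l) / 2) + of_real w4 * exp ((l + m) / 2) \<noteq> 0"
    by (metis less_irrefl zero_complex.sel(1))
  then show ?thesis
    unfolding st lin_factor_weights w[symmetric] mult_eq_0_iff using k by simp
qed

text \<open>
  The principal square root is multiplicative here since \<open>\<bar>Im ((l + m) / 2)\<bar> < \<pi> / 2\<close> and \<open>half_form\<close> has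
  positive real part.
\<close>
lemma csqrt_lin_factor:
  "csqrt (lin_factor a b (logistic u, logistic v))
    = exp ((l + m) / 4) * (of_real (sqrt (sech_half u * sech_half v / k2)) * csqrt (half_form k1 k2 k3 k4 (of_real u + l) (of_real v + m)))"
proof -
  let ?r = "sech_half u * sech_half v"
  let ?h = "half_form k1 k2 k3 k4 (of_real u + l) (of_real v + m)"
  have h: "Re ?h > 0" using im by (intro Re_half_form_pos k) auto
  have r: "?r / k2 > 0" using k sech_half_pos by simp
  have w: "(1 - logistic u) * (1 - logistic v) = ?r * exp (- (u + v) / 2)" "logistic u * (1 - logistic v) = ?r * exp ((u - v) / 2)"
    "(1 - logistic u) * logistic v = ?r * exp ((v - u) / 2)" "logistic u * logistic v = ?r * exp ((u + v) / 2)"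
    unfolding logistic_sech_half(2) unfolding logistic_sech_half(1)
    by (simp_all add: add_divide_distrib diff_divide_distrib mult_ac flip: exp_add)
  have eo: "complex_of_real (exp (y / 2)) = exp (of_real y / 2)" for y by (simp add: exp_of_real[symmetric])
  have hh: "?h = of_real k2 * (of_real (exp (- (u + v) / 2)) * exp (- (l + m) / 2)) + of_real k4 * (of_real (exp ((u - v) / 2)) * exp ((l - m) / 2))
     + of_real k1 * (of_real (exp ((v - u) / 2)) * exp ((m - l) / 2)) + of_real k3 * (of_real (exp ((u + v) / 2)) * exp ((l + m) / 2))"
    unfolding half_form_def eo
    by (simp add: add_divide_distrib diff_divide_distrib algebra_simps flip: exp_add)
  have "lin_factor a b (logistic u, logistic v) = exp ((l + m) / 2) * (of_real (?r / k2) * ?h)"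
    unfolding lin_factor_weights w hh by (simp add: algebra_simps)
  moreover have "csqrt (exp ((l + m) / 2) * (of_real (?r / k2) * ?h)) = exp ((l + m) / 2 / 2) * csqrt (of_real (?r / k2) * ?h)"
  proof (rule csqrt_exp_mult)
    show "0 < Re (of_real (?r / k2) * ?h)" unfolding Re_of_real_mult by (rule mult_pos_pos[OF r h])
  qed (use im in auto)
  moreover have "csqrt (of_real (?r / k2) * ?h) = of_real (sqrt (?r / k2)) * csqrt ?h"
    by (rule csqrt_of_real_mult[OF h r])
  ultimately show ?thesis by simp
qed

end

lemma FS_euler_eq_borchardt_integral:
  fixes c1 c2 c3 c4 :: real and l m :: complex and z :: "complex^2^2"
  assumes c: "c1 > 0" "c2 > 0" "c3 > 0" "c4 > 0" and im: "\<bar>Im l\<bar> + \<bar>Im m\<bar> < pi"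
    and rel: "of_real c4 * exp l + of_real c1 * exp m - of_real c2 = of_real c3 * exp l * exp m"
      "of_real c1 * exp l + of_real c4 * exp m - of_real c3 = of_real c2 * exp l * exp m"
    and z: "z$1$1 = 1 - of_real (c4 / c2) * exp l" "z$1$2 = 1 - of_real (c1 / c3) * exp l"
      "z$2$1 = 1 - of_real (c1 / c2) * exp m" "z$2$2 = 1 - of_real (c4 / c3) * exp m"
  shows "FS_euler z = of_real (sqrt (c2 * c3) / pi\<^sup>2) * exp (- (l + m) / 2) * of_real (enn2real (borchardt_integral c1 c2 c3 c4))"
    and "p \<in> unit_square \<Longrightarrow> lin_factor (z$1$1) (z$2$1) p \<noteq> 0 \<and> lin_factor (z$1$2) (z$2$2) p \<noteq> 0"
proof -
  note nz1 = lin_factor_nonzero[OF c im rel(1) z(1,3)]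
  note nz2 = lin_factor_nonzero[OF c(4,3,2,1) im rel(2) z(2,4)]
  show "p \<in> unit_square \<Longrightarrow> lin_factor (z$1$1) (z$2$1) p \<noteq> 0 \<and> lin_factor (z$1$2) (z$2$2) p \<noteq> 0"
    using nz1 nz2 by blast
  define f where "f p = 1 / (of_real (sqrt (fst p * (1 - fst p) * snd p * (1 - snd p)))
      * csqrt (lin_factor (z$1$1) (z$2$1) p) * csqrt (lin_factor (z$1$2) (z$2$2) p))" for p :: "real \<times> real"
  have [measurable]: "f \<in> borel_measurable borel"
    unfolding f_def lin_factor_def borel_prod[symmetric] by measurable
  \<comment> \<open>On the boundary of the square the integrand is \<open>1 / 0 = 0\<close>, so the open square may be used.\<close>
  have "indicator unit_square p *\<^sub>R (case p of (s1, s2) \<Rightarrow> 1 / (of_real (sqrt (s1 * (1 - s1) * s2 * (1 - s2)))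
      * lin_sqrt (z$1$1) (z$2$1) (s1, s2) * lin_sqrt (z$1$2) (z$2$2) (s1, s2)))
     = indicator ({0<..<1} \<times> {0<..<1}) p *\<^sub>R f p" for p :: "real \<times> real"
  proof (cases "p \<in> unit_square")
    case True
    then obtain s t where p: "p = (s, t)" "0 \<le> s" "s \<le> 1" "0 \<le> t" "t \<le> 1" by auto
    have "lin_sqrt (z$1$1) (z$2$1) p = csqrt (lin_factor (z$1$1) (z$2$1) p)"
      "lin_sqrt (z$1$2) (z$2$2) p = csqrt (lin_factor (z$1$2) (z$2$2) p)"
      using nz1 nz2 True by (auto intro!: lin_sqrt_eq_csqrt)
    then show ?thesis using p by (auto simp: f_def indicator_def)
  qed (auto simp: indicator_def)
  then have "FS_euler z = 1 / of_real (pi ^ 2) * (\<integral>p. indicator ({0<..<1} \<times> {0<..<1}) p *\<^sub>R f p \<partial>lborel2)"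
    unfolding FS_euler_def set_lebesgue_integral_def lborel_prod by simp
  also have "(\<integral>p. indicator ({0<..<1} \<times> {0<..<1}) p *\<^sub>R f p \<partial>lborel2)
    = (\<integral>(u, v). ((sech_half u)\<^sup>2 * (sech_half v)\<^sup>2) *\<^sub>R f (logistic u, logistic v) \<partial>lborel2)"
    by (rule integral_unit_square_logistic) measurable
  also have "\<dots> = (\<integral>p. (of_real (sqrt (c2 * c3)) * exp (- (l + m) / 2)) * (case p of (u, v) \<Rightarrow> kummer_kernel c1 c2 c3 c4 (of_real u + l) (of_real v + m)) \<partial>lborel2)"
  proof (rule Bochner_Integration.integral_cong[OF refl], clarify)
    fix u v :: real
    let ?r = "sech_half u * sech_half v"
    let ?h1 = "csqrt (half_form c1 c2 c3 c4 (of_real u + l) (of_real v + m))"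
    let ?h2 = "csqrt (half_form c4 c3 c2 c1 (of_real u + l) (of_real v + m))"
    have r: "?r > 0" using sech_half_pos by simp
    have swap: "half_form c4 c3 c2 c1 x y = half_form c1 c2 c3 c4 (- x) (- y)" for x y
      by (simp add: half_form_def add_ac)
    have w: "sqrt (logistic u * (1 - logistic u) * logistic v * (1 - logistic v)) = ?r"
    proof -
      have "logistic u * (1 - logistic u) * logistic v * (1 - logistic v) = ?r\<^sup>2"
        using logistic_sech_half(3)[of u] logistic_sech_half(3)[of v] by (simp add: mult.assoc power_mult_distrib)
      then show ?thesis using r by simp
    qed
    have "sqrt (x / c2) * sqrt (x / c3) = x / sqrt (c2 * c3)" if "x > 0" for x
      using that c by (simp add: real_sqrt_divide real_sqrt_mult)
    note s = this[OF r]
    have E: "exp ((l + m) / 4) * exp ((l + m) / 4) = exp ((l + m) / 2)" "exp (- (l + m) / 2) = 1 / exp ((l + m) / 2)"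
      using exp_minus[of "(l + m) / 2"] by (simp flip: exp_add, simp only: minus_divide_left inverse_eq_divide)
    have f: "f (logistic u, logistic v) = 1 / (of_real ?r * (of_real (sqrt (?r / c2) * sqrt (?r / c3)) * (exp ((l + m) / 4) * exp ((l + m) / 4)) * (?h1 * ?h2)))"
      unfolding f_def fst_conv snd_conv w csqrt_lin_factor[OF c im rel(1) z(1,3)] csqrt_lin_factor[OF c(4,3,2,1) im rel(2) z(2,4)]
      by (simp add: mult_ac)
    have "((sech_half u)\<^sup>2 * (sech_half v)\<^sup>2) *\<^sub>R f (logistic u, logistic v)
      = of_real (?r * ?r) * f (logistic u, logistic v)"
      by (simp add: scaleR_conv_of_real power2_eq_square mult_ac)
    also have "\<dots> = (of_real (sqrt (c2 * c3)) * exp (- (l + m) / 2)) * (1 / (?h1 * ?h2))"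
      unfolding f s E using sech_half_pos[of u] sech_half_pos[of v] c by (simp add: field_simps)
    finally show "((sech_half u)\<^sup>2 * (sech_half v)\<^sup>2) *\<^sub>R f (logistic u, logistic v) =
       (of_real (sqrt (c2 * c3)) * exp (- (l + m) / 2)) * kummer_kernel c1 c2 c3 c4 (of_real u + l) (of_real v + m)"
      unfolding kummer_kernel_def swap .
  qed
  also have "\<dots> = (of_real (sqrt (c2 * c3)) * exp (- (l + m) / 2)) * of_real (enn2real (borchardt_integral c1 c2 c3 c4))"
    unfolding integral_mult_right_zero kummer_kernel_shift[OF c im] kummer_kernel_integral_eq_borchardt_integral[OF c] ..
  finally show "FS_euler z = of_real (sqrt (c2 * c3) / pi\<^sup>2) * exp (- (l + m) / 2) * of_real (enn2real (borchardt_integral c1 c2 c3 c4))"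
    by simp
qed

section \<open>The power series and the Euler integral\<close>

text \<open>
  The coefficient of \<open>a ^ m * b ^ n\<close> in the expansion of \<open>1 / sqrt (1 - a - b)\<close>.
\<close>
definition inv_sqrt_coeff :: "nat \<Rightarrow> nat \<Rightarrow> real" where
  "inv_sqrt_coeff m n = pochhammer (1/2) (m + n) / (fact m * fact n)"

lemma inv_sqrt_coeff_nonneg: "inv_sqrt_coeff m n \<ge> 0"
  by (simp add: inv_sqrt_coeff_def pochhammer_nonneg)

lemma gbinomial_minus_half:
  "((-1/2) gchoose n) * (- x) ^ n = pochhammer (1/2) n / fact n * (x :: 'a :: field_char_0) ^ n"
proof -
  have 1: "(- 1) ^ n * (- x) ^ n = x ^ n" by (simp flip: power_mult_distrib)
  have 2: "- (- 1 / 2) = (1 / 2 :: 'a)" by simp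
  have "((-1/2) gchoose n) * (- x) ^ n = pochhammer (1/2) n / fact n * ((- 1) ^ n * (- x) ^ n)"
    unfolding gbinomial_pochhammer 2 by (simp only: divide_inverse mult.assoc mult.commute mult.left_commute)
  then show ?thesis unfolding 1 .
qed

lemma sum_inv_sqrt_coeff_diagonal:
  fixes a b :: "'a :: {real_normed_field}"
  shows "(\<Sum>m\<le>N. of_real (inv_sqrt_coeff m (N - m)) * a ^ m * b ^ (N - m)) = of_real (pochhammer (1/2) N / fact N) * (a + b) ^ N"
proof -
  have "of_real (inv_sqrt_coeff m (N - m)) * a ^ m * b ^ (N - m)
      = of_real (pochhammer (1/2) N / fact N) * (of_nat (N choose m) * a ^ m * b ^ (N - m))" if "m \<le> N" for m
  proof -
    have "inv_sqrt_coeff m (N - m) = pochhammer (1/2) N / fact N * real (N choose m)"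
      using that by (simp add: inv_sqrt_coeff_def binomial_fact)
    then show ?thesis by (simp add: mult_ac)
  qed
  then show ?thesis
    by (simp add: binomial_ring sum_distrib_left)
qed

lemma bij_diagonals: "bij_betw (\<lambda>(N, m). (m, N - m)) (Sigma UNIV (\<lambda>N::nat. {..N})) (UNIV :: (nat \<times> nat) set)"
  by (rule bij_betwI[where g = "\<lambda>(m, n). (m + n, m)"]) auto

text \<open>
  Summation along the diagonals \<open>m + n = N\<close> reduces this to the binomial series at \<open>\<bar>a\<bar> + \<bar>b\<bar>\<close>.
\<close>
lemma inv_sqrt_coeff_abs_summable:
  fixes a b :: complex
  assumes "cmod a + cmod b < 1"
  shows "(\<lambda>p. norm ((\<lambda>(m, n). of_real (inv_sqrt_coeff m n) * a ^ m * b ^ n) p)) summable_on UNIV"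
proof -
  let ?x = "cmod a + cmod b"
  have "(\<lambda>n. ((-1/2) gchoose n) * (- ?x) ^ n) sums (1 + - ?x) powr (-1/2)"
    by (rule gen_binomial_real) (use assms norm_ge_zero[of a] norm_ge_zero[of b] in linarith)
  then have s: "summable (\<lambda>n. pochhammer (1/2) n / fact n * ?x ^ n)"
    unfolding gbinomial_minus_half by (rule sums_summable)
  have "(\<lambda>(N, m). inv_sqrt_coeff m (N - m) * cmod a ^ m * cmod b ^ (N - m)) summable_on Sigma UNIV (\<lambda>N. {..N})"
  proof (rule summable_on_SigmaI)
    show "((\<lambda>m. case (N, m) of (N, m) \<Rightarrow> inv_sqrt_coeff m (N - m) * cmod a ^ m * cmod b ^ (N - m)) has_sum pochhammer (1/2) N / fact N * ?x ^ N) {..N}" for N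
      using sum_inv_sqrt_coeff_diagonal[of N "cmod a" "cmod b"] by (intro has_sum_finiteI) simp_all
    show "(\<lambda>n. pochhammer (1/2) n / fact n * ?x ^ n) summable_on UNIV"
      using s by (subst summable_on_UNIV_nonneg_real_iff) (auto intro!: mult_nonneg_nonneg divide_nonneg_nonneg pochhammer_nonneg)
  qed (auto intro!: mult_nonneg_nonneg inv_sqrt_coeff_nonneg)
  then have "(\<lambda>p. (\<lambda>(m, n). inv_sqrt_coeff m n * cmod a ^ m * cmod b ^ n) ((\<lambda>(N, m). (m, N - m)) p)) summable_on Sigma UNIV (\<lambda>N. {..N})"
    by (simp add: case_prod_beta')
  then have "(\<lambda>(m, n). inv_sqrt_coeff m n * cmod a ^ m * cmod b ^ n) summable_on UNIV"
    by (subst (asm) summable_on_reindex_bij_betw[OF bij_diagonals])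
  then show ?thesis
    by (simp add: case_prod_beta' norm_mult norm_power inv_sqrt_coeff_nonneg)
qed

lemma inv_sqrt_coeff_has_sum:
  fixes a b :: complex
  assumes "cmod a + cmod b < 1"
  shows "((\<lambda>(m, n). of_real (inv_sqrt_coeff m n) * a ^ m * b ^ n) has_sum 1 / csqrt (1 - a - b)) UNIV"
proof -
  have lt: "cmod (- (a + b)) < 1" unfolding norm_minus_cancel using norm_triangle_ineq[of a b] assms by linarith
  have sq: "(1 + - (a + b)) powr (-1/2) = 1 / csqrt (1 - a - b)"
  proof -
    have "(1 - a - b) powr (- (1/2)) = inverse ((1 - a - b) powr (1/2))" by (rule powr_minus)
    moreover have "1 + - (a + b) = 1 - a - b" "(- 1 / 2 :: complex) = - (1 / 2)" by simp_all
    ultimately show ?thesis unfolding csqrt_conv_powr by (simp only: inverse_eq_divide)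
  qed
  have pc: "pochhammer (1/2) n / fact n * z ^ n = of_real (pochhammer (1/2) n / fact n) * z ^ n" for n and z :: complex
    by (simp add: pochhammer_of_real[symmetric])
  have "(\<lambda>n. of_real (pochhammer (1/2) n / fact n) * (a + b) ^ n) sums (1 / csqrt (1 - a - b))"
    using gen_binomial_complex[OF lt, of "-1/2"] unfolding gbinomial_minus_half sq pc .
  moreover have "summable (\<lambda>n. norm (of_real (pochhammer (1/2) n / fact n) * (a + b) ^ n))"
  proof -
    have "(\<lambda>n. ((-1/2) gchoose n) * (- cmod (a + b)) ^ n) sums (1 + - cmod (a + b)) powr (-1/2)"
      by (rule gen_binomial_real) (use lt[unfolded norm_minus_cancel] in simp)
    then have "summable (\<lambda>n. pochhammer (1/2) n / fact n * cmod (a + b) ^ n)"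
      unfolding gbinomial_minus_half by (rule sums_summable)
    then show ?thesis by (simp add: norm_mult norm_divide norm_power abs_of_nonneg pochhammer_nonneg)
  qed
  ultimately have out: "((\<lambda>n. of_real (pochhammer (1/2) n / fact n) * (a + b) ^ n) has_sum 1 / csqrt (1 - a - b)) UNIV"
    by (intro norm_summable_imp_has_sum)
  let ?f = "\<lambda>(m, n). of_real (inv_sqrt_coeff m n) * a ^ m * b ^ n"
  have "((\<lambda>p. ?f ((\<lambda>(N, m). (m, N - m)) p)) has_sum 1 / csqrt (1 - a - b)) (Sigma UNIV (\<lambda>N. {..N}))"
  proof (rule has_sum_SigmaI)
    show "((\<lambda>m. ?f ((\<lambda>(N, m). (m, N - m)) (N, m))) has_sum of_real (pochhammer (1/2) N / fact N) * (a + b) ^ N) {..N}" for N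
      using sum_inv_sqrt_coeff_diagonal[of N a b] by (intro has_sum_finiteI) simp_all
    show "(\<lambda>p. ?f ((\<lambda>(N, m). (m, N - m)) p)) summable_on Sigma UNIV (\<lambda>N. {..N})"
      using abs_summable_summable[OF inv_sqrt_coeff_abs_summable[OF assms]]
      by (subst summable_on_reindex_bij_betw[OF bij_diagonals])
  qed (rule out)
  then show ?thesis
    by (subst (asm) has_sum_reindex_bij_betw[OF bij_diagonals])
qed

lemma has_sum_product_complex:
  fixes f :: "'a \<Rightarrow> complex" and g :: "'b \<Rightarrow> complex"
  assumes f: "(f has_sum S) UNIV" "(\<lambda>x. norm (f x)) summable_on UNIV" and g: "(g has_sum T) UNIV" "(\<lambda>x. norm (g x)) summable_on UNIV"
  shows "(\<lambda>p. norm ((\<lambda>(x, y). f x * g y) p)) summable_on UNIV" "((\<lambda>(x, y). f x * g y) has_sum S * T) UNIV"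
proof -
  have "(\<lambda>p. norm ((\<lambda>(x, y). f x * g y) p)) summable_on Sigma UNIV (\<lambda>_. UNIV)"
  proof (rule Infinite_Sum.abs_summable_on_Sigma_iff[THEN iffD2], intro conjI ballI)
    show "(\<lambda>y. norm (case (x, y) of (x, y) \<Rightarrow> f x * g y)) summable_on UNIV" for x
      using summable_on_cmult_right[OF g(2), of "cmod (f x)"] by (simp add: norm_mult)
    have "(\<lambda>x. cmod (f x) * infsum (\<lambda>y. cmod (g y)) UNIV) summable_on UNIV"
      by (rule summable_on_cmult_left[OF f(2)])
    moreover have "norm (infsum (\<lambda>y. norm (case (x, y) of (x, y) \<Rightarrow> f x * g y)) UNIV) = cmod (f x) * infsum (\<lambda>y. cmod (g y)) UNIV" for x
      by (simp add: norm_mult infsum_cmult_right' infsum_nonneg abs_mult)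
    ultimately show "(\<lambda>x. norm (infsum (\<lambda>y. norm (case (x, y) of (x, y) \<Rightarrow> f x * g y)) UNIV)) summable_on UNIV"
      by simp
  qed
  then show 1: "(\<lambda>p. norm ((\<lambda>(x, y). f x * g y) p)) summable_on UNIV" by simp
  have "((\<lambda>(x, y). f x * g y) has_sum S * T) (Sigma UNIV (\<lambda>_. UNIV))"
  proof (rule has_sum_SigmaI)
    show "((\<lambda>y. case (x, y) of (x, y) \<Rightarrow> f x * g y) has_sum f x * T) UNIV" for x
      using has_sum_cmult_right[OF g(1)] by simp
    show "((\<lambda>x. f x * T) has_sum S * T) UNIV" by (rule has_sum_cmult_left[OF f(1)])
    show "(\<lambda>(x, y). f x * g y) summable_on Sigma UNIV (\<lambda>_. UNIV)" using abs_summable_summable[OF 1] by simp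
  qed
  then show "((\<lambda>(x, y). f x * g y) has_sum S * T) UNIV" by simp
qed

text \<open>
  The probability density of the arcsine law.  Its moments are the quotients \<open>(1/2)\<^sub>k / (1)\<^sub>k\<close> that occur in the
  series, which is why the Euler integral and the series agree.
\<close>
definition arcsine_density :: "real \<Rightarrow> real" where
  "arcsine_density x = indicator {0<..<1} x / (pi * sqrt (x * (1 - x)))"

definition arcsine :: "real measure" where
  "arcsine = density lborel (\<lambda>x. ennreal (arcsine_density x))"

lemma arcsine_density_nonneg: "arcsine_density x \<ge> 0"
  by (auto simp: arcsine_density_def indicator_def)

lemma arcsine_density_measurable[measurable]: "arcsine_density \<in> borel_measurable borel"
  unfolding arcsine_density_def[abs_def] by measurable

lemma sets_arcsine[measurable_cong]: "sets arcsine = sets borel" and space_arcsine: "space arcsine = UNIV"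
  by (simp_all add: arcsine_def)

lemma nn_integral_arcsine_power: "(\<integral>\<^sup>+x. ennreal (x ^ k) \<partial>arcsine) = ennreal (pochhammer (1/2) k / fact k)"
proof -
  have "(\<integral>\<^sup>+x. ennreal (x ^ k) \<partial>arcsine) = (\<integral>\<^sup>+x. ennreal (arcsine_density x) * ennreal (x ^ k) \<partial>lborel)"
    unfolding arcsine_def by (subst nn_integral_density) simp_all
  also have "\<dots> = (\<integral>\<^sup>+x. ennreal (1 / pi) * (ennreal (x powr (real k + 1/2 - 1) * (1 - x) powr (1/2 - 1)) * indicator {0..1} x) \<partial>lborel)"
  proof (intro nn_integral_cong)
    fix x :: real
    show "ennreal (arcsine_density x) * ennreal (x ^ k) = ennreal (1 / pi) * (ennreal (x powr (real k + 1/2 - 1) * (1 - x) powr (1/2 - 1)) * indicator {0..1} x)"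
    proof (cases "x \<in> {0<..<1}")
      case True
      then have x: "0 < x" "x < 1" by auto
      have half: "y powr (- (1/2)) = 1 / sqrt y" if "y > 0" for y :: real
        using that by (simp only: powr_minus powr_half_sqrt less_imp_le inverse_eq_divide)
      have "real k + 1/2 - 1 = real k + - (1/2)" by simp
      then have "x powr (real k + 1/2 - 1) = x powr real k * x powr (- (1/2))"
        by (simp only: powr_add)
      also have "\<dots> = x ^ k / sqrt x" using x by (simp add: powr_realpow half)
      finally have 1: "x powr (real k + 1/2 - 1) = x ^ k / sqrt x" .
      have "(1/2 - 1 :: real) = - (1/2)" by simp
      then have 2: "(1 - x) powr (1/2 - 1) = 1 / sqrt (1 - x)" using x half[of "1 - x"] by simp
      show ?thesis
        unfolding 1 2 arcsine_density_def using x by (simp add: real_sqrt_mult ennreal_mult'[symmetric])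
    next
      case False
      then show ?thesis by (cases "x = 0 \<or> x = 1") (auto simp: arcsine_density_def indicator_def)
    qed
  qed
  also have "\<dots> = ennreal (1 / pi) * ennreal (Beta (real k + 1/2) (1/2))"
    by (subst nn_integral_cmult, simp, subst nn_integral_has_integral_lebesgue'[OF _ has_integral_Beta_real]) simp_all
  also have "\<dots> = ennreal (pochhammer (1/2) k / fact k)"
  proof -
    have "pochhammer (1/2) k = Gamma (1/2 + real k) / Gamma (1/2 :: real)"
      by (rule pochhammer_Gamma) (use nonpos_Ints_nonpos[of "1/2 :: real"] in auto)
    then have "Gamma (real k + 1/2) = pochhammer (1/2) k * sqrt pi"
      by (simp add: Gamma_one_half_real add.commute)
    moreover have "Gamma (real k + 1) = fact k" by (simp add: Gamma_fact add.commute)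
    ultimately have "Beta (real k + 1/2) (1/2) = pochhammer (1/2) k * pi / fact k"
      by (simp add: Beta_def Gamma_one_half_real add.commute)
    then show ?thesis by (simp flip: ennreal_mult')
  qed
  finally show ?thesis .
qed

interpretation arcsine: finite_measure arcsine
  by (rule finite_measureI) (use nn_integral_arcsine_power[of 0] in simp)

interpretation arcsine_pair: pair_sigma_finite arcsine arcsine ..

lemma AE_arcsine: "AE x in arcsine. 0 < x \<and> x < 1"
  unfolding arcsine_def by (subst AE_density) (auto simp: arcsine_density_def indicator_def)

lemma arcsine_power:
  "integrable arcsine (\<lambda>x. complex_of_real x ^ k)" "(\<integral>x. complex_of_real x ^ k \<partial>arcsine) = of_real (pochhammer (1/2) k / fact k)"
proof -
  have i: "integrable arcsine (\<lambda>x. x ^ k)"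
    by (rule arcsine.integrable_const_bound[where B = 1])
       (use AE_arcsine in \<open>eventually_elim, simp add: power_le_one\<close>, simp)
  have "ennreal (\<integral>x. x ^ k \<partial>arcsine) = (\<integral>\<^sup>+x. ennreal (x ^ k) \<partial>arcsine)"
    by (rule nn_integral_eq_integral[symmetric, OF i]) (use AE_arcsine in \<open>eventually_elim, simp\<close>)
  moreover have "0 \<le> (\<integral>x. x ^ k \<partial>arcsine)"
    by (rule integral_nonneg_AE) (use AE_arcsine in \<open>eventually_elim, simp\<close>)
  ultimately have e: "(\<integral>x. x ^ k \<partial>arcsine) = pochhammer (1/2) k / fact k"
    unfolding nn_integral_arcsine_power by (simp add: pochhammer_nonneg)
  show "integrable arcsine (\<lambda>x. complex_of_real x ^ k)"
    using i by (simp only: complex_of_real_integrable_eq flip: of_real_power)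
  show "(\<integral>x. complex_of_real x ^ k \<partial>arcsine) = of_real (pochhammer (1/2) k / fact k)"
    unfolding e[symmetric] of_real_power[symmetric] by (rule integral_complex_of_real)
qed

abbreviation arcsine2 :: "(real \<times> real) measure" where
  "arcsine2 \<equiv> arcsine \<Otimes>\<^sub>M arcsine"

lemma arcsine_pair_density:
  "arcsine2 = density lborel2 (\<lambda>p. ennreal (arcsine_density (fst p) * arcsine_density (snd p)))"
  using arcsine.sigma_finite_measure_axioms unfolding arcsine_def
  by (subst pair_measure_density)
     (auto simp: lborel.sigma_finite_measure_axioms case_prod_beta ennreal_mult' arcsine_density_nonneg intro!: density_cong)

lemma AE_arcsine_pair: "AE p in arcsine2. p \<in> {0<..<1} \<times> {0<..<1}"
  unfolding arcsine_pair_density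
  by (subst AE_density) (auto simp: arcsine_density_def indicator_def split: if_splits)

lemma arcsine_pair_power:
  "integrable arcsine2 (\<lambda>p. complex_of_real (fst p) ^ i * of_real (snd p) ^ j)"
  "(\<integral>p. complex_of_real (fst p) ^ i * of_real (snd p) ^ j \<partial>arcsine2)
     = of_real (pochhammer (1/2) i / fact i * (pochhammer (1/2) j / fact j))"
  "(\<integral>p. norm (complex_of_real (fst p) ^ i * of_real (snd p) ^ j) \<partial>arcsine2) \<le> 1"
proof -
  have bd: "AE p in arcsine2. norm (complex_of_real (fst p) ^ i * of_real (snd p) ^ j) \<le> 1"
    using AE_arcsine_pair
    by eventually_elim (auto simp: norm_mult norm_power intro!: mult_le_one power_le_one)
  have one: "emeasure arcsine UNIV = 1"
    using nn_integral_arcsine_power[of 0] by (simp add: space_arcsine)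
  have one2: "emeasure arcsine2 (space arcsine2) = 1"
    unfolding space_pair_measure space_arcsine
    by (subst arcsine.emeasure_pair_measure_Times) (simp_all add: one sets_arcsine)
  interpret P: finite_measure "arcsine2"
    by (rule finite_measureI) (simp add: one2)
  show int: "integrable arcsine2 (\<lambda>p. complex_of_real (fst p) ^ i * of_real (snd p) ^ j)"
    by (rule P.integrable_const_bound[OF bd]) measurable
  have "(\<integral>p. complex_of_real (fst p) ^ i * of_real (snd p) ^ j \<partial>arcsine2)
     = (\<integral>x. \<integral>y. complex_of_real x ^ i * of_real y ^ j \<partial>arcsine \<partial>arcsine)"
    using arcsine_pair.integral_fst'[OF int] by simp
  then show "(\<integral>p. complex_of_real (fst p) ^ i * of_real (snd p) ^ j \<partial>arcsine2)
     = of_real (pochhammer (1/2) i / fact i * (pochhammer (1/2) j / fact j))"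
    by (simp add: arcsine_power)
  have "(\<integral>p. norm (complex_of_real (fst p) ^ i * of_real (snd p) ^ j) \<partial>arcsine2) \<le> (\<integral>p. 1 \<partial>arcsine2)"
    by (intro integral_mono_AE integrable_norm int bd) (simp_all add: one2)
  then show "(\<integral>p. norm (complex_of_real (fst p) ^ i * of_real (snd p) ^ j) \<partial>arcsine2) \<le> 1"
    using one2 by (simp add: measure_def)
qed

lemma lin_factor_bound:
  assumes "cmod a + cmod b < 1" "p \<in> unit_square"
  shows "cmod (a * of_real (fst p)) + cmod (b * of_real (snd p)) < 1" "lin_factor a b p \<noteq> 0"
proof -
  have "cmod (a * of_real (fst p)) \<le> cmod a" "cmod (b * of_real (snd p)) \<le> cmod b"
    using assms(2) by (auto simp: norm_mult intro!: mult_left_le)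
  then show 1: "cmod (a * of_real (fst p)) + cmod (b * of_real (snd p)) < 1" using assms(1) by simp
  show "lin_factor a b p \<noteq> 0"
  proof
    assume "lin_factor a b p = 0"
    then have "1 = cmod (a * of_real (fst p) + b * of_real (snd p))"
      unfolding lin_factor_def by (metis add.commute diff_add_cancel diff_diff_eq eq_iff_diff_eq_0 norm_one)
    then show False using norm_triangle_ineq[of "a * of_real (fst p)" "b * of_real (snd p)"] 1 by linarith
  qed
qed

lemma FS_euler_arcsine:
  assumes nz: "\<forall>p\<in>unit_square. lin_factor (z$1$1) (z$2$1) p \<noteq> 0" "\<forall>p\<in>unit_square. lin_factor (z$1$2) (z$2$2) p \<noteq> 0"
  shows "FS_euler z = (\<integral>p. 1 / csqrt (lin_factor (z$1$1) (z$2$1) p) * (1 / csqrt (lin_factor (z$1$2) (z$2$2) p)) \<partial>arcsine2)"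
proof -
  let ?f = "\<lambda>p. 1 / csqrt (lin_factor (z$1$1) (z$2$1) p) * (1 / csqrt (lin_factor (z$1$2) (z$2$2) p))"
  have [measurable]: "?f \<in> borel_measurable lborel2"
    unfolding lin_factor_def by measurable
  have eq: "1 / of_real (pi ^ 2) * (indicator unit_square p *\<^sub>R (case p of (s1, s2) \<Rightarrow> 1 / (of_real (sqrt (s1 * (1 - s1) * s2 * (1 - s2)))
      * lin_sqrt (z$1$1) (z$2$1) (s1, s2) * lin_sqrt (z$1$2) (z$2$2) (s1, s2))))
     = (arcsine_density (fst p) * arcsine_density (snd p)) *\<^sub>R ?f p" for p :: "real \<times> real"
  proof (cases "p \<in> unit_square")
    case True
    then obtain s t where p: "p = (s, t)" "0 \<le> s" "s \<le> 1" "0 \<le> t" "t \<le> 1" by auto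
    have ls: "lin_sqrt (z$1$1) (z$2$1) p = csqrt (lin_factor (z$1$1) (z$2$1) p)"
      "lin_sqrt (z$1$2) (z$2$2) p = csqrt (lin_factor (z$1$2) (z$2$2) p)"
      using nz True by (auto intro!: lin_sqrt_eq_csqrt)
    have sq: "sqrt (s * (1 - s) * t * (1 - t)) = sqrt (s * (1 - s)) * sqrt (t * (1 - t))"
      by (simp add: real_sqrt_mult mult_ac)
    have "indicator unit_square p = (1::real)" using True by simp
    then show ?thesis using ls p
      by (auto simp: arcsine_density_def indicator_def sq scaleR_conv_of_real power2_eq_square)
  qed (cases p, auto simp: indicator_def arcsine_density_def)
  have "FS_euler z = (\<integral>p. 1 / of_real (pi ^ 2) * (indicator unit_square p *\<^sub>R (case p of (s1, s2) \<Rightarrow> 1 / (of_real (sqrt (s1 * (1 - s1) * s2 * (1 - s2)))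
      * lin_sqrt (z$1$1) (z$2$1) (s1, s2) * lin_sqrt (z$1$2) (z$2$2) (s1, s2)))) \<partial>lborel2)"
    unfolding FS_euler_def set_lebesgue_integral_def integral_mult_right_zero lborel_prod ..
  also have "\<dots> = (\<integral>p. ?f p \<partial>arcsine2)"
    unfolding eq arcsine_pair_density
    by (rule integral_density[symmetric], measurable) (simp add: arcsine_density_nonneg)
  finally show ?thesis .
qed

text \<open>
  Expand both inverse square roots and integrate term by term against two independent arcsine laws.  Since
  the coordinates are at most 1, the summable moduli of the coefficients dominate everything.
\<close>
lemma FS_series_eq_FS_euler:
  assumes z: "cmod (z$1$1) + cmod (z$2$1) < 1" "cmod (z$1$2) + cmod (z$2$2) < 1"
  shows "FS_series z = FS_euler z"
proof -
  let ?t = "\<lambda>a b (m, n). of_real (inv_sqrt_coeff m n) * a ^ m * b ^ n :: complex"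
  define c where "c = (\<lambda>((n1, n2), (n3, n4)). ?t (z$1$1) (z$2$1) (n1, n2) * ?t (z$1$2) (z$2$2) (n3, n4))"
  define e1 e2 :: "(nat \<times> nat) \<times> (nat \<times> nat) \<Rightarrow> nat"
    where "e1 = (\<lambda>((n1, n2), (n3, n4)). n1 + n3)" and "e2 = (\<lambda>((n1, n2), (n3, n4)). n2 + n4)"
  define w where "w k p = complex_of_real (fst p) ^ e1 k * of_real (snd p) ^ e2 k" for k and p :: "real \<times> real"
  let ?f = "\<lambda>p. 1 / csqrt (lin_factor (z$1$1) (z$2$1) p) * (1 / csqrt (lin_factor (z$1$2) (z$2$2) p))"
  \<comment> \<open>An enumeration of the index set makes the term-by-term integration theorem for sequences applicable.\<close>
  define g where "g = from_nat_into (UNIV :: ((nat \<times> nat) \<times> (nat \<times> nat)) set)"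
  have g: "bij_betw g UNIV UNIV"
    unfolding g_def by (rule bij_betw_from_nat_into) (simp_all add: finite_prod)
  have csum: "(\<lambda>k. norm (c k)) summable_on UNIV"
    using has_sum_product_complex(1)[OF inv_sqrt_coeff_has_sum[OF z(1)] inv_sqrt_coeff_abs_summable[OF z(1)]
        inv_sqrt_coeff_has_sum[OF z(2)] inv_sqrt_coeff_abs_summable[OF z(2)]]
    by (simp add: c_def case_prod_beta')
  then have csum': "summable (\<lambda>i. cmod (c (g i)))"
    by (intro summable_on_imp_summable) (subst summable_on_reindex_bij_betw[OF g])
  have pt: "((\<lambda>k. c k * w k p) has_sum ?f p) UNIV" if p: "p \<in> unit_square" for p
  proof -
    note b = lin_factor_bound(1)[OF z(1) p] lin_factor_bound(1)[OF z(2) p]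
    have "((\<lambda>(x, y). ?t (z$1$1 * of_real (fst p)) (z$2$1 * of_real (snd p)) x * ?t (z$1$2 * of_real (fst p)) (z$2$2 * of_real (snd p)) y)
       has_sum ?f p) UNIV"
      using has_sum_product_complex(2)[OF inv_sqrt_coeff_has_sum[OF b(1)] inv_sqrt_coeff_abs_summable[OF b(1)]
        inv_sqrt_coeff_has_sum[OF b(2)] inv_sqrt_coeff_abs_summable[OF b(2)]]
      unfolding lin_factor_def .
    moreover have "(\<lambda>(x, y). ?t (z$1$1 * of_real (fst p)) (z$2$1 * of_real (snd p)) x * ?t (z$1$2 * of_real (fst p)) (z$2$2 * of_real (snd p)) y)
       = (\<lambda>k. c k * w k p)"
      by (auto simp: fun_eq_iff c_def w_def e1_def e2_def power_mult_distrib power_add mult_ac)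
    ultimately show ?thesis by simp
  qed
  have wi: "integrable arcsine2 (w k)" for k
    unfolding w_def by (rule arcsine_pair_power(1))
  have wn: "(\<integral>p. norm (w k p) \<partial>arcsine2) \<le> 1" for k
    unfolding w_def by (rule arcsine_pair_power(3))
  have AE1: "AE p in arcsine2. p \<in> unit_square"
    using AE_arcsine_pair by eventually_elim auto
  have AEs: "AE p in arcsine2. summable (\<lambda>i. norm (c (g i) * w (g i) p))"
    using AE1
  proof eventually_elim
    case (elim p)
    have "norm (w k p) \<le> 1" for k
      using elim unfolding w_def by (auto simp: norm_mult norm_power intro!: mult_le_one power_le_one)
    then show ?case
      by (intro summable_comparison_test[OF _ csum']) (auto simp: norm_mult mult_left_le intro!: exI[of _ 0])
  qed
  have sI: "summable (\<lambda>i. \<integral>p. norm (c (g i) * w (g i) p) \<partial>arcsine2)"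
    by (rule summable_comparison_test[OF _ csum'])
       (use wn in \<open>auto simp: norm_mult mult_left_le integral_nonneg_AE intro!: exI[of _ 0]\<close>)
  have int: "integrable arcsine2 (\<lambda>p. c (g i) * w (g i) p)" for i
    by (intro integrable_mult_right wi)
  have "FS_euler z = (\<integral>p. ?f p \<partial>arcsine2)"
    by (rule FS_euler_arcsine) (use lin_factor_bound(2)[OF z(1)] lin_factor_bound(2)[OF z(2)] in auto)
  also have "\<dots> = (\<integral>p. (\<Sum>i. c (g i) * w (g i) p) \<partial>arcsine2)"
  proof (rule integral_cong_AE)
    show "AE p in arcsine2. ?f p = (\<Sum>i. c (g i) * w (g i) p)"
      using AE1
    proof eventually_elim
      case (elim p)
      have "((\<lambda>i. c (g i) * w (g i) p) has_sum ?f p) UNIV"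
        using pt[OF elim] by (subst has_sum_reindex_bij_betw[OF g])
      then show ?case by (simp add: has_sum_imp_sums sums_unique)
    qed
    show "?f \<in> borel_measurable arcsine2" unfolding lin_factor_def by measurable
    show "(\<lambda>p. \<Sum>i. c (g i) * w (g i) p) \<in> borel_measurable arcsine2" unfolding w_def by measurable
  qed
  also have "\<dots> = (\<Sum>i. \<integral>p. c (g i) * w (g i) p \<partial>arcsine2)"
    by (rule integral_suminf[OF int AEs sI])
  also have "\<dots> = (\<Sum>\<^sub>\<infinity>i. \<integral>p. c (g i) * w (g i) p \<partial>arcsine2)"
  proof -
    have s: "summable (\<lambda>i. norm (\<integral>p. c (g i) * w (g i) p \<partial>arcsine2))"
      by (rule summable_comparison_test[OF _ sI])
         (auto simp only: real_norm_def abs_norm_cancel intro!: exI[of _ 0] integral_norm_bound)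
    show ?thesis
      by (rule infsumI[symmetric, OF norm_summable_imp_has_sum[OF s summable_sums[OF summable_norm_cancel[OF s]]]])
  qed
  also have "\<dots> = (\<Sum>\<^sub>\<infinity>k. \<integral>p. c k * w k p \<partial>arcsine2)"
    by (rule infsum_reindex_bij_betw[OF g])
  also have "\<dots> = (\<Sum>\<^sub>\<infinity>k. c k * of_real (pochhammer (1/2) (e1 k) / fact (e1 k) * (pochhammer (1/2) (e2 k) / fact (e2 k))))"
    unfolding w_def integral_mult_right_zero arcsine_pair_power(2) ..
  also have "\<dots> = FS_series z"
  proof -
    let ?h = "\<lambda>(n1, n2, n3, n4). ((n1, n2), (n3, n4)) :: (nat \<times> nat) \<times> (nat \<times> nat)"
    have h: "bij_betw ?h UNIV UNIV"
      by (rule bij_betwI[where g = "\<lambda>((n1, n2), (n3, n4)). (n1, n2, n3, n4)"]) auto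
    have pc: "pochhammer (1/2) n = complex_of_real (pochhammer (1/2) n)" for n
      by (simp add: pochhammer_of_real[symmetric])
    have p1: "pochhammer 1 n = complex_of_real (fact n)" for n
      by (simp add: pochhammer_fact[symmetric])
    show ?thesis
      unfolding FS_series_def
      by (subst infsum_reindex_bij_betw[OF h, symmetric])
         (auto intro!: infsum_cong simp: c_def e1_def e2_def inv_sqrt_coeff_def pc p1 mult_ac)
  qed
  finally show ?thesis ..
qed

section \<open>The quadratic transformation\<close>

lemma Arg_sum_less_pi_half:
  assumes p: "Re p > 0" and q: "Re q > 0" and pq: "\<bar>Im p * Im q\<bar> < Re p * Re q"
  shows "\<bar>Arg p\<bar> + \<bar>Arg q\<bar> < pi / 2"
proof -
  have nz: "p \<noteq> 0" "q \<noteq> 0" using p q by auto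
  have b: "\<bar>Arg p\<bar> < pi / 2" "\<bar>Arg q\<bar> < pi / 2" using p q Arg_Re_pos by auto
  have "Re (p * q) > 0" "Re (p * cnj q) > 0" using pq by (auto simp: abs_less_iff)
  then have "\<bar>Arg (p * q)\<bar> < pi / 2" "\<bar>Arg (p * cnj q)\<bar> < pi / 2" using Arg_Re_pos by auto
  moreover have "Arg (p * q) = Arg p + Arg q" using b nz by (intro Arg_times) auto
  moreover have "Arg (cnj q) = - Arg q" using q by (simp add: Arg_cnj complex_is_Real_iff) (metis Arg_eq_0 b(2) complex_is_Real_iff less_imp_le minus_zero)
  then have "Arg (p * cnj q) = Arg p - Arg q" using b nz by (subst Arg_times) auto
  ultimately show ?thesis by linarith
qed

text \<open>
  Here \<open>p\<close> and \<open>q\<close> are the square roots of \<open>\<rho>\<close> and \<open>\<sigma>\<close> in the right half-plane.  The inequality between real and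
  imaginary parts says that \<open>p q\<close> and \<open>p cnj q\<close> both have positive real part, that is,
  \<open>\<bar>Arg p\<bar> + \<bar>Arg q\<bar> < \<pi> / 2\<close>.
\<close>
lemma FS_eq_borchardt_integral:
  fixes c1 c2 c3 c4 :: real and p q :: complex and z :: "complex^2^2"
  assumes c: "c1 > 0" "c2 > 0" "c3 > 0" "c4 > 0"
    and pq: "Re p > 0" "Re q > 0" "\<bar>Im p * Im q\<bar> < Re p * Re q"
    and rel: "of_real c4 * p\<^sup>2 + of_real c1 * q\<^sup>2 - of_real c2 = of_real c3 * p\<^sup>2 * q\<^sup>2"
      "of_real c1 * p\<^sup>2 + of_real c4 * q\<^sup>2 - of_real c3 = of_real c2 * p\<^sup>2 * q\<^sup>2"
    and z: "z$1$1 = 1 - of_real (c4 / c2) * p\<^sup>2" "z$1$2 = 1 - of_real (c1 / c3) * p\<^sup>2"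
      "z$2$1 = 1 - of_real (c1 / c2) * q\<^sup>2" "z$2$2 = 1 - of_real (c4 / c3) * q\<^sup>2"
  shows "FS z = of_real (sqrt (c2 * c3) / pi\<^sup>2) * of_real (enn2real (borchardt_integral c1 c2 c3 c4)) / (p * q)"
proof -
  define l m where "l = 2 * Ln p" and "m = 2 * Ln q"
  have nz: "p \<noteq> 0" "q \<noteq> 0" using pq by auto
  have e: "exp l = p\<^sup>2" "exp m = q\<^sup>2"
    using nz by (simp_all add: l_def m_def exp_double)
  have im: "\<bar>Im l\<bar> + \<bar>Im m\<bar> < pi"
    using Arg_sum_less_pi_half[OF pq] nz by (simp add: l_def m_def Arg_eq_Im_Ln)
  have pqe: "exp (- (l + m) / 2) = 1 / (p * q)"
  proof -
    have "- (l + m) / 2 = - (Ln p + Ln q)" by (simp add: l_def m_def)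
    then show ?thesis by (simp only: exp_minus exp_add exp_Ln[OF nz(1)] exp_Ln[OF nz(2)] inverse_eq_divide)
  qed
  have "FS z = FS_euler z"
    using FS_series_eq_FS_euler[of z] by (simp add: FS_def)
  also have "\<dots> = of_real (sqrt (c2 * c3) / pi\<^sup>2) * exp (- (l + m) / 2) * of_real (enn2real (borchardt_integral c1 c2 c3 c4))"
    by (rule FS_euler_eq_borchardt_integral[OF c im]) (use rel z in \<open>simp_all add: e\<close>)
  finally show ?thesis unfolding pqe by simp
qed

lemma inverse_sector:
  fixes p q :: complex
  assumes pq: "Re p > 0" "Re q > 0" "\<bar>Im p * Im q\<bar> < Re p * Re q"
  shows "Re (inverse p) > 0" "Re (inverse q) > 0" "\<bar>Im (inverse p) * Im (inverse q)\<bar> < Re (inverse p) * Re (inverse q)"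
proof -
  have n: "0 < (Re p)\<^sup>2 + (Im p)\<^sup>2" "0 < (Re q)\<^sup>2 + (Im q)\<^sup>2"
    using pq by (simp_all add: add_pos_nonneg)
  show "Re (inverse p) > 0" "Re (inverse q) > 0" using pq n by simp_all
  have "\<bar>Im (inverse p) * Im (inverse q)\<bar> = \<bar>Im p * Im q\<bar> / (((Re p)\<^sup>2 + (Im p)\<^sup>2) * ((Re q)\<^sup>2 + (Im q)\<^sup>2))"
    using n by (simp add: abs_mult)
  also have "\<dots> < (Re p * Re q) / (((Re p)\<^sup>2 + (Im p)\<^sup>2) * ((Re q)\<^sup>2 + (Im q)\<^sup>2))"
    using pq n by (intro divide_strict_right_mono mult_pos_pos)
  finally show "\<bar>Im (inverse p) * Im (inverse q)\<bar> < Re (inverse p) * Re (inverse q)" by simp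
qed

text \<open>
  Passing to inverses exchanges the two relations between \<open>p\<close> and \<open>q\<close>; this is how \<open>w\<close> is obtained from \<open>z\<close>.
\<close>
lemma inverse_bilinear_relation:
  fixes p q c1 c2 c3 c4 :: "'a :: field"
  assumes "p \<noteq> 0" "q \<noteq> 0" and "c4 * p\<^sup>2 + c1 * q\<^sup>2 - c2 = c3 * p\<^sup>2 * q\<^sup>2"
  shows "c1 * (inverse p)\<^sup>2 + c4 * (inverse q)\<^sup>2 - c3 = c2 * (inverse p)\<^sup>2 * (inverse q)\<^sup>2"
proof -
  have "(inverse p)\<^sup>2 * p\<^sup>2 = 1" "(inverse q)\<^sup>2 * q\<^sup>2 = 1"
    using assms(1,2) by (simp_all flip: power_mult_distrib)
  then show ?thesis using assms(3) by algebra
qed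

lemma csqrt_of_real_mult_real:
  assumes "x > 0" shows "csqrt (of_real (x * y)) = of_real (sqrt x) * csqrt (of_real y)"
proof (cases "y \<ge> 0")
  case True
  then show ?thesis using assms by (simp add: real_sqrt_mult flip: of_real_mult)
next
  case False
  then have "x * y < 0" using assms by (simp add: mult_less_0_iff)
  moreover have "sqrt (- (x * y)) = sqrt x * sqrt (- y)"
    using real_sqrt_mult[of x "- y"] by simp
  ultimately show ?thesis using False
    by (simp add: csqrt_of_real_nonpos del: of_real_mult) (simp only: of_real_mult)
qed

theorem theorem6:
  fixes c1 c2 c3 c4 d1 d2 d3 d4 :: real
    and r13 r24 r12 r34 :: complex
    and z w mz mw :: "complex^2^2"
  assumes "c1 > c2" and "c2 > c3" and "c3 > c4" and "c4 > 0"
    and "d1 = c1 + c2 + c3 + c4"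
    and "d2 = c1 + c2 - c3 - c4"
    and "d3 = c1 - c2 + c3 - c4"
    and "d4 = c1 - c2 - c3 + c4"
    and "r13 = csqrt (complex_of_real (d1 * d3))"
    and "r24 = csqrt (complex_of_real (d2 * d4))"
    and "r12 = csqrt (complex_of_real (d1 * d2))"
    and "r34 = csqrt (complex_of_real (d3 * d4))"
    and "z = vector
      [vector [1 - complex_of_real (c4 / c2) * ((r13 - r24) / (r13 + r24)),
               1 - complex_of_real (c1 / c3) * ((r13 - r24) / (r13 + r24))],
       vector [1 - complex_of_real (c1 / c2) * ((r12 - r34) / (r12 + r34)),
               1 - complex_of_real (c4 / c3) * ((r12 - r34) / (r12 + r34))]]"
    and "w = vector
      [vector [1 - complex_of_real (c4 / c2) * ((r13 + r24) / (r13 - r24)),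
               1 - complex_of_real (c1 / c3) * ((r13 + r24) / (r13 - r24))],
       vector [1 - complex_of_real (c1 / c2) * ((r12 + r34) / (r12 - r34)),
               1 - complex_of_real (c4 / c3) * ((r12 + r34) / (r12 - r34))]]"
    and "mz = vector
      [vector [complex_of_real
                 (1 - (2 * (sqrt (c1 * c4) + sqrt (c2 * c3)) * (sqrt (c1 * c3) - sqrt (c2 * c4)))
                    / ((sqrt (c1 * c2) + sqrt (c3 * c4)) * d3)),
               complex_of_real
                 (1 - ((sqrt (c1 * c3) - sqrt (c2 * c4)) * d1)
                    / ((sqrt (c1 * c3) + sqrt (c2 * c4)) * d3))],
       vector [complex_of_real
                 (1 - ((sqrt (c1 * c2) - sqrt (c3 * c4)) * d1)
                    / ((sqrt (c1 * c2) + sqrt (c3 * c4)) * d2)),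
               complex_of_real
                 (1 - (2 * (sqrt (c1 * c4) + sqrt (c2 * c3)) * (sqrt (c1 * c2) - sqrt (c3 * c4)))
                    / ((sqrt (c1 * c3) + sqrt (c2 * c4)) * d2))]]"
    and "mw = vector
      [vector [complex_of_real
                 (1 - ((sqrt (c1 * c4) + sqrt (c2 * c3)) * d3)
                    / (2 * (sqrt (c1 * c2) + sqrt (c3 * c4)) * (sqrt (c1 * c3) - sqrt (c2 * c4)))),
               complex_of_real (1 - (d1 * d3) / (4 * (c1 * c3 - c2 * c4)))],
       vector [complex_of_real (1 - (d1 * d2) / (4 * (c1 * c2 - c3 * c4))),
               complex_of_real
                 (1 - ((sqrt (c1 * c4) + sqrt (c2 * c3)) * d2)
                    / (2 * (sqrt (c1 * c3) + sqrt (c2 * c4)) * (sqrt (c1 * c2) - sqrt (c3 * c4))))]]"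
  shows "FS mz =
      1 / 16 * ((complex_of_real (sqrt (d2 * d3)) * (r12 - r34) * (r13 - r24))
        / complex_of_real (sqrt (c2 * c3) * (sqrt (c1 * c2) - sqrt (c3 * c4))
                             * (sqrt (c1 * c3) - sqrt (c2 * c4)))) * FS z
    \<and> FS mw =
      ((r12 + r34) * (r13 + r24)) / complex_of_real (4 * sqrt (c2 * c3 * d2 * d3)) * FS w"
proof -
  note [simp] = vector_2
  define a b c d where "a = sqrt c1" and "b = sqrt c2" and "c = sqrt c3" and "d = sqrt c4"
  have cpos: "c1 > 0" "c2 > 0" "c3 > 0" "c4 > 0" using assms(1-4) by auto
  have sq: "a\<^sup>2 = c1" "b\<^sup>2 = c2" "c\<^sup>2 = c3" "d\<^sup>2 = c4"
    using cpos by (simp_all add: a_def b_def c_def d_def)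
  have ord: "a > b" "b > c" "c > d" "d > 0"
    using assms(1-4) by (simp_all add: a_def b_def c_def d_def)
  have pos: "a > 0" "b > 0" "c > 0" "d > 0" using ord by auto
  have sqrts: "sqrt (c1 * c4) = a * d" "sqrt (c2 * c3) = b * c" "sqrt (c1 * c3) = a * c" "sqrt (c2 * c4) = b * d"
    "sqrt (c1 * c2) = a * b" "sqrt (c3 * c4) = c * d"
    by (simp_all add: a_def b_def c_def d_def real_sqrt_mult)
  note d_defs = assms(5-8)
  have dpos: "d1 > 0" "d2 > 0" "d3 > 0" "\<bar>d4\<bar> < d1" using assms(1-4) unfolding d_defs by auto
  have diff: "c * d < a * b" "b * d < a * c" using ord pos by (auto intro!: mult_strict_mono)
  define X Y U V where XYUV: "X = sqrt (a * c - b * d)" "Y = sqrt (a * c + b * d)" "U = sqrt (a * b - c * d)" "V = sqrt (a * b + c * d)"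
  have XYUV_sq: "X\<^sup>2 = a * c - b * d" "Y\<^sup>2 = a * c + b * d" "U\<^sup>2 = a * b - c * d" "V\<^sup>2 = a * b + c * d"
    unfolding XYUV using diff pos by (simp_all add: add_nonneg_nonneg)
  have XYUV_pos: "X > 0" "Y > 0" "U > 0" "V > 0"
    unfolding XYUV using diff pos by (simp_all add: add_pos_pos)
  define S1 S2 S3 where S: "S1 = sqrt d1" "S2 = sqrt d2" "S3 = sqrt d3"
  have S_sq: "S1\<^sup>2 = d1" "S2\<^sup>2 = d2" "S3\<^sup>2 = d3" and S_pos: "S1 > 0" "S2 > 0" "S3 > 0"
    unfolding S using dpos by simp_all
  define J where "J = complex_of_real (enn2real (borchardt_integral c1 c2 c3 c4))"
  define \<delta> where "\<delta> = csqrt (of_real d4)"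
  have delta_sq: "\<delta>\<^sup>2 = of_real d4" by (simp add: \<delta>_def)
  have r: "r13 = of_real (S1 * S3)" "r24 = of_real S2 * \<delta>" "r12 = of_real (S1 * S2)" "r34 = of_real S3 * \<delta>"
    unfolding assms(9-12) \<delta>_def S
    using dpos by (simp_all only: csqrt_of_real_mult_real) (simp_all add: real_sqrt_mult)
  \<comment> \<open>The square roots of the two quotients in \<open>z\<close>, since \<open>(r13 - r24) (r13 + r24) = 4 (c1 c3 - c2 c4) = (2 X Y)\<^sup>2\<close> and similarly for \<open>q\<close>.\<close>
  define p q where "p = (r13 - r24) / of_real (2 * X * Y)" and "q = (r12 - r34) / of_real (2 * U * V)"
  have dd: "d1 * d3 - d2 * d4 = (2 * X * Y)\<^sup>2" "d1 * d2 - d3 * d4 = (2 * U * V)\<^sup>2"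
    unfolding power_mult_distrib XYUV_sq d_defs sq[symmetric] by (simp_all add: power2_eq_square algebra_simps)
  have rr: "(r13 - r24) * (r13 + r24) = of_real ((2 * X * Y)\<^sup>2)" "(r12 - r34) * (r12 + r34) = of_real ((2 * U * V)\<^sup>2)"
  proof -
    have "(r13 - r24) * (r13 + r24) = of_real (S1\<^sup>2 * S3\<^sup>2) - of_real (S2\<^sup>2) * \<delta>\<^sup>2"
      "(r12 - r34) * (r12 + r34) = of_real (S1\<^sup>2 * S2\<^sup>2) - of_real (S3\<^sup>2) * \<delta>\<^sup>2"
      unfolding r by (simp_all add: power2_eq_square algebra_simps)
    then show "(r13 - r24) * (r13 + r24) = of_real ((2 * X * Y)\<^sup>2)" "(r12 - r34) * (r12 + r34) = of_real ((2 * U * V)\<^sup>2)"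
      unfolding delta_sq S_sq dd[symmetric] by simp_all
  qed
  have k: "2 * X * Y > 0" "2 * U * V > 0" using XYUV_pos by simp_all
  have rnz: "r13 - r24 \<noteq> 0" "r13 + r24 \<noteq> 0" "r12 - r34 \<noteq> 0" "r12 + r34 \<noteq> 0"
    using rr k by auto
  have p2: "p\<^sup>2 = (r13 - r24) / (r13 + r24)" "q\<^sup>2 = (r12 - r34) / (r12 + r34)"
  proof -
    have "p\<^sup>2 = (r13 - r24)\<^sup>2 / of_real ((2 * X * Y)\<^sup>2)" "q\<^sup>2 = (r12 - r34)\<^sup>2 / of_real ((2 * U * V)\<^sup>2)"
      unfolding p_def q_def by (simp_all only: power_divide of_real_power)
    then show "p\<^sup>2 = (r13 - r24) / (r13 + r24)" "q\<^sup>2 = (r12 - r34) / (r12 + r34)"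
      unfolding rr[symmetric] using rnz by (simp_all add: power2_eq_square)
  qed
  have cd: "c1 = (d1 + d2 + d3 + d4) / 4" "c2 = (d1 + d2 - d3 - d4) / 4" "c3 = (d1 - d2 + d3 - d4) / 4" "c4 = (d1 - d2 - d3 + d4) / 4"
    unfolding d_defs by simp_all
  \<comment> \<open>Everything is a polynomial in \<open>S1, S2, S3\<close> and \<open>\<delta>\<close>, the square roots of \<open>d1, d2, d3, d4\<close>.\<close>
  have cdc: "4 * of_real c1 = of_real S1 ^ 2 + of_real S2 ^ 2 + of_real S3 ^ 2 + \<delta>\<^sup>2"
    "4 * of_real c2 = of_real S1 ^ 2 + of_real S2 ^ 2 - of_real S3 ^ 2 - \<delta>\<^sup>2"
    "4 * of_real c3 = of_real S1 ^ 2 - of_real S2 ^ 2 + of_real S3 ^ 2 - \<delta>\<^sup>2"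
    "4 * of_real c4 = of_real S1 ^ 2 - of_real S2 ^ 2 - of_real S3 ^ 2 + \<delta>\<^sup>2"
    unfolding delta_sq of_real_power[symmetric] S_sq cd by simp_all
  have rel: "of_real c4 * p\<^sup>2 + of_real c1 * q\<^sup>2 - of_real c2 = of_real c3 * p\<^sup>2 * q\<^sup>2"
    "of_real c1 * p\<^sup>2 + of_real c4 * q\<^sup>2 - of_real c3 = of_real c2 * p\<^sup>2 * q\<^sup>2"
  proof -
    have 1: "of_real c4 * (r13 - r24) * (r12 + r34) + of_real c1 * (r12 - r34) * (r13 + r24) - of_real c2 * (r13 + r24) * (r12 + r34)
       = of_real c3 * (r13 - r24) * (r12 - r34)"
      "of_real c1 * (r13 - r24) * (r12 + r34) + of_real c4 * (r12 - r34) * (r13 + r24) - of_real c3 * (r13 + r24) * (r12 + r34)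
       = of_real c2 * (r13 - r24) * (r12 - r34)"
      using cdc unfolding r of_real_mult by algebra+
    show "of_real c4 * p\<^sup>2 + of_real c1 * q\<^sup>2 - of_real c2 = of_real c3 * p\<^sup>2 * q\<^sup>2"
      "of_real c1 * p\<^sup>2 + of_real c4 * q\<^sup>2 - of_real c3 = of_real c2 * p\<^sup>2 * q\<^sup>2"
      using 1 unfolding p2 using rnz by (simp_all add: divide_simps) (simp_all add: mult_ac)
  qed
  have reim: "Re p = (S1 * S3 - S2 * Re \<delta>) / (2 * X * Y)" "Im p = - (S2 * Im \<delta>) / (2 * X * Y)"
    "Re q = (S1 * S2 - S3 * Re \<delta>) / (2 * U * V)" "Im q = - (S3 * Im \<delta>) / (2 * U * V)"
    unfolding p_def q_def r by (simp_all only: Re_divide_of_real Im_divide_of_real) simp_all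
  \<comment> \<open>Here \<open>\<delta>\<close> is real or purely imaginary; in the second case the last inequality is \<open>- d4 < d1\<close>.\<close>
  have key: "S1 * S3 - S2 * Re \<delta> > 0" "S1 * S2 - S3 * Re \<delta> > 0"
    "S2 * S3 * (Im \<delta>)\<^sup>2 < (S1 * S3 - S2 * Re \<delta>) * (S1 * S2 - S3 * Re \<delta>)"
  proof -
    have "S1 * S3 - S2 * Re \<delta> > 0 \<and> S1 * S2 - S3 * Re \<delta> > 0 \<and>
      S2 * S3 * (Im \<delta>)\<^sup>2 < (S1 * S3 - S2 * Re \<delta>) * (S1 * S2 - S3 * Re \<delta>)"
    proof (cases "d4 \<ge> 0")
      case True
      then have D: "Re \<delta> = sqrt d4" "Im \<delta> = 0" by (simp_all add: \<delta>_def)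
      have "(S2 * sqrt d4)\<^sup>2 < (S1 * S3)\<^sup>2" "(S3 * sqrt d4)\<^sup>2 < (S1 * S2)\<^sup>2"
      proof -
        have "d2 * d4 < d1 * d3" "d3 * d4 < d1 * d2"
          using dd zero_less_power[OF k(1), of 2] zero_less_power[OF k(2), of 2] by linarith+
        then show "(S2 * sqrt d4)\<^sup>2 < (S1 * S3)\<^sup>2" "(S3 * sqrt d4)\<^sup>2 < (S1 * S2)\<^sup>2"
          unfolding power_mult_distrib S_sq using True by simp_all
      qed
      then have "S2 * sqrt d4 < S1 * S3" "S3 * sqrt d4 < S1 * S2"
        using S_pos by (auto intro: power2_less_imp_less)
      then show ?thesis unfolding D by simp
    next
      case False
      then have D: "Re \<delta> = 0" "Im \<delta> = sqrt (- d4)" by (simp_all add: \<delta>_def csqrt_of_real_nonpos)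
      have "S2 * S3 * (- d4) < S2 * S3 * S1\<^sup>2"
        unfolding S_sq using S_pos dpos(4) by (intro mult_strict_left_mono) auto
      then show ?thesis unfolding D using False S_pos by (simp add: power2_eq_square mult_ac)
    qed
    then show "S1 * S3 - S2 * Re \<delta> > 0" "S1 * S2 - S3 * Re \<delta> > 0"
      "S2 * S3 * (Im \<delta>)\<^sup>2 < (S1 * S3 - S2 * Re \<delta>) * (S1 * S2 - S3 * Re \<delta>)"
      by blast+
  qed
  have pq: "Re p > 0" "Re q > 0" "\<bar>Im p * Im q\<bar> < Re p * Re q"
  proof -
    show "Re p > 0" "Re q > 0" unfolding reim using key k by simp_all
    have "Im p * Im q = S2 * S3 * (Im \<delta>)\<^sup>2 / (2 * X * Y * (2 * U * V))"
      unfolding reim by (simp add: power2_eq_square)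
    moreover have "0 \<le> S2 * S3 * (Im \<delta>)\<^sup>2 / (2 * X * Y * (2 * U * V))"
      using S_pos XYUV_pos by simp
    ultimately have "\<bar>Im p * Im q\<bar> = S2 * S3 * (Im \<delta>)\<^sup>2 / (2 * X * Y * (2 * U * V))"
      by (simp only: abs_of_nonneg)
    also have "\<dots> < (S1 * S3 - S2 * Re \<delta>) * (S1 * S2 - S3 * Re \<delta>) / (2 * X * Y * (2 * U * V))"
      by (rule divide_strict_right_mono[OF key(3) mult_pos_pos[OF k]])
    finally show "\<bar>Im p * Im q\<bar> < Re p * Re q" unfolding reim by simp
  qed
  have pnz: "p \<noteq> 0" "q \<noteq> 0" using pq by auto
  have FSz: "FS z = of_real (sqrt (c2 * c3) / pi\<^sup>2) * J / (p * q)"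
    unfolding J_def by (rule FS_eq_borchardt_integral[OF cpos pq rel]) (simp_all add: assms(13) p2)
  have FSw: "FS w = of_real (sqrt (c2 * c3) / pi\<^sup>2) * J * (p * q)"
  proof -
    have ip2: "(inverse p)\<^sup>2 = (r13 + r24) / (r13 - r24)" "(inverse q)\<^sup>2 = (r12 + r34) / (r12 - r34)"
      unfolding power_inverse p2 by simp_all
    have "FS w = of_real (sqrt (c2 * c3) / pi\<^sup>2) * J / (inverse p * inverse q)"
      unfolding J_def
      by (rule FS_eq_borchardt_integral[OF cpos inverse_sector[OF pq] inverse_bilinear_relation[OF pnz rel(2)] inverse_bilinear_relation[OF pnz rel(1)]])
         (simp_all add: assms(14) ip2)
    then show ?thesis by (simp add: field_simps)
  qed
  \<comment> \<open>The four means of Borchardt, from which \<open>mz\<close> and \<open>mw\<close> arise as \<open>z\<close> and \<open>w\<close> arise from \<open>c1, c2, c3, c4\<close>.\<close>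
  define e1 e2 e3 e4 where e: "e1 = (a\<^sup>2 + b\<^sup>2 + c\<^sup>2 + d\<^sup>2) / 4" "e2 = (a * b + c * d) / 2" "e3 = (a * c + b * d) / 2" "e4 = (a * d + b * c) / 2"
  have epos: "e1 > 0" "e2 > 0" "e3 > 0" "e4 > 0" unfolding e using pos by (simp_all add: add_pos_pos)
  have J': "complex_of_real (enn2real (borchardt_integral e1 e2 e3 e4)) = J"
    unfolding J_def e by (simp only: sq borchardt_integral_mean_invariant[OF ord, unfolded sq])
  define p' q' where "p' = sqrt 2 * X / S3" and "q' = sqrt 2 * U / S2"
  have p'q': "p' > 0" "q' > 0" unfolding p'_def q'_def using XYUV_pos S_pos by simp_all
  have p'2: "p'\<^sup>2 = 2 * (a * c - b * d) / d3" "q'\<^sup>2 = 2 * (a * b - c * d) / d2"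
    unfolding p'_def q'_def by (simp_all add: power_divide power_mult_distrib XYUV_sq S_sq)
  have rel': "e4 * p'\<^sup>2 + e1 * q'\<^sup>2 - e2 = e3 * p'\<^sup>2 * q'\<^sup>2" "e1 * p'\<^sup>2 + e4 * q'\<^sup>2 - e3 = e2 * p'\<^sup>2 * q'\<^sup>2"
  proof -
    have dabc: "d2 = a\<^sup>2 + b\<^sup>2 - c\<^sup>2 - d\<^sup>2" "d3 = a\<^sup>2 - b\<^sup>2 + c\<^sup>2 - d\<^sup>2" unfolding d_defs sq by simp_all
    have "e4 * (2 * (a * c - b * d)) * d2 + e1 * (2 * (a * b - c * d)) * d3 - e2 * d2 * d3 = e3 * (2 * (a * c - b * d)) * (2 * (a * b - c * d))"
      "e1 * (2 * (a * c - b * d)) * d2 + e4 * (2 * (a * b - c * d)) * d3 - e3 * d2 * d3 = e2 * (2 * (a * c - b * d)) * (2 * (a * b - c * d))"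
      unfolding e dabc by (simp_all add: power2_eq_square field_simps)
    then show "e4 * p'\<^sup>2 + e1 * q'\<^sup>2 - e2 = e3 * p'\<^sup>2 * q'\<^sup>2" "e1 * p'\<^sup>2 + e4 * q'\<^sup>2 - e3 = e2 * p'\<^sup>2 * q'\<^sup>2"
      unfolding p'2 using dpos by (simp_all add: divide_simps) (simp_all add: mult_ac)
  qed
  have relc': "of_real e4 * (of_real p')\<^sup>2 + of_real e1 * (of_real q')\<^sup>2 - of_real e2 = of_real e3 * (of_real p')\<^sup>2 * (of_real q' :: complex)\<^sup>2"
    "of_real e1 * (of_real p')\<^sup>2 + of_real e4 * (of_real q')\<^sup>2 - of_real e3 = of_real e2 * (of_real p')\<^sup>2 * (of_real q' :: complex)\<^sup>2"
    unfolding of_real_power[symmetric] of_real_mult[symmetric] of_real_add[symmetric] of_real_diff[symmetric] rel' by simp_all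
  have pq': "Re (complex_of_real p') > 0" "Re (complex_of_real q') > 0"
    "\<bar>Im (complex_of_real p') * Im (complex_of_real q')\<bar> < Re (complex_of_real p') * Re (complex_of_real q')"
    using p'q' by simp_all
  have sqrte: "sqrt (e2 * e3) = V * Y / 2"
  proof (rule real_sqrt_unique)
    show "(V * Y / 2)\<^sup>2 = e2 * e3" unfolding e by (simp add: power_divide power_mult_distrib XYUV_sq)
    show "0 \<le> V * Y / 2" using XYUV_pos by simp
  qed
  have d1e: "d1 = 4 * e1" unfolding e d_defs sq by simp
  have ratio: "e4 / e2 = (a * d + b * c) / (a * b + c * d)" "e1 / e3 = 2 * e1 / (a * c + b * d)"
    "e1 / e2 = 2 * e1 / (a * b + c * d)" "e4 / e3 = (a * d + b * c) / (a * c + b * d)"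
  proof -
    have "x / 2 / (y / 2) = x / y" "x / (y / 2) = 2 * x / y" for x y :: real by simp_all
    then show "e4 / e2 = (a * d + b * c) / (a * b + c * d)" "e1 / e3 = 2 * e1 / (a * c + b * d)"
      "e1 / e2 = 2 * e1 / (a * b + c * d)" "e4 / e3 = (a * d + b * c) / (a * c + b * d)"
      unfolding e(2,3,4) by metis+
  qed
  define T where "T = a * d + b * c"
  have mz_entries:
    "1 - 2 * (a * d + b * c) * (a * c - b * d) / ((a * b + c * d) * d3) = 1 - e4 / e2 * p'\<^sup>2"
    "1 - (a * c - b * d) * (4 * e1) / ((a * c + b * d) * d3) = 1 - e1 / e3 * p'\<^sup>2"
    "1 - (a * b - c * d) * (4 * e1) / ((a * b + c * d) * d2) = 1 - e1 / e2 * q'\<^sup>2"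
    "1 - 2 * (a * d + b * c) * (a * b - c * d) / ((a * c + b * d) * d2) = 1 - e4 / e3 * q'\<^sup>2"
    unfolding p'2 ratio XYUV_sq[symmetric] T_def[symmetric] by (simp_all add: mult_ac)
  have mw_entries:
    "1 - (a * d + b * c) * d3 / (2 * (a * b + c * d) * (a * c - b * d)) = 1 - e4 / e2 * (inverse p')\<^sup>2" (is ?m1)
    "1 - 4 * e1 * d3 / (4 * (c1 * c3 - c2 * c4)) = 1 - e1 / e3 * (inverse p')\<^sup>2" (is ?m2)
    "1 - 4 * e1 * d2 / (4 * (c1 * c2 - c3 * c4)) = 1 - e1 / e2 * (inverse q')\<^sup>2" (is ?m3)
    "1 - (a * d + b * c) * d2 / (2 * (a * c + b * d) * (a * b - c * d)) = 1 - e4 / e3 * (inverse q')\<^sup>2" (is ?m4)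
  proof -
    have "c1 * c3 - c2 * c4 = (a * c + b * d) * (a * c - b * d)" "c1 * c2 - c3 * c4 = (a * b + c * d) * (a * b - c * d)"
      unfolding sq[symmetric] by (simp_all add: power2_eq_square algebra_simps)
    then show ?m1 ?m2 ?m3 ?m4
      unfolding power_inverse p'2 ratio XYUV_sq[symmetric] T_def[symmetric] by (simp_all add: mult_ac)
  qed
  have FSmz: "FS mz = of_real (sqrt (e2 * e3) / pi\<^sup>2) * J / (of_real p' * of_real q')"
    unfolding J'[symmetric]
    by (rule FS_eq_borchardt_integral[OF epos pq' relc'])
       (simp_all only: assms(15) vector_2 sqrts d1e mz_entries, simp_all)
  have FSmw: "FS mw = of_real (sqrt (e2 * e3) / pi\<^sup>2) * J * (of_real p' * of_real q')"
  proof -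
    have p'nz: "complex_of_real p' \<noteq> 0" "complex_of_real q' \<noteq> 0" using p'q' by auto
    have "FS mw = of_real (sqrt (e2 * e3) / pi\<^sup>2) * J / (inverse (of_real p') * inverse (of_real q'))"
      unfolding J'[symmetric]
      by (rule FS_eq_borchardt_integral[OF epos inverse_sector[OF pq'] inverse_bilinear_relation[OF p'nz relc'(2)] inverse_bilinear_relation[OF p'nz relc'(1)]])
         (simp_all only: assms(16) vector_2 sqrts d1e mw_entries, simp_all)
    then show ?thesis by (simp add: field_simps)
  qed
  have sd: "sqrt (d2 * d3) = S2 * S3" unfolding S by (simp add: real_sqrt_mult)
  have sd4: "sqrt (c2 * c3 * d2 * d3) = sqrt (c2 * c3) * (S2 * S3)" unfolding S by (simp add: real_sqrt_mult)
  have pp: "p' * q' = 2 * (X * U) / (S2 * S3)"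
    unfolding p'_def q'_def by (simp add: mult_ac)
  have pc: "of_real p' * of_real q' = complex_of_real (2 * (X * U) / (S2 * S3))"
    unfolding pp[symmetric] by simp
  have bc: "sqrt (c2 * c3) > 0" using cpos by simp
  have UX: "sqrt (c1 * c2) - sqrt (c3 * c4) = U\<^sup>2" "sqrt (c1 * c3) - sqrt (c2 * c4) = X\<^sup>2"
    unfolding sqrts XYUV_sq by simp_all
  have sum_p: "(r12 + r34) * (r13 + r24) * (p * q) = of_real (4 * (X * Y * U * V))"
  proof -
    have "(r12 + r34) * (r13 + r24) * (p * q) = ((r13 - r24) * (r13 + r24)) * ((r12 - r34) * (r12 + r34)) / (of_real (2 * X * Y) * of_real (2 * U * V))"
      unfolding p_def q_def by simp
    also have "\<dots> = of_real (4 * (X * Y * U * V))"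
      unfolding rr of_real_mult[symmetric] of_real_divide[symmetric] using k
      by (simp add: power2_eq_square)
    finally show ?thesis .
  qed
  have "FS mz = 1 / 16 * ((complex_of_real (sqrt (d2 * d3)) * (r12 - r34) * (r13 - r24))
        / complex_of_real (sqrt (c2 * c3) * (sqrt (c1 * c2) - sqrt (c3 * c4))
                             * (sqrt (c1 * c3) - sqrt (c2 * c4)))) * FS z"
  proof -
    have A: "r13 - r24 = p * of_real (2 * X * Y)" "r12 - r34 = q * of_real (2 * U * V)"
      unfolding p_def q_def using XYUV_pos by simp_all
    have "1 / 16 * ((complex_of_real (sqrt (d2 * d3)) * (r12 - r34) * (r13 - r24))
        / complex_of_real (sqrt (c2 * c3) * (sqrt (c1 * c2) - sqrt (c3 * c4)) * (sqrt (c1 * c3) - sqrt (c2 * c4)))) * FS z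
      = of_real (1 / 16 * (S2 * S3 * (2 * U * V) * (2 * X * Y) / (sqrt (c2 * c3) * U\<^sup>2 * X\<^sup>2)) * (sqrt (c2 * c3) / pi\<^sup>2)) * J"
      unfolding sd UX A FSz using pnz by (simp add: mult_ac)
    also have "1 / 16 * (S2 * S3 * (2 * U * V) * (2 * X * Y) / (sqrt (c2 * c3) * U\<^sup>2 * X\<^sup>2)) * (sqrt (c2 * c3) / pi\<^sup>2)
      = V * Y / 2 / pi\<^sup>2 / (2 * (X * U) / (S2 * S3))"
      using XYUV_pos S_pos bc cpos by (simp add: field_simps power2_eq_square)
    also have "of_real \<dots> * J = FS mz"
      unfolding FSmz pc sqrte by simp
    finally show ?thesis ..
  qed
  moreover have "FS mw =
      ((r12 + r34) * (r13 + r24)) / complex_of_real (4 * sqrt (c2 * c3 * d2 * d3)) * FS w"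
  proof -
    have "((r12 + r34) * (r13 + r24)) / complex_of_real (4 * sqrt (c2 * c3 * d2 * d3)) * FS w
      = ((r12 + r34) * (r13 + r24) * (p * q)) * (of_real (sqrt (c2 * c3) / pi\<^sup>2) / of_real (4 * (sqrt (c2 * c3) * (S2 * S3))) * J)"
      unfolding FSw sd4 by (simp add: mult_ac)
    also have "\<dots> = FS mw"
      unfolding sum_p FSmw pc sqrte using XYUV_pos S_pos bc cpos by (simp add: field_simps)
    finally show ?thesis ..
  qed
  ultimately show ?thesis ..
qed

end
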